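(* Let $d\ge1$, let $G=(V,E)$ be a graph and let $u,v$ be nonadjacent vertices of $G$. If $G$ is $d$-joined, then $G+uv$ is $d$-joined.
   Context: A $d$-dimensional realization of $G=(V,E)$ is a pair $(G,p)$ with $p:V\to\mathbb{R}^d$; it is generic if the $d|V|$ coordinates of $p$ are algebraically independent over $\mathbb{Q}$. $(G,p),(G,q)$ are equivalent if $\|p(x)-p(y)\|=\|q(x)-q(y)\|$ for all edges $xy$, congruent if this holds for all pairs of vertices. $G$ is rigid in $\mathbb{R}^d$ if for a generic realization $(G,p)$ there is $\varepsilon>0$ such that every equivalent $(G,q)$ with $\|p(x)-q(x)\|<\varepsilon$ for all $x$ is congruent to $(G,p)$. A pair $\{x,y\}$ is globally linked in $G$ in $\mathbb{R}^d$ if for every generic realization $(G,p)$ in $\mathbb{R}^d$ and every equivalent realization $(G,q)$ in $\mathbb{R}^d$, $\|p(x)-p(y)\|=\|q(x)-q(y)\|$. $\kappa(G,x,y)$ is the maximum number of internally vertex-disjoint $x$–$y$ paths. $G$ is $d$-joined if $|V|\ge d+1$, $G$ is rigid in $\mathbb{R}^d$, and for all $x,y\in V$: $\{x,y\}$ is globally linked in $G$ in $\mathbb{R}^d$ iff $xy\in E$ or $\kappa(G,x,y)\ge d+1$. *)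

theory Defs
  imports "HOL-Analysis.Analysis" "HOL-Library.Poly_Mapping"
begin

text \<open>
  The dimension \<open>d\<close> is the cardinality of a finite index type \<open>'n\<close>, so that \<open>real ^ 'n\<close> is
  Euclidean \<open>d\<close>-space; it is passed as \<open>TYPE('n)\<close> to notions that mention no realization.
  Realizations are total functions, but only their values on \<open>V\<close> matter.
\<close>

definition simple_graph :: "'a set \<Rightarrow> 'a set set \<Rightarrow> bool" where
  "simple_graph V E \<longleftrightarrow> finite V \<and> (\<forall>e\<in>E. e \<subseteq> V \<and> card e = 2)"

text \<open>
  \<open>('k \<Rightarrow>\<^sub>0 nat) \<Rightarrow>\<^sub>0 rat\<close> is the type of polynomials over the rationals in indeterminates
  indexed by \<open>'k\<close>: monomials are finitely supported exponent vectors.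
\<close>

definition rat_mpoly_eval :: "('k \<Rightarrow> real) \<Rightarrow> (('k \<Rightarrow>\<^sub>0 nat) \<Rightarrow>\<^sub>0 rat) \<Rightarrow> real" where
  "rat_mpoly_eval c P =
     (\<Sum>m\<in>Poly_Mapping.keys P. of_rat (Poly_Mapping.lookup P m) *
        (\<Prod>k\<in>Poly_Mapping.keys m. c k ^ Poly_Mapping.lookup m k))"

text \<open>Algebraic independence over the rationals of the indexed family \<open>(c k)\<close>, \<open>k \<in> K\<close>
  (in particular, the family has no repetitions).\<close>

definition alg_independent_rat :: "'k set \<Rightarrow> ('k \<Rightarrow> real) \<Rightarrow> bool" where
  "alg_independent_rat K c \<longleftrightarrow>
     (\<forall>P :: ('k \<Rightarrow>\<^sub>0 nat) \<Rightarrow>\<^sub>0 rat.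
        (\<forall>m\<in>Poly_Mapping.keys P. Poly_Mapping.keys m \<subseteq> K) \<and> rat_mpoly_eval c P = 0 \<longrightarrow> P = 0)"

definition generic :: "'a set \<Rightarrow> ('a \<Rightarrow> real ^ 'n) \<Rightarrow> bool" where
  "generic V p \<longleftrightarrow> alg_independent_rat (V \<times> (UNIV :: 'n set)) (\<lambda>(x, i). p x $ i)"

definition equivalent :: "'a set set \<Rightarrow> ('a \<Rightarrow> real ^ 'n) \<Rightarrow> ('a \<Rightarrow> real ^ 'n) \<Rightarrow> bool" where
  "equivalent E p q \<longleftrightarrow> (\<forall>x y. {x, y} \<in> E \<longrightarrow> norm (p x - p y) = norm (q x - q y))"

definition congruent_on :: "'a set \<Rightarrow> ('a \<Rightarrow> real ^ 'n) \<Rightarrow> ('a \<Rightarrow> real ^ 'n) \<Rightarrow> bool" where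
  "congruent_on V p q \<longleftrightarrow> (\<forall>x\<in>V. \<forall>y\<in>V. norm (p x - p y) = norm (q x - q y))"

text \<open>``A generic realization'' is read as ``every generic realization''.\<close>

definition rigid :: "'n::finite itself \<Rightarrow> 'a set \<Rightarrow> 'a set set \<Rightarrow> bool" where
  "rigid _ V E \<longleftrightarrow>
     (\<forall>p :: 'a \<Rightarrow> real ^ 'n. generic V p \<longrightarrow>
        (\<exists>\<epsilon>>0. \<forall>q :: 'a \<Rightarrow> real ^ 'n.
           equivalent E p q \<and> (\<forall>x\<in>V. norm (p x - q x) < \<epsilon>) \<longrightarrow> congruent_on V p q))"

definition globally_linked ::
    "'n::finite itself \<Rightarrow> 'a set \<Rightarrow> 'a set set \<Rightarrow> 'a \<Rightarrow> 'a \<Rightarrow> bool" where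
  "globally_linked _ V E x y \<longleftrightarrow>
     (\<forall>p q :: 'a \<Rightarrow> real ^ 'n. generic V p \<and> equivalent E p q \<longrightarrow>
        norm (p x - p y) = norm (q x - q y))"

definition is_path :: "'a set \<Rightarrow> 'a set set \<Rightarrow> 'a \<Rightarrow> 'a \<Rightarrow> 'a list \<Rightarrow> bool" where
  "is_path V E x y xs \<longleftrightarrow>
     xs \<noteq> [] \<and> hd xs = x \<and> last xs = y \<and> distinct xs \<and> set xs \<subseteq> V \<and>
     successively (\<lambda>a b. {a, b} \<in> E) xs"

definition internally_disjoint_paths ::
    "'a set \<Rightarrow> 'a set set \<Rightarrow> 'a \<Rightarrow> 'a \<Rightarrow> 'a list set \<Rightarrow> bool" where
  "internally_disjoint_paths V E x y \<P> \<longleftrightarrow>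
     (\<forall>xs\<in>\<P>. is_path V E x y xs) \<and>
     (\<forall>xs\<in>\<P>. \<forall>ys\<in>\<P>. xs \<noteq> ys \<longrightarrow> set xs \<inter> set ys \<subseteq> {x, y})"

text \<open>For finite \<open>V\<close> there are only finitely many paths, so the maximum exists.
  An edge \<open>xy\<close> contributes the single path \<open>[x, y]\<close>.\<close>

definition kappa :: "'a set \<Rightarrow> 'a set set \<Rightarrow> 'a \<Rightarrow> 'a \<Rightarrow> nat" where
  "kappa V E x y = Max {card \<P> |\<P>. internally_disjoint_paths V E x y \<P>}"

text \<open>Only pairs of distinct vertices are considered: \<open>kappa V E x x\<close> counts just the
  trivial path.\<close>

definition d_joined :: "'n::finite itself \<Rightarrow> 'a set \<Rightarrow> 'a set set \<Rightarrow> bool" where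
  "d_joined T V E \<longleftrightarrow>
     card V \<ge> CARD('n) + 1 \<and> rigid T V E \<and>
     (\<forall>x\<in>V. \<forall>y\<in>V. x \<noteq> y \<longrightarrow>
        (globally_linked T V E x y \<longleftrightarrow> {x, y} \<in> E \<or> kappa V E x y \<ge> CARD('n) + 1))"

lemma finite_kappa_set:
  assumes "finite V"
  shows "finite {card \<P> |\<P>. internally_disjoint_paths V E x y \<P>}"
proof -
  have "finite {xs. set xs \<subseteq> V \<and> distinct xs}"
    using assms by (rule finite_subset_distinct)
  moreover have "{\<P>. internally_disjoint_paths V E x y \<P>} \<subseteq> Pow {xs. set xs \<subseteq> V \<and> distinct xs}"
    by (auto simp: internally_disjoint_paths_def is_path_def)
  ultimately have "finite {\<P>. internally_disjoint_paths V E x y \<P>}"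
    by (meson finite_Pow_iff finite_subset)
  then show ?thesis by simp
qed

end

theory Submission
  imports Defs "HOL-Probability.Discrete_Topology"
begin

text \<open>
  Write \<open>d\<close> for the dimension, let \<open>G = (V, E)\<close>, and let \<open>L\<close> be the graph of globally linked pairs of \<open>G\<close>.
  If no generic realization exists, all pairs are globally linked and the claim is monotone in \<open>E\<close>.
  Otherwise rigidity yields a generic \<open>p\<close> with only trivial infinitesimal motions. Exhibiting nontrivial
  infinitesimal motions shows that \<open>G\<close> has no separator with fewer than \<open>d\<close> vertices and that no two
  separators with \<open>d\<close> vertices cross. By Menger's theorem, nonadjacent vertices of \<open>L\<close> are therefore
  separated by a clique of \<open>L\<close> with \<open>d\<close> vertices, so that \<open>L\<close> is a tree-like union of
  \<open>(d + 1)\<close>-cliques (chambers) in which neighbouring ones share \<open>d\<close> vertices (a wall).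

  Let \<open>p\<close> be generic and \<open>q\<close> equivalent to \<open>p\<close> in \<open>G + uv\<close>. Along a shortest gallery of chambers from \<open>u\<close>
  to \<open>v\<close>, the isometries taking \<open>p\<close> to \<open>q\<close> on successive chambers agree or differ by the reflection in
  the wall. As the distance of \<open>u\<close> and \<open>v\<close> is preserved, genericity excludes reflections.
  If the distance of \<open>x\<close> and \<open>y\<close> is not preserved, some wall \<open>S\<close> on a shortest gallery from \<open>x\<close> to \<open>y\<close> carries
  a reflection. If \<open>u\<close> and \<open>v\<close> were in the two components of \<open>G - S\<close> that contain \<open>x\<close> and \<open>y\<close>, then the gallery
  from \<open>u\<close> to \<open>v\<close> would cross \<open>S\<close> without a reflection; hence \<open>S\<close> also separates \<open>x\<close> from \<open>y\<close> in \<open>G + uv\<close>.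
\<close>

section \<open>Genericity\<close>

text \<open>After adding \<open>uv\<close> the delicate direction leads from \<open>kappa\<close> to
  linkedness: a pair may gain disjoint paths and must then be shown to be globally linked. This is
  done by contraposition: a single equivalent \<open>q\<close> that changes the distance of
  \<open>x\<close> and \<open>y\<close> has to produce a separator of d vertices in the enlarged
  graph. \<open>L\<close> replaces \<open>G\<close> because its pairs have fixed distances and its
  separators of d vertices are cliques: d + 1 clique vertices in general position pin an isometry
  down, and d of them leave just one reflection open. Galleries are shortest because then the first
  bent wall has a vertex that lies on no later bent wall. Moving this vertex changes one factor of
  the product of reflections, which is what contradicts genericity; otherwise reflections might
  cancel. Separators are treated by infinitesimal motions since these solve linear systems, where
  counting unknowns suffices, whereas rigidity speaks of finite motions near a generic point. The
  case distinction on the existence of a generic realization spares a count of transcendence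
  degrees.\<close>

definition mono_eval :: "('k \<Rightarrow> real) \<Rightarrow> ('k \<Rightarrow>\<^sub>0 nat) \<Rightarrow> real" where
  "mono_eval c m = (\<Prod>k\<in>Poly_Mapping.keys m. c k ^ Poly_Mapping.lookup m k)"

lemma mono_eval_superset:
  assumes "finite A" "Poly_Mapping.keys m \<subseteq> A"
  shows "mono_eval c m = (\<Prod>k\<in>A. c k ^ Poly_Mapping.lookup m k)"
  unfolding mono_eval_def
  by (rule prod.mono_neutral_left) (use assms in \<open>auto simp: in_keys_iff\<close>)

lemma mono_eval_add: "mono_eval c (m + m') = mono_eval c m * mono_eval c m'"
proof -
  let ?A = "Poly_Mapping.keys m \<union> Poly_Mapping.keys m'"
  have "mono_eval c (m + m') = (\<Prod>k\<in>?A. c k ^ Poly_Mapping.lookup (m + m') k)"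
    by (rule mono_eval_superset) (auto intro!: keys_add[THEN subsetD])
  also have "\<dots> = (\<Prod>k\<in>?A. c k ^ Poly_Mapping.lookup m k) * (\<Prod>k\<in>?A. c k ^ Poly_Mapping.lookup m' k)"
    by (simp add: lookup_add power_add prod.distrib)
  also have "\<dots> = mono_eval c m * mono_eval c m'"
    by (subst (1 2) mono_eval_superset[where A = ?A]) auto
  finally show ?thesis .
qed

lemma rat_mpoly_eval_superset:
  assumes "finite A" "Poly_Mapping.keys P \<subseteq> A"
  shows "rat_mpoly_eval c P = (\<Sum>m\<in>A. of_rat (Poly_Mapping.lookup P m) * mono_eval c m)"
  unfolding rat_mpoly_eval_def mono_eval_def[symmetric]
  by (rule sum.mono_neutral_left) (use assms in \<open>auto simp: in_keys_iff\<close>)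

lemma rat_mpoly_eval_add:
  "rat_mpoly_eval c (P + Q) = rat_mpoly_eval c P + rat_mpoly_eval c Q"
proof -
  let ?A = "Poly_Mapping.keys P \<union> Poly_Mapping.keys Q"
  have "rat_mpoly_eval c (P + Q) =
      (\<Sum>m\<in>?A. of_rat (Poly_Mapping.lookup (P + Q) m) * mono_eval c m)"
    by (rule rat_mpoly_eval_superset) (auto intro!: keys_add[THEN subsetD])
  also have "\<dots> = (\<Sum>m\<in>?A. of_rat (Poly_Mapping.lookup P m) * mono_eval c m) +
      (\<Sum>m\<in>?A. of_rat (Poly_Mapping.lookup Q m) * mono_eval c m)"
    by (simp add: lookup_add of_rat_add distrib_right sum.distrib)
  also have "\<dots> = rat_mpoly_eval c P + rat_mpoly_eval c Q"
    by (subst (1 2) rat_mpoly_eval_superset[where A = ?A]) auto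
  finally show ?thesis .
qed

lemma rat_mpoly_eval_single:
  "rat_mpoly_eval c (Poly_Mapping.single m a) = of_rat a * mono_eval c m"
  by (subst rat_mpoly_eval_superset[where A = "{m}"]) auto

lemma rat_mpoly_eval_zero [simp]: "rat_mpoly_eval c 0 = 0"
  by (simp add: rat_mpoly_eval_def)

lemma rat_mpoly_eval_sum:
  "rat_mpoly_eval c (\<Sum>i\<in>I. P i) = (\<Sum>i\<in>I. rat_mpoly_eval c (P i))"
  by (induction I rule: infinite_finite_induct) (auto simp: rat_mpoly_eval_add)

lemma sum_single_lookup:
  "(\<Sum>m\<in>Poly_Mapping.keys P. Poly_Mapping.single m (Poly_Mapping.lookup P m)) = P"
  by (rule poly_mapping_eqI) (auto simp: lookup_sum lookup_single when_def in_keys_iff)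

lemma rat_mpoly_eval_mult:
  "rat_mpoly_eval c (P * Q) = rat_mpoly_eval c P * rat_mpoly_eval c Q"
proof -
  let ?s = "\<lambda>P m. Poly_Mapping.single m (Poly_Mapping.lookup P m)"
  have "P * Q = (\<Sum>m\<in>Poly_Mapping.keys P. ?s P m) * (\<Sum>m\<in>Poly_Mapping.keys Q. ?s Q m)"
    by (simp only: sum_single_lookup)
  also have "\<dots> = (\<Sum>m\<in>Poly_Mapping.keys P. \<Sum>m'\<in>Poly_Mapping.keys Q. 
      Poly_Mapping.single (m + m') (Poly_Mapping.lookup P m * Poly_Mapping.lookup Q m'))"
    by (simp add: sum_product mult_single)
  finally have "rat_mpoly_eval c (P * Q) = (\<Sum>m\<in>Poly_Mapping.keys P. \<Sum>m'\<in>Poly_Mapping.keys Q. 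
      of_rat (Poly_Mapping.lookup P m) * mono_eval c m * (of_rat (Poly_Mapping.lookup Q m') * mono_eval c m'))"
    by (simp add: rat_mpoly_eval_sum rat_mpoly_eval_single mono_eval_add of_rat_mult mult_ac)
  also have "\<dots> = rat_mpoly_eval c P * rat_mpoly_eval c Q"
    by (simp add: rat_mpoly_eval_def mono_eval_def sum_product)
  finally show ?thesis .
qed

text \<open>Rational polynomial functions in the variables from \<open>K\<close>, given by closure
  rules: that a determinant or an inner product is polynomial is then settled by introduction rules,
  and monomials are handled only in the bridge to \<open>rat_mpoly_eval\<close>.\<close>

inductive polyfun :: "'k set \<Rightarrow> (('k \<Rightarrow> real) \<Rightarrow> real) \<Rightarrow> bool" for K where
  of_rat: "polyfun K (\<lambda>c. of_rat r)"
| coord: "k \<in> K \<Longrightarrow> polyfun K (\<lambda>c. c k)"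
| add: "polyfun K f \<Longrightarrow> polyfun K g \<Longrightarrow> polyfun K (\<lambda>c. f c + g c)"
| mult: "polyfun K f \<Longrightarrow> polyfun K g \<Longrightarrow> polyfun K (\<lambda>c. f c * g c)"

lemma polyfun_rat_mpoly:
  fixes K :: "'k set"
  assumes "polyfun K f"
  shows "\<exists>P :: ('k \<Rightarrow>\<^sub>0 nat) \<Rightarrow>\<^sub>0 rat. (\<forall>m\<in>Poly_Mapping.keys P. Poly_Mapping.keys m \<subseteq> K) \<and>
           (\<forall>c. f c = rat_mpoly_eval c P)"
  using assms
proof (induction rule: polyfun.induct)
  case (of_rat r)
  show ?case
    by (rule exI[of _ "Poly_Mapping.single 0 r"])
       (auto simp: rat_mpoly_eval_single mono_eval_def split: if_splits)
next
  case (coord k)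
  then show ?case
    by (intro exI[of _ "Poly_Mapping.single (Poly_Mapping.single k 1) 1"])
       (auto simp: rat_mpoly_eval_single mono_eval_def split: if_splits)
next
  case (add f g)
  then obtain P Q :: "('k \<Rightarrow>\<^sub>0 nat) \<Rightarrow>\<^sub>0 rat"
    where "\<forall>m\<in>Poly_Mapping.keys P. Poly_Mapping.keys m \<subseteq> K" "\<forall>c. f c = rat_mpoly_eval c P"
      "\<forall>m\<in>Poly_Mapping.keys Q. Poly_Mapping.keys m \<subseteq> K" "\<forall>c. g c = rat_mpoly_eval c Q"
    by auto
  then show ?case
    using keys_add[of P Q] by (intro exI[of _ "P + Q"]) (simp add: rat_mpoly_eval_add, blast)
next
  case (mult f g)
  then obtain P Q :: "('k \<Rightarrow>\<^sub>0 nat) \<Rightarrow>\<^sub>0 rat"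
    where PQ: "\<forall>m\<in>Poly_Mapping.keys P. Poly_Mapping.keys m \<subseteq> K" "\<forall>c. f c = rat_mpoly_eval c P"
      "\<forall>m\<in>Poly_Mapping.keys Q. Poly_Mapping.keys m \<subseteq> K" "\<forall>c. g c = rat_mpoly_eval c Q"
    by auto
  have "Poly_Mapping.keys m \<subseteq> K" if m: "m \<in> Poly_Mapping.keys (P * Q)" for m
  proof -
    obtain a b where "a \<in> Poly_Mapping.keys P" "b \<in> Poly_Mapping.keys Q" "m = a + b"
      using m keys_mult[of P Q] by auto
    then show ?thesis
      using PQ keys_add[of a b] by blast
  qed
  then show ?case
    by (intro exI[of _ "P * Q"]) (use PQ in \<open>auto simp: rat_mpoly_eval_mult\<close>)
qed

text \<open>A representing polynomial that vanishes at an independent \<open>c\<close> is 0, so the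
  function vanishes identically. Genericity is later exploited by choosing a convenient
  \<open>c'\<close>.\<close>

lemma polyfun_eq_0_of_alg_independent:
  assumes "alg_independent_rat K c" "polyfun K f" "f c = 0"
  shows "f c' = 0"
  using assms polyfun_rat_mpoly[OF assms(2)]
  unfolding alg_independent_rat_def by (metis rat_mpoly_eval_zero)

lemma polyfun_uminus: "polyfun K f \<Longrightarrow> polyfun K (\<lambda>c. - f c)"
  using polyfun.mult[OF polyfun.of_rat[of K "-1"], of f] by (simp add: of_rat_minus)

lemma polyfun_diff: "polyfun K f \<Longrightarrow> polyfun K g \<Longrightarrow> polyfun K (\<lambda>c. f c - g c)"
  using polyfun.add[OF _ polyfun_uminus[of K g], of f] by simp

lemma polyfun_numeral: "polyfun K (\<lambda>c. numeral n)"
  using polyfun.of_rat[of K "numeral n"] by simp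

lemma polyfun_0: "polyfun K (\<lambda>c. 0)"
  using polyfun.of_rat[of K 0] by simp

lemma polyfun_1: "polyfun K (\<lambda>c. 1)"
  using polyfun.of_rat[of K 1] by simp

lemma polyfun_sum: "(\<And>i. i \<in> I \<Longrightarrow> polyfun K (f i)) \<Longrightarrow> polyfun K (\<lambda>c. \<Sum>i\<in>I. f i c)"
  by (induction I rule: infinite_finite_induct) (auto intro: polyfun_0 polyfun.add)

lemma polyfun_prod: "(\<And>i. i \<in> I \<Longrightarrow> polyfun K (f i)) \<Longrightarrow> polyfun K (\<lambda>c. \<Prod>i\<in>I. f i c)"
  by (induction I rule: infinite_finite_induct) (auto intro: polyfun_1 polyfun.mult)

lemma polyfun_power: "polyfun K f \<Longrightarrow> polyfun K (\<lambda>c. f c ^ n)"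
  by (induction n) (auto intro: polyfun_1 polyfun.mult)

lemmas polyfun_intros = polyfun.intros polyfun_uminus polyfun_diff polyfun_numeral polyfun_0
  polyfun_1 polyfun_sum polyfun_prod polyfun_power

lemma polyfun_det:
  fixes A :: "('k \<Rightarrow> real) \<Rightarrow> real ^ 'n ^ 'n"
  assumes "\<And>i j. polyfun K (\<lambda>c. A c $ i $ j)"
  shows "polyfun K (\<lambda>c. det (A c))"
proof -
  have "polyfun K (\<lambda>c. of_int (sign \<pi>))" for \<pi> :: "'n \<Rightarrow> 'n"
    using polyfun.of_rat[of K "of_int (sign \<pi>)"] by simp
  then show ?thesis
    unfolding det_def by (intro polyfun_intros assms)
qed

lemma polyfun_translate:
  assumes "polyfun K f"
  shows "polyfun K (\<lambda>c. f (\<lambda>k. c k + of_rat (r k)))"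
  using assms by (induction rule: polyfun.induct) (auto intro: polyfun_intros)

lemma polyfun_rat_mpoly_eval:
  assumes "\<forall>m\<in>Poly_Mapping.keys P. Poly_Mapping.keys m \<subseteq> K"
  shows "polyfun K (\<lambda>c. rat_mpoly_eval c P)"
  unfolding rat_mpoly_eval_def by (intro polyfun_intros) (use assms in auto)

text \<open>A relation for the translate is a polynomial function of \<open>c\<close> that vanishes
  at \<open>c\<close>, hence everywhere, in particular at \<open>c k - r k\<close>, where it becomes
  a relation for \<open>c\<close> itself.\<close>

lemma alg_independent_rat_translate:
  assumes "alg_independent_rat K c"
  shows "alg_independent_rat K (\<lambda>k. c k + of_rat (r k))"
  unfolding alg_independent_rat_def
proof (intro allI impI)
  fix P :: "('a \<Rightarrow>\<^sub>0 nat) \<Rightarrow>\<^sub>0 rat"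
  assume P: "(\<forall>m\<in>Poly_Mapping.keys P. Poly_Mapping.keys m \<subseteq> K) \<and>
    rat_mpoly_eval (\<lambda>k. c k + of_rat (r k)) P = 0"
  then have *: "rat_mpoly_eval (\<lambda>k. c' k + of_rat (r k)) P = 0" for c'
    using polyfun_eq_0_of_alg_independent[OF assms polyfun_translate[OF polyfun_rat_mpoly_eval]] P
    by blast
  have "rat_mpoly_eval c P = 0"
    using *[of "\<lambda>k. c k - of_rat (r k)"] by simp
  with P assms show "P = 0"
    unfolding alg_independent_rat_def by blast
qed

definition coords :: "('a \<Rightarrow> real ^ 'n) \<Rightarrow> 'a \<times> 'n \<Rightarrow> real" where
  "coords p = (\<lambda>(x, i). p x $ i)"

lemma coords_apply [simp]: "coords p (x, i) = p x $ i"
  by (simp add: coords_def)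

lemma generic_polyfun:
  fixes p q :: "'a \<Rightarrow> real ^ 'n"
  assumes "generic V p" "polyfun (V \<times> (UNIV :: 'n set)) f" "f (coords p) = 0"
  shows "f (coords q) = 0"
  using assms polyfun_eq_0_of_alg_independent unfolding generic_def coords_def by blast

text \<open>Genericity survives rational translations, and rational vectors are dense; so a single
  generic \<open>p\<close> provides generic configurations near any \<open>q\<close>.\<close>

lemma generic_dense:
  fixes p q :: "'a \<Rightarrow> real ^ 'n"
  assumes "generic V p" "e > 0"
  shows "\<exists>p'. generic V p' \<and> (\<forall>x. norm (p' x - q x) < e)"
proof -
  define e' where "e' = e / CARD('n)"
  have "e' > 0" using assms by (simp add: e'_def)
  have "\<exists>r. \<bar>p x $ i + of_rat r - q x $ i\<bar> < e'" for x i
  proof -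
    obtain s where s: "s \<in> \<rat>" "q x $ i - p x $ i < s" "s < q x $ i - p x $ i + e'"
      using Rats_dense_in_real[of "q x $ i - p x $ i" "q x $ i - p x $ i + e'"] \<open>e' > 0\<close> by auto
    then obtain r where "s = of_rat r" by (auto elim: Rats_cases)
    with s show ?thesis by (intro exI[of _ r]) (simp add: abs_less_iff)
  qed
  then obtain r where r: "\<And>x i. \<bar>p x $ i + of_rat (r x i) - q x $ i\<bar> < e'" by metis
  define p' where "p' = (\<lambda>x. \<chi> i. p x $ i + of_rat (r x i))"
  have "(\<lambda>(x, i). p' x $ i) = (\<lambda>k. (\<lambda>(x, i). p x $ i) k + of_rat ((\<lambda>(x, i). r x i) k))"
    by (auto simp: p'_def)
  then have "generic V p'"
    using assms(1) alg_independent_rat_translate unfolding generic_def by metis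
  moreover have "norm (p' x - q x) < e" for x
  proof -
    have "norm (p' x - q x) \<le> (\<Sum>i\<in>UNIV. \<bar>(p' x - q x) $ i\<bar>)"
      by (rule norm_le_l1_cart)
    also have "\<dots> < (\<Sum>i\<in>(UNIV :: 'n set). e')"
      by (rule sum_strict_mono) (auto simp: p'_def r)
    finally show ?thesis by (simp add: e'_def)
  qed
  ultimately show ?thesis by blast
qed

text \<open>Affine independence of any d + 1 vertices. The determinant makes it a polynomial
  condition and gives access to invertible matrices.\<close>

definition general_position :: "'a set \<Rightarrow> ('a \<Rightarrow> real ^ 'n) \<Rightarrow> bool" where
  "general_position V p \<longleftrightarrow>
     (\<forall>(\<sigma> :: 'n \<Rightarrow> 'a) z. inj \<sigma> \<and> range \<sigma> \<subseteq> V \<and> z \<in> V - range \<sigma> \<longrightarrow>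
        det (\<chi> i. p (\<sigma> i) - p z) \<noteq> 0)"

lemma det_axis_1: "det (\<chi> i. axis i (1 :: real) :: real ^ 'n ^ 'n) = 1"
proof -
  have "(\<chi> i. axis i (1::real)) = (mat 1 :: real ^ 'n ^ 'n)"
    by (simp add: mat_def axis_def vec_eq_iff)
  then show ?thesis by simp
qed

text \<open>The determinant is a polynomial that is not identically zero: with \<open>z\<close> at
  the origin and the \<open>\<sigma> i\<close> at the unit vectors its value is 1.\<close>

lemma generic_imp_general_position:
  fixes p :: "'a \<Rightarrow> real ^ 'n"
  assumes "generic V p"
  shows "general_position V p"
  unfolding general_position_def
proof (intro allI impI notI)
  fix \<sigma> :: "'n \<Rightarrow> 'a" and z
  assume \<sigma>: "inj \<sigma> \<and> range \<sigma> \<subseteq> V \<and> z \<in> V - range \<sigma>"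
    and det: "det (\<chi> i. p (\<sigma> i) - p z) = 0"
  define A :: "('a \<times> 'n \<Rightarrow> real) \<Rightarrow> real ^ 'n ^ 'n"
    where "A = (\<lambda>c. \<chi> i j. c (\<sigma> i, j) - c (z, j))"
  have A_coords: "A (coords q) = (\<chi> i. q (\<sigma> i) - q z)" for q
    by (simp add: A_def vec_eq_iff)
  have poly: "polyfun (V \<times> (UNIV :: 'n set)) (\<lambda>c. det (A c))"
    by (rule polyfun_det) (use \<sigma> in \<open>auto simp: A_def intro!: polyfun_intros\<close>)
  define q :: "'a \<Rightarrow> real ^ 'n" where "q = (\<lambda>y. if y \<in> range \<sigma> then axis (inv \<sigma> y) 1 else 0)"
  have "det (A (coords q)) = 0"
    using generic_polyfun[OF assms poly] det by (simp add: A_coords)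
  moreover have "A (coords q) = (\<chi> i. axis i 1)"
    using \<sigma> by (simp add: A_coords q_def vec_eq_iff)
  ultimately show False by (simp add: det_axis_1)
qed

lemma obtain_enumeration:
  assumes "card W = CARD('n)"
  obtains \<sigma> :: "'n::finite \<Rightarrow> 'a" where "inj \<sigma>" "range \<sigma> = W"
proof -
  have "finite W"
    using assms by (metis card.infinite zero_less_card_finite less_irrefl)
  then obtain \<sigma> where "bij_betw \<sigma> (UNIV :: 'n set) W"
    using assms by (metis finite_same_card_bij finite)
  then show ?thesis using that by (auto simp: bij_betw_def)
qed

text \<open>Among the differences, d are the rows of an invertible matrix, whose kernel is
  trivial.\<close>

lemma general_position_span:
  fixes p :: "'a \<Rightarrow> real ^ 'n"
  assumes "general_position V p" "z \<in> V" "W \<subseteq> V - {z}" "CARD('n) \<le> card W"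
    and "\<And>x. x \<in> W \<Longrightarrow> (p z - p x) \<bullet> v = 0"
  shows "v = 0"
proof -
  obtain W' where W': "W' \<subseteq> W" "card W' = CARD('n)"
    using assms(4) obtain_subset_with_card_n by metis
  then obtain \<sigma> :: "'n \<Rightarrow> 'a" where \<sigma>: "inj \<sigma>" "range \<sigma> = W'"
    using obtain_enumeration by metis
  let ?A = "\<chi> i. p (\<sigma> i) - p z"
  have "det ?A \<noteq> 0"
    using assms(1) \<sigma> W' assms(2,3) unfolding general_position_def by blast
  then have "invertible ?A" by (simp add: invertible_det_nz)
  moreover have "?A *v v = 0"
  proof -
    have "(p (\<sigma> i) - p z) \<bullet> v = 0" for i
      using assms(5)[of "\<sigma> i"] \<sigma> W'
      by (metis inner_diff_left eq_iff_diff_eq_0 rangeI subsetD)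
    then show ?thesis
      by (simp add: vec_eq_iff matrix_vector_mult_def inner_vec_def)
  qed
  ultimately show "v = 0"
    by (metis invertible_left_inverse matrix_left_invertible_ker)
qed

text \<open>The system is completed to d vertices, which is possible because \<open>V\<close> has
  more than d, and then has an invertible matrix.\<close>

lemma general_position_solve:
  fixes p :: "'a \<Rightarrow> real ^ 'n"
  assumes "general_position V p" "finite V" "CARD('n) < card V"
    and "z \<in> V" "W \<subseteq> V - {z}" "card W \<le> CARD('n)"
  shows "\<exists>v. \<forall>x\<in>W. (p z - p x) \<bullet> v = c x"
proof -
  have card: "finite (V - {z})" "CARD('n) \<le> card (V - {z})"
    using assms by auto
  obtain W' where W': "W \<subseteq> W'" "W' \<subseteq> V - {z}" "card W' = CARD('n)"
    using exists_subset_between[of W "CARD('n)" "V - {z}"] assms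
    card by metis
  then obtain \<sigma> :: "'n \<Rightarrow> 'a" where \<sigma>: "inj \<sigma>" "range \<sigma> = W'"
    using obtain_enumeration by metis
  let ?A = "\<chi> i. p (\<sigma> i) - p z"
  have "det ?A \<noteq> 0"
    using assms(1,4) \<sigma> W' unfolding general_position_def by blast
  then have "invertible ?A" by (simp add: invertible_det_nz)
  then obtain B where B: "?A ** B = mat 1" unfolding invertible_def by blast
  \<comment> \<open>The rows are \<open>p (\<sigma> i) - p z\<close>, opposite to the differences in
    the claim; hence the sign.\<close>
  define v where "v = B *v (\<chi> i. - c (\<sigma> i))"
  have "?A *v v = (\<chi> i. - c (\<sigma> i))"
    by (simp add: v_def matrix_vector_mul_assoc B)
  then have "(p (\<sigma> i) - p z) \<bullet> v = - c (\<sigma> i)" for i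
    by (simp add: vec_eq_iff matrix_vector_mult_def inner_vec_def)
  then have "(p z - p (\<sigma> i)) \<bullet> v = c (\<sigma> i)" for i
    by (metis add.inverse_inverse inner_minus_left minus_diff_eq)
  then show ?thesis using W' \<sigma> by blast
qed

text \<open>Coordinates in the basis of rows turn prescribed images of the \<open>a k\<close> into
  an explicit formula, both for infinitesimal and for Euclidean isometries.\<close>

lemma matrix_row_coordinates:
  fixes a :: "'n \<Rightarrow> real ^ 'n"
  assumes "det (\<chi> i. a i) \<noteq> 0"
  shows "\<exists>c. linear c \<and> (\<forall>y. y = (\<Sum>i\<in>UNIV. c y $ i *\<^sub>R a i)) \<and> (\<forall>k. c (a k) = axis k 1)"
proof -
  define A :: "real ^ 'n ^ 'n" where "A = (\<chi> i. a i)"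
  have "invertible A" using assms by (simp add: A_def invertible_det_nz)
  then obtain B where B: "A ** B = mat 1" "B ** A = mat 1" unfolding invertible_def by blast
  define c where "c y = transpose B *v y" for y
  have tA: "transpose A *v x = (\<Sum>i\<in>UNIV. x $ i *\<^sub>R a i)" for x
    by (simp add: vec_eq_iff matrix_vector_mult_def transpose_def A_def mult.commute)
  have "transpose A ** transpose B = mat 1" "transpose B ** transpose A = mat 1"
    using B by (simp_all only: matrix_transpose_mul[symmetric] transpose_mat)
  then have cA: "transpose A *v c y = y" "c (transpose A *v y) = y" for y
    by (simp_all only: c_def matrix_vector_mul_assoc matrix_vector_mul_lid)
  have "transpose A *v axis k 1 = a k" for k
    unfolding tA by (simp add: axis_def if_distrib[of "\<lambda>r. r *\<^sub>R _"] cong: if_cong)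
  then have "c (a k) = axis k 1" for k using cA(2)[of "axis k 1"] by (simp only:)
  moreover have "y = (\<Sum>i\<in>UNIV. c y $ i *\<^sub>R a i)" for y using cA(1)[of y] by (simp only: tA)
  moreover have "linear c" unfolding c_def by (rule matrix_vector_mul_linear)
  ultimately show ?thesis by blast
qed

section \<open>From rigidity to infinitesimal rigidity\<close>

lemma linear_functional_combination:
  fixes \<phi> :: "'i \<Rightarrow> 'x::real_vector \<Rightarrow> real"
  assumes "finite F" "\<And>i. i \<in> F \<Longrightarrow> linear (\<phi> i)" "linear \<psi>"
    and "\<And>z. (\<And>i. i \<in> F \<Longrightarrow> \<phi> i z = 0) \<Longrightarrow> \<psi> z = 0"
  shows "\<exists>c. \<forall>z. \<psi> z = (\<Sum>i\<in>F. c i * \<phi> i z)"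
  using assms
proof (induction F arbitrary: \<psi> rule: finite_induct)
  case empty
  then show ?case by simp
next
  case (insert j F)
  show ?case
  proof (cases "\<exists>w. (\<forall>i\<in>F. \<phi> i w = 0) \<and> \<phi> j w \<noteq> 0")
    case True
    then obtain w where w: "\<And>i. i \<in> F \<Longrightarrow> \<phi> i w = 0" "\<phi> j w \<noteq> 0" by auto
    define a where "a = \<psi> w / \<phi> j w"
    have lin: "linear (\<lambda>z. \<psi> z - a * \<phi> j z)"
      using insert.prems(1)[of j] insert.prems(2)
      by (simp add: linear_iff algebra_simps)
    have "\<exists>c. \<forall>z. \<psi> z - a * \<phi> j z = (\<Sum>i\<in>F. c i * \<phi> i z)"
    proof (rule insert.IH[OF _ lin])
      fix z assume z: "\<And>i. i \<in> F \<Longrightarrow> \<phi> i z = 0"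
      \<comment> \<open>Projection of \<open>z\<close> along \<open>w\<close> to the kernel of
        \<open>\<phi> j\<close>; the functionals of \<open>F\<close> do not notice it.\<close>
      define y where "y = z - (\<phi> j z / \<phi> j w) *\<^sub>R w"
      have "\<phi> i y = 0" if "i \<in> insert j F" for i
        using that insert.prems(1)[of i] z w
        by (auto simp: y_def linear_diff linear_scale)
      then have "\<psi> y = 0" using insert.prems(3) by blast
      then show "\<psi> z - a * \<phi> j z = 0"
        using w insert.prems(2) by (simp add: y_def a_def linear_diff linear_scale)
    qed (use insert.prems in auto)
    then obtain c where c: "\<And>z. \<psi> z - a * \<phi> j z = (\<Sum>i\<in>F. c i * \<phi> i z)" by auto
    show ?thesis
    proof (intro exI allI)
      fix z
      have "(\<Sum>i\<in>insert j F. (c(j := a)) i * \<phi> i z) = a * \<phi> j z + (\<Sum>i\<in>F. (c(j := a)) i * \<phi> i z)"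
        using insert.hyps by simp
      also have "(\<Sum>i\<in>F. (c(j := a)) i * \<phi> i z) = (\<Sum>i\<in>F. c i * \<phi> i z)"
        by (rule sum.cong) (use insert.hyps in auto)
      finally show "\<psi> z = (\<Sum>i\<in>insert j F. (c(j := a)) i * \<phi> i z)" using c[of z] by simp
    qed
  next
    case False
    have "\<exists>c. \<forall>z. \<psi> z = (\<Sum>i\<in>F. c i * \<phi> i z)"
    proof (rule insert.IH)
      fix z assume z: "\<And>i. i \<in> F \<Longrightarrow> \<phi> i z = 0"
      then have "\<phi> j z = 0" using False by blast
      with z show "\<psi> z = 0" using insert.prems(3) by blast
    qed (use insert.prems in auto)
    then obtain c where c: "\<And>z. \<psi> z = (\<Sum>i\<in>F. c i * \<phi> i z)" by auto
    show ?thesis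
    proof (intro exI allI)
      fix z
      have "(\<Sum>i\<in>insert j F. (c(j := 0)) i * \<phi> i z) = (\<Sum>i\<in>F. (c(j := 0)) i * \<phi> i z)"
        using insert.hyps by simp
      also have "\<dots> = (\<Sum>i\<in>F. c i * \<phi> i z)"
        by (rule sum.cong) (use insert.hyps in auto)
      finally show "\<psi> z = (\<Sum>i\<in>insert j F. (c(j := 0)) i * \<phi> i z)" using c[of z] by simp
    qed
  qed
qed

text \<open>If no vector were seen by \<open>\<phi> j\<close> alone, \<open>\<phi> j\<close> would
  be a combination of the other functionals, against independence.\<close>

lemma linear_functional_dual:
  fixes \<phi> :: "'i \<Rightarrow> 'x::real_vector \<Rightarrow> real"
  assumes "finite F" "\<And>i. i \<in> F \<Longrightarrow> linear (\<phi> i)"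
    and indep: "\<And>c. (\<And>z. (\<Sum>i\<in>F. c i * \<phi> i z) = 0) \<Longrightarrow> (\<forall>i\<in>F. c i = 0)"
  shows "\<exists>w. \<forall>i\<in>F. \<forall>j\<in>F. \<phi> i (w j) = (if i = j then 1 else 0)"
proof -
  have "\<exists>w. \<forall>i\<in>F. \<phi> i w = (if i = j then 1 else 0)" if j: "j \<in> F" for j
  proof -
    have "\<exists>w. (\<forall>i\<in>F - {j}. \<phi> i w = 0) \<and> \<phi> j w \<noteq> 0"
    proof (rule ccontr)
      assume "\<not> ?thesis"
      then have "\<exists>c. \<forall>z. \<phi> j z = (\<Sum>i\<in>F - {j}. c i * \<phi> i z)"
        using assms(1,2) j by (intro linear_functional_combination) blast+
      then obtain c where c: "\<And>z. \<phi> j z = (\<Sum>i\<in>F - {j}. c i * \<phi> i z)" by auto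
      have "(\<Sum>i\<in>F. (c(j := - 1)) i * \<phi> i z) = 0" for z
      proof -
        have "(\<Sum>i\<in>F. (c(j := - 1)) i * \<phi> i z) = - \<phi> j z + (\<Sum>i\<in>F - {j}. (c(j := - 1)) i * \<phi> i z)"
          using assms(1) j by (subst sum.remove[of F j]) auto
        also have "(\<Sum>i\<in>F - {j}. (c(j := - 1)) i * \<phi> i z) = (\<Sum>i\<in>F - {j}. c i * \<phi> i z)"
          by (rule sum.cong) auto
        finally show ?thesis using c[of z] by simp
      qed
      from indep[OF this] j show False by auto
    qed
    then obtain w where w: "\<And>i. i \<in> F - {j} \<Longrightarrow> \<phi> i w = 0" "\<phi> j w \<noteq> 0" by auto
    show ?thesis
      by (rule exI[of _ "(1 / \<phi> j w) *\<^sub>R w"]) (use w assms(2) j in \<open>auto simp: linear_scale\<close>)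
  qed
  then show ?thesis by metis
qed

lemma has_derivative_0_of_quadratic_bound:
  fixes g :: "real \<Rightarrow> real"
  assumes "open U" "t \<in> U" "\<And>s. s \<in> U \<Longrightarrow> \<bar>g s - g t\<bar> \<le> C * (s - t)\<^sup>2"
  shows "(g has_real_derivative 0) (at t)"
proof -
  have "((\<lambda>s. (g s - g t) / (s - t)) \<longlongrightarrow> 0) (at t)"
  proof (rule Lim_null_comparison)
    have "\<bar>(g s - g t) / (s - t)\<bar> \<le> C * \<bar>s - t\<bar>" if "s \<in> U" "s \<noteq> t" for s
    proof -
      have "\<bar>(g s - g t) / (s - t)\<bar> \<le> C * (s - t)\<^sup>2 / \<bar>s - t\<bar>"
        using assms(3)[OF that(1)] that(2) by (simp add: divide_right_mono)
      also have "\<dots> = C * \<bar>s - t\<bar>"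
        proof -
        have "C * (s - t)\<^sup>2 / \<bar>s - t\<bar> = C * (\<bar>s - t\<bar> * \<bar>s - t\<bar>) / \<bar>s - t\<bar>"
          by (simp add: power2_eq_square)
        also have "\<dots> = C * \<bar>s - t\<bar>" using that(2) by (simp del: abs_mult_self_eq)
        finally show ?thesis .
      qed
      finally show ?thesis .
    qed
    then show "\<forall>\<^sub>F s in at t. norm ((g s - g t) / (s - t)) \<le> C * \<bar>s - t\<bar>"
      using assms(1,2) by (auto simp: eventually_at_topological)
    show "((\<lambda>s. C * \<bar>s - t\<bar>) \<longlongrightarrow> 0) (at t)"
      by (auto intro!: tendsto_eq_intros)
  qed
  then show ?thesis by (simp add: has_field_derivative_iff)
qed

text \<open>Solve \<open>h = t v - (\<Sum>j\<in>F. b j h h *\<^sub>R w j)\<close> by contraction. Since the squared lengths are quadratic forms,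
  duality of \<open>w\<close> keeps those in \<open>F\<close> exactly constant along \<open>p + h t\<close>. The remaining ones have derivatives in the
  span of those in \<open>F\<close> near \<open>p\<close>, so their variation between \<open>s\<close> and \<open>t\<close> is \<open>O((s - t)\<^sup>2)\<close>, hence zero.\<close>

lemma quadratic_flex:
  fixes b :: "'i \<Rightarrow> 'x::banach \<Rightarrow> 'x \<Rightarrow> real"
  assumes J: "finite J" "F \<subseteq> J"
    and bil: "\<And>j. j \<in> J \<Longrightarrow> bounded_bilinear (b j)"
    and sym: "\<And>j x y. j \<in> J \<Longrightarrow> b j x y = b j y x"
    and dual: "\<And>i j. i \<in> F \<Longrightarrow> j \<in> F \<Longrightarrow> 2 * b i p (w j) = (if i = j then 1 else 0)"
    and "\<epsilon> > 0"
    and ker: "\<And>q z e. norm (q - p) < \<epsilon> \<Longrightarrow> e \<in> J \<Longrightarrow> (\<And>i. i \<in> F \<Longrightarrow> b i q z = 0) \<Longrightarrow> b e q z = 0"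
    and v: "\<And>i. i \<in> F \<Longrightarrow> b i p v = 0"
  shows "\<exists>\<delta>>0. \<exists>h C. \<forall>t. \<bar>t\<bar> < \<delta> \<longrightarrow> norm (h t) \<le> C * \<bar>t\<bar> \<and> norm (h t - t *\<^sub>R v) \<le> C * t\<^sup>2 \<and>
           (\<forall>e\<in>J. b e (p + h t) (p + h t) = b e p p)"
proof -
  have fF: "finite F" using J finite_subset by blast
  have "\<exists>K\<ge>0. \<forall>x y. \<bar>b j x y\<bar> \<le> norm x * norm y * K" if "j \<in> J" for j
    using bounded_bilinear.nonneg_bounded[OF bil[OF that]] by auto
  then obtain K where K: "\<And>j. j \<in> J \<Longrightarrow> K j \<ge> 0"
    "\<And>j x y. j \<in> J \<Longrightarrow> \<bar>b j x y\<bar> \<le> norm x * norm y * K j" by metis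
  define L where "L = (\<Sum>j\<in>F. K j * norm (w j))"
  have "L \<ge> 0" unfolding L_def using K J by (intro sum_nonneg) auto
  define G where "G = (\<lambda>h. \<Sum>j\<in>F. b j h h *\<^sub>R w j)"
  have Gdiff: "norm (G x - G y) \<le> L * (norm x + norm y) * norm (x - y)" for x y
  proof -
    have "norm (G x - G y) = norm (\<Sum>j\<in>F. (b j (x - y) x + b j y (x - y)) *\<^sub>R w j)"
      unfolding G_def sum_subtractf[symmetric] scaleR_diff_left[symmetric]
      by (intro arg_cong[where f = norm] sum.cong refl)
        (use bil J in \<open>auto simp: bounded_bilinear.diff_left bounded_bilinear.diff_right subset_iff\<close>)
    also have "\<dots> \<le> (\<Sum>j\<in>F. norm ((b j (x - y) x + b j y (x - y)) *\<^sub>R w j))"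
      by (rule norm_sum)
    also have "\<dots> \<le> (\<Sum>j\<in>F. (norm x + norm y) * norm (x - y) * (K j * norm (w j)))"
    proof (rule sum_mono)
      fix j assume "j \<in> F"
      then have j: "j \<in> J" using J by auto
      have "\<bar>b j (x - y) x + b j y (x - y)\<bar> \<le> norm (x - y) * norm x * K j +
          norm y * norm (x - y) * K j"
        using K(2)[OF j, of "x - y" x] K(2)[OF j, of y "x - y"] by linarith
      also have "\<dots> = (norm x + norm y) * norm (x - y) * K j" by (simp add: algebra_simps)
      finally show "norm ((b j (x - y) x + b j y (x - y)) *\<^sub>R w j) \<le> (norm x +
          norm y) * norm (x - y) * (K j * norm (w j))"
        by (simp add: mult.assoc[symmetric] mult_right_mono)
    qed
    also have "\<dots> = L * (norm x + norm y) * norm (x - y)"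
      by (simp add: L_def sum_distrib_left[symmetric])
    finally show ?thesis .
  qed
  have G0: "G 0 = 0" unfolding G_def
    by (rule sum.neutral) (use J bil in \<open>auto simp: bounded_bilinear.zero_left subset_iff\<close>)
  \<comment> \<open>Half of \<open>\<epsilon>\<close> keeps \<open>p + h t\<close> where
    \<open>ker\<close> applies; the other bound gives \<open>G\<close> the contraction factor 1/2.
    The summand 1 covers \<open>L = 0\<close>.\<close>
  define \<rho> where "\<rho> = min (\<epsilon> / 2) (1 / (4 * (L + 1)))"
  have \<rho>: "\<rho> > 0" "\<rho> < \<epsilon>" using \<open>L \<ge> 0\<close> \<open>\<epsilon> > 0\<close> by (auto simp: \<rho>_def min_def)
  have "L * (2 * \<rho>) \<le> L * (2 * (1 / (4 * (L + 1))))"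
    using \<open>L \<ge> 0\<close> by (intro mult_left_mono) (auto simp: \<rho>_def)
  also have "\<dots> \<le> 1 / 2" using \<open>L \<ge> 0\<close> by (simp add: divide_simps)
  finally have L\<rho>: "L * (2 * \<rho>) \<le> 1 / 2" .
  have contr: "norm (G x - G y) \<le> 1 / 2 * norm (x - y)" if "norm x \<le> \<rho>" "norm y \<le> \<rho>" for x y
  proof -
    have "L * (norm x + norm y) * norm (x - y) \<le> L * (2 * \<rho>) * norm (x - y)"
      using that \<open>L \<ge> 0\<close> by (intro mult_right_mono mult_left_mono) auto
    also have "\<dots> \<le> 1 / 2 * norm (x - y)" using L\<rho> by (intro mult_right_mono) auto
    finally show ?thesis using Gdiff[of x y] by linarith
  qed
  \<comment> \<open>Keeps \<open>t *\<^sub>R v\<close> in the ball of half the radius;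
    \<open>G\<close> contributes at most the other half, so the ball is mapped into itself.\<close>
  define \<delta> where "\<delta> = \<rho> / (2 * (norm v + 1))"
  have nv: "norm v + 1 > 0" using norm_ge_zero[of v] by linarith
  have "\<delta> > 0" using \<rho> nv by (simp add: \<delta>_def)
  have tv: "\<bar>t\<bar> * norm v \<le> \<rho> / 2" if "\<bar>t\<bar> < \<delta>" for t
  proof -
    have "\<bar>t\<bar> * norm v \<le> \<delta> * (norm v + 1)" using that by (intro mult_mono) auto
    also have "\<dots> = \<rho> / 2" using nv by (simp add: \<delta>_def field_simps)
    finally show ?thesis .
  qed
  have "\<exists>x. norm x \<le> \<rho> \<and> t *\<^sub>R v - G x = x" if t: "\<bar>t\<bar> < \<delta>" for t
  proof -
    have "\<exists>!x\<in>cball 0 \<rho>. t *\<^sub>R v - G x = x"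
    proof (rule Banach_fix[where c = "1/2"])
      show "complete (cball 0 \<rho> :: 'x set)" by (simp add: complete_eq_closed)
      show "cball 0 \<rho> \<noteq> ({} :: 'x set)" using \<rho> by simp
      show "(\<lambda>x. t *\<^sub>R v - G x) ` cball 0 \<rho> \<subseteq> cball 0 \<rho>"
      proof clarsimp
        fix x :: 'x assume "norm x \<le> \<rho>"
        then have "norm (G x) \<le> \<rho> / 2" using contr[of x 0] \<rho> by (simp add: G0)
        then show "norm (t *\<^sub>R v - G x) \<le> \<rho>"
          using norm_triangle_ineq4[of "t *\<^sub>R v" "G x"] tv[OF t] by simp
      qed
      show "dist (t *\<^sub>R v - G x) (t *\<^sub>R v - G y) \<le> 1 / 2 * dist x y"
        if "x \<in> cball 0 \<rho>" "y \<in> cball 0 \<rho>" for x y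
        using contr[of y x] that by (simp add: dist_norm norm_minus_commute)
    qed auto
    then show ?thesis by auto
  qed
  then obtain h where h: "\<And>t. \<bar>t\<bar> < \<delta> \<Longrightarrow> norm (h t) \<le> \<rho>"
    "\<And>t. \<bar>t\<bar> < \<delta> \<Longrightarrow> t *\<^sub>R v - G (h t) = h t" by metis
  have lip: "norm (h s - h t) \<le> 2 * norm v * \<bar>s - t\<bar>" if "\<bar>s\<bar> < \<delta>" "\<bar>t\<bar> < \<delta>" for s t
  proof -
    have "h s - h t = (s *\<^sub>R v - G (h s)) - (t *\<^sub>R v - G (h t))"
      by (simp only: h(2)[OF that(1)] h(2)[OF that(2)])
    also have "\<dots> = (s - t) *\<^sub>R v - (G (h s) - G (h t))"
      by (simp add: scaleR_diff_left)
    finally have "h s - h t = (s - t) *\<^sub>R v - (G (h s) - G (h t))" .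
    then have "norm (h s - h t) \<le> \<bar>s - t\<bar> * norm v + 1 / 2 * norm (h s - h t)"
      using contr[OF h(1)[OF that(1)] h(1)[OF that(2)]] norm_triangle_ineq4[of "(s - t) *\<^sub>R v"
          "G (h s) - G (h t)"]
      by simp
    then show ?thesis by (simp add: field_simps)
  qed
  have h0: "h 0 = 0"
  proof -
    have "h 0 = - G (h 0)" using h(2)[of 0] \<open>\<delta> > 0\<close> by simp
    then have "norm (h 0) = norm (G (h 0))" by (metis norm_minus_cancel)
    then show ?thesis
      using contr[of "h 0" 0] h(1)[of 0] \<rho> \<open>\<delta> > 0\<close> by (simp add: G0)
  qed
  have hb: "norm (h t) \<le> 2 * norm v * \<bar>t\<bar>" if "\<bar>t\<bar> < \<delta>" for t
    using lip[OF that, of 0] h0 \<open>\<delta> > 0\<close> by simp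
  have hq: "norm (h t - t *\<^sub>R v) \<le> L * (2 * norm v)\<^sup>2 * t\<^sup>2" if "\<bar>t\<bar> < \<delta>" for t
  proof -
    have "norm (h t - t *\<^sub>R v) = norm ((t *\<^sub>R v - G (h t)) - t *\<^sub>R v)"
      by (simp only: h(2)[OF that])
    also have "\<dots> = norm (G (h t) - G 0)" by (simp add: G0)
    also have "\<dots> \<le> L * (norm (h t) * norm (h t))" using Gdiff[of "h t" 0] by (simp add: mult.assoc)
    also have "\<dots> \<le> L * ((2 * norm v * \<bar>t\<bar>) * (2 * norm v * \<bar>t\<bar>))"
      using hb[OF that] \<open>L \<ge> 0\<close> by (intro mult_left_mono mult_mono) auto
    also have "\<dots> = L * (2 * norm v)\<^sup>2 * t\<^sup>2" by (simp add: power2_eq_square)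
    finally show ?thesis .
  qed
  define g where "g = (\<lambda>e t. b e (p + h t) (p + h t))"
  have expand: "b e (x + y) (x + y) = b e x x + 2 * b e x y + b e y y" if "e \<in> J" for e x y
    using bil[OF that] sym[OF that, of y x]
    by (simp add: bounded_bilinear.add_left bounded_bilinear.add_right)
  have gF: "g i t = b i p p" if i: "i \<in> F" and t: "\<bar>t\<bar> < \<delta>" for i t
  proof -
    have iJ: "i \<in> J" using i J by auto
    interpret bounded_bilinear "b i" by (rule bil[OF iJ])
    have "2 * b i p (h t) = 2 * b i p (t *\<^sub>R v - G (h t))" by (simp add: h(2)[OF t])
    also have "\<dots> = - (\<Sum>j\<in>F. b j (h t) (h t) * (2 * b i p (w j)))"
      by (simp add: diff_right scaleR_right v[OF i] G_def sum_right sum_distrib_left mult_ac)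
    also have "(\<Sum>j\<in>F. b j (h t) (h t) * (2 * b i p (w j))) = (\<Sum>j\<in>F. if j =
        i then b j (h t) (h t) else 0)"
      by (rule sum.cong) (use dual[OF i] in auto)
    also have "\<dots> = b i (h t) (h t)" using i fF by simp
    finally show ?thesis using expand[OF iJ, of p "h t"] by (simp add: g_def)
  qed
  have g_der: "(g e has_real_derivative 0) (at t)" if e: "e \<in> J" and t: "\<bar>t\<bar> < \<delta>" for e t
  proof -
    define q where "q = p + h t"
    have lin: "linear (b j q)" if "j \<in> J" for j
      using bounded_bilinear.bounded_linear_right[OF bil[OF that]] bounded_linear.linear by blast
    have "norm (q - p) < \<epsilon>" using h(1)[OF t] \<rho> by (simp add: q_def)
    then have "\<exists>c. \<forall>z. b e q z = (\<Sum>i\<in>F. c i * b i q z)"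
      using ker[OF _ e, of q] lin J fF e by (intro linear_functional_combination) auto
    then obtain c where c: "\<And>z. b e q z = (\<Sum>i\<in>F. c i * b i q z)" by auto
    define C where "C = K e + (\<Sum>i\<in>F. \<bar>c i\<bar> * K i)"
    have "C \<ge> 0" unfolding C_def using K e J by (auto intro!: add_nonneg_nonneg sum_nonneg)
    have "\<bar>g e s - g e t\<bar> \<le> C * (2 * norm v)\<^sup>2 * (s - t)\<^sup>2" if s: "\<bar>s\<bar> < \<delta>" for s
    proof -
      define \<Delta> where "\<Delta> = h s - h t"
      have ps: "p + h s = q + \<Delta>" by (simp add: q_def \<Delta>_def)
      have dg: "g j s - g j t = 2 * b j q \<Delta> + b j \<Delta> \<Delta>" if "j \<in> J" for j
        using expand[OF that, of q \<Delta>] by (simp add: g_def ps) (simp add: q_def)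
      \<comment> \<open>As \<open>g i\<close> is constant for \<open>i\<close> in \<open>F\<close>,
        its linear term is the negative of its quadratic one; this makes the linear term of
        \<open>g e\<close>, a combination of these, quadratic as well.\<close>
      have F0: "2 * b i q \<Delta> = - b i \<Delta> \<Delta>" if "i \<in> F" for i
        using dg[of i] gF[OF that s] gF[OF that t] that J by auto
      have "g e s - g e t = 2 * (\<Sum>i\<in>F. c i * b i q \<Delta>) + b e \<Delta> \<Delta>" using dg[OF e] c by simp
      also have "2 * (\<Sum>i\<in>F. c i * b i q \<Delta>) = (\<Sum>i\<in>F. c i * (2 * b i q \<Delta>))"
        by (simp add: sum_distrib_left mult_ac)
      also have "\<dots> = (\<Sum>i\<in>F. c i * (- b i \<Delta> \<Delta>))" by (rule sum.cong) (simp_all only: F0)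
      finally have "\<bar>g e s - g e t\<bar> \<le> \<bar>\<Sum>i\<in>F. c i * (- b i \<Delta> \<Delta>)\<bar> + \<bar>b e \<Delta> \<Delta>\<bar>" by linarith
      also have "\<bar>\<Sum>i\<in>F. c i * (- b i \<Delta> \<Delta>)\<bar> \<le> (\<Sum>i\<in>F. \<bar>c i * (- b i \<Delta> \<Delta>)\<bar>)" by (rule sum_abs)
      also have "\<dots> \<le> (\<Sum>i\<in>F. \<bar>c i\<bar> * (norm \<Delta> * norm \<Delta> * K i))"
        using K(2)[of _ \<Delta> \<Delta>] J by (intro sum_mono) (auto simp: abs_mult intro!: mult_left_mono)
      also have "\<dots> = (\<Sum>i\<in>F. \<bar>c i\<bar> * K i) * (norm \<Delta> * norm \<Delta>)"
        by (simp add: sum_distrib_left mult_ac)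
      finally have "\<bar>g e s - g e t\<bar> \<le> C * (norm \<Delta> * norm \<Delta>)"
        using K(2)[OF e, of \<Delta> \<Delta>] by (simp add: C_def algebra_simps)
      also have "\<dots> \<le> C * ((2 * norm v * \<bar>s - t\<bar>) * (2 * norm v * \<bar>s - t\<bar>))"
        using lip[OF s t] \<open>C \<ge> 0\<close> by (intro mult_left_mono mult_mono) (auto simp: \<Delta>_def)
      also have "\<dots> = C * (2 * norm v)\<^sup>2 * (s - t)\<^sup>2"
        by (simp only: power2_abs[of "s - t", symmetric] power2_eq_square mult_ac)
      finally show ?thesis .
    qed
    note bound = this
    show ?thesis
    proof (rule has_derivative_0_of_quadratic_bound)
      show "open {-\<delta><..<\<delta>}" by simp
      show "t \<in> {-\<delta><..<\<delta>}" using t by (simp add: abs_less_iff)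
      fix s assume "s \<in> {-\<delta><..<\<delta>}"
      then have "\<bar>s\<bar> < \<delta>" by (simp add: abs_less_iff)
      then show "\<bar>g e s - g e t\<bar> \<le> C * (2 * norm v)\<^sup>2 * (s - t)\<^sup>2" by (rule bound)
    qed
  qed
  have gJ: "g e t = b e p p" if e: "e \<in> J" and t: "\<bar>t\<bar> < \<delta>" for e t
  proof -
    have "\<exists>c. \<forall>t\<in>{-\<delta><..<\<delta>}. g e t = c"
    proof (rule has_field_derivative_zero_constant)
      fix s assume "s \<in> {-\<delta><..<\<delta>}"
      then have "\<bar>s\<bar> < \<delta>" by (simp add: abs_less_iff)
      from g_der[OF e this] show "(g e has_real_derivative 0) (at s within {-\<delta><..<\<delta>})"
        by (rule has_field_derivative_at_within)
    qed simp
    then obtain c where c: "\<And>t. t \<in> {-\<delta><..<\<delta>} \<Longrightarrow> g e t = c" by blast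
    have "t \<in> {-\<delta><..<\<delta>}" "0 \<in> {-\<delta><..<\<delta>}" using t \<open>\<delta> > 0\<close> by (simp_all add: abs_less_iff)
    then have "g e t = g e 0" using c by metis
    then show ?thesis by (simp add: g_def h0)
  qed
  show ?thesis
  proof (intro exI conjI allI impI)
    show "\<delta> > 0" by fact
    fix t assume t: "\<bar>t\<bar> < \<delta>"
    define C where "C = max (2 * norm v) (L * (2 * norm v)\<^sup>2)"
    have "2 * norm v * \<bar>t\<bar> \<le> C * \<bar>t\<bar>" "L * (2 * norm v)\<^sup>2 * t\<^sup>2 \<le> C * t\<^sup>2"
      by (intro mult_right_mono; simp add: C_def)+
    then show "norm (h t) \<le> max (2 * norm v) (L * (2 * norm v)\<^sup>2) * \<bar>t\<bar>"
      "norm (h t - t *\<^sub>R v) \<le> max (2 * norm v) (L * (2 * norm v)\<^sup>2) * t\<^sup>2"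
      using hb[OF t] hq[OF t] by (auto simp: C_def)
    show "\<forall>e\<in>J. b e (p + h t) (p + h t) = b e p p" using gJ[OF _ t] by (simp add: g_def)
  qed
qed

instance bcontfun :: (metric_space, banach) banach ..

text \<open>Stated for velocities instead of ranks, because separators are refuted by exhibiting a
  velocity.\<close>

definition inf_rigid :: "'a set \<Rightarrow> 'a set set \<Rightarrow> ('a \<Rightarrow> real ^ 'n) \<Rightarrow> bool" where
  "inf_rigid V E p \<longleftrightarrow>
     (\<forall>v. (\<forall>x y. {x, y} \<in> E \<longrightarrow> (p x - p y) \<bullet> (v x - v y) = 0) \<longrightarrow>
          (\<forall>x\<in>V. \<forall>y\<in>V. (p x - p y) \<bullet> (v x - v y) = 0))"

text \<open>Coefficients indexed by \<open>F\<close> make repeated functionals dependent, so the two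
  orientations of one edge never occur together in an independent set.\<close>

definition indep_at :: "('i \<Rightarrow> 'x \<Rightarrow> 'x \<Rightarrow> real) \<Rightarrow> 'i set \<Rightarrow> 'x \<Rightarrow> bool" where
  "indep_at b F q \<longleftrightarrow> (\<forall>c. (\<forall>z. (\<Sum>i\<in>F. c i * b i q z) = 0) \<longrightarrow> (\<forall>i\<in>F. c i = 0))"

text \<open>Against the dual vectors of \<open>q0\<close> the functionals at a nearby
  \<open>q\<close> form a matrix close to the identity; testing a relation at the index of its
  largest coefficient forces that coefficient to be 0.\<close>

lemma indep_at_open:
  fixes b :: "'i \<Rightarrow> 'x::real_normed_vector \<Rightarrow> 'x \<Rightarrow> real"
  assumes "finite F" and bil: "\<And>i. i \<in> F \<Longrightarrow> bounded_bilinear (b i)" and ind: "indep_at b F q0"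
  shows "\<exists>\<epsilon>>0. \<forall>q. norm (q - q0) < \<epsilon> \<longrightarrow> indep_at b F q"
proof -
  have lin: "linear (b i q)" if "i \<in> F" for i q
    using bounded_bilinear.bounded_linear_right[OF bil[OF that]] bounded_linear.linear by blast
  obtain w where w: "\<And>i j. i \<in> F \<Longrightarrow> j \<in> F \<Longrightarrow> b i q0 (w j) = (if i = j then 1 else 0)"
    using linear_functional_dual[of F "\<lambda>i. b i q0"] assms(1) lin ind unfolding indep_at_def by blast
  have "\<exists>K\<ge>0. \<forall>x y. \<bar>b i x y\<bar> \<le> norm x * norm y * K" if "i \<in> F" for i
    using bounded_bilinear.nonneg_bounded[OF bil[OF that]] by auto
  then obtain K where K: "\<And>j. j \<in> F \<Longrightarrow> K j \<ge> 0"
    "\<And>j x y. j \<in> F \<Longrightarrow> \<bar>b j x y\<bar> \<le> norm x * norm y * K j" by metis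
  define W where "W = (\<Sum>j\<in>F. norm (w j))"
  define M where "M = sum K F * W"
  have "M \<ge> 0" unfolding M_def W_def using K by (intro mult_nonneg_nonneg sum_nonneg) auto
  \<comment> \<open>Makes \<open>\<epsilon> * M < 1\<close>, where \<open>M\<close> bounds the
    summed perturbation at any \<open>w k\<close> per unit of distance.\<close>
  define \<epsilon> where "\<epsilon> = 1 / (M + 1)"
  have "\<epsilon> > 0" using \<open>M \<ge> 0\<close> by (simp add: \<epsilon>_def)
  have "indep_at b F q" if q: "norm (q - q0) < \<epsilon>" for q
    unfolding indep_at_def
  proof (intro allI impI)
    fix c assume c: "\<forall>z. (\<Sum>i\<in>F. c i * b i q z) = 0"
    show "\<forall>i\<in>F. c i = 0"
    proof (cases "F = {}")
      case False
      define m where "m = Max ((\<lambda>i. \<bar>c i\<bar>) ` F)"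
      have "m \<in> (\<lambda>i. \<bar>c i\<bar>) ` F"
        unfolding m_def using assms(1) False by (intro Max_in) auto
      then obtain k where k: "k \<in> F" "m = \<bar>c k\<bar>" by auto
      have m: "\<bar>c i\<bar> \<le> m" if "i \<in> F" for i
        unfolding m_def using assms(1) that by (intro Max_ge) auto
      have split: "b i q (w k) = (if i = k then 1 else 0) + b i (q - q0) (w k)" if "i \<in> F" for i
        using bounded_bilinear.diff_left[OF bil[OF that], of q q0 "w k"] w[OF that k(1)] by simp
      have "0 = (\<Sum>i\<in>F. c i * b i q (w k))" using c by simp
      also have "\<dots> = (\<Sum>i\<in>F. (if i = k then c i else 0) + c i * b i (q - q0) (w k))"
        by (rule sum.cong) (use split in \<open>auto simp: algebra_simps\<close>)
      also have "\<dots> = c k + (\<Sum>i\<in>F. c i * b i (q - q0) (w k))"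
        using k assms(1) by (simp add: sum.distrib)
      finally have "\<bar>c k\<bar> = \<bar>\<Sum>i\<in>F. c i * b i (q - q0) (w k)\<bar>" by linarith
      also have "\<dots> \<le> (\<Sum>i\<in>F. \<bar>c i * b i (q - q0) (w k)\<bar>)" by (rule sum_abs)
      also have "\<dots> \<le> (\<Sum>i\<in>F. m * (norm (q - q0) * W * K i))"
      proof (rule sum_mono)
        fix i assume i: "i \<in> F"
        have "norm (w k) \<le> W"
          unfolding W_def using k(1) assms(1) by (intro member_le_sum) auto
        then have "norm (q - q0) * norm (w k) * K i \<le> norm (q - q0) * W * K i"
          using K(1)[OF i] by (intro mult_right_mono mult_left_mono) auto
        then have "\<bar>b i (q - q0) (w k)\<bar> \<le> norm (q - q0) * W * K i"
          using K(2)[OF i, of "q - q0" "w k"] by linarith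
        then show "\<bar>c i * b i (q - q0) (w k)\<bar> \<le> m * (norm (q - q0) * W * K i)"
          using m[OF i] by (simp only: abs_mult) (intro mult_mono, auto)
      qed
      also have "\<dots> = m * (norm (q - q0) * M)"
        by (simp add: M_def sum_distrib_left sum_distrib_right mult_ac)
      finally have le: "m \<le> m * (norm (q - q0) * M)" using k by simp
      have "norm (q - q0) * M \<le> \<epsilon> * M" using q \<open>M \<ge> 0\<close> by (intro mult_right_mono) auto
      also have "\<dots> < 1" using \<open>M \<ge> 0\<close> by (simp add: \<epsilon>_def divide_simps)
      finally have "norm (q - q0) * M < 1" .
      moreover have "m \<ge> 0" using k by simp
      ultimately have "m = 0"
        using le mult_strict_left_mono[of "norm (q - q0) * M" 1 m] by (cases "m > 0") auto
      then show ?thesis using m by fastforce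
    qed simp
  qed
  then show ?thesis using \<open>\<epsilon> > 0\<close> by blast
qed

context
  fixes V :: "'a set"
  assumes fin: "finite V"
begin

text \<open>Configurations of \<open>V\<close> are embedded into a Banach space: all functions on a discrete space are continuous.\<close>

definition conf :: "('a discrete \<Rightarrow>\<^sub>C (real ^ 'n)) \<Rightarrow> 'a \<Rightarrow> real ^ 'n" where
  "conf q x = apply_bcontfun q (discrete x)"

text \<open>The value 0 off \<open>V\<close> leaves a finite range, hence a bounded function, and
  lets the norm see only the vertices.\<close>

definition emb :: "('a \<Rightarrow> real ^ 'n) \<Rightarrow> ('a discrete \<Rightarrow>\<^sub>C (real ^ 'n))" where
  "emb c = Bcontfun (\<lambda>z. if of_discrete z \<in> V then c (of_discrete z) else 0)"

lemma apply_emb: "apply_bcontfun (emb c) z = (if of_discrete z \<in> V then c (of_discrete z) else 0)"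
proof -
  have "range (\<lambda>z. if of_discrete z \<in> V then c (of_discrete z) else 0) \<subseteq> insert 0 (c ` V)" by auto
  then have "finite (range (\<lambda>z. if of_discrete z \<in> V then c (of_discrete z) else 0))"
    using fin by (meson finite_subset finite_imageI finite_insert)
  then show ?thesis
    unfolding emb_def by (subst Bcontfun_inverse) (auto simp: bcontfun_def continuous_on_open_vimage open_discrete intro: finite_imp_bounded)
qed

lemma conf_emb [simp]: "x \<in> V \<Longrightarrow> conf (emb c) x = c x"
  by (simp add: conf_def apply_emb discrete_inverse)

lemma norm_emb_diff_le:
  assumes "\<And>x. x \<in> V \<Longrightarrow> norm (c x - conf q x) \<le> e" "e \<ge> 0"
  shows "norm (emb c - emb (conf q)) \<le> e"
  by (rule norm_bound) (use assms in \<open>auto simp: apply_emb\<close>)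

lemma bounded_linear_conf: "bounded_linear (\<lambda>q. conf q x)"
proof (rule bounded_linear_intro[where K = 1])
  show "norm (conf q x) \<le> norm q * 1" for q :: "'a discrete \<Rightarrow>\<^sub>C (real ^ 'n)"
    unfolding conf_def using norm_bounded by simp
qed (auto simp: conf_def)

definition pairing ::
    "'a \<times> 'a \<Rightarrow> ('a discrete \<Rightarrow>\<^sub>C (real ^ 'n)) \<Rightarrow> ('a discrete \<Rightarrow>\<^sub>C (real ^ 'n)) \<Rightarrow> real" where
  "pairing e q z = (conf q (fst e) - conf q (snd e)) \<bullet> (conf z (fst e) - conf z (snd e))"

lemma bounded_bilinear_pairing: "bounded_bilinear (pairing e)"
  unfolding pairing_def
  by (intro bounded_bilinear.comp[OF bounded_bilinear_inner] bounded_linear_sub bounded_linear_conf)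

lemma pairing_sym: "pairing e q z = pairing e z q"
  by (simp add: pairing_def inner_commute)

lemma pairing_cong:
  assumes "fst e \<in> V" "snd e \<in> V"
  shows "pairing e (emb (conf q)) z = pairing e q z"
  using assms by (simp add: pairing_def)

text \<open>A set of edge functionals of maximal size that is independent somewhere stays independent nearby, so the
  rank is locally constant there, and generic realizations are dense.\<close>

lemma rigid_imp_inf_rigid:
  fixes p0 :: "'a \<Rightarrow> real ^ 'n"
  assumes EV: "\<And>e. e \<in> E \<Longrightarrow> e \<subseteq> V" and rig: "rigid TYPE('n) V E" and gen: "generic V p0"
  shows "\<exists>p :: 'a \<Rightarrow> real ^ 'n. generic V p \<and> inf_rigid V E p"
proof -
  define J where "J = {e \<in> V \<times> V. {fst e, snd e} \<in> E}"
  let ?b = "pairing :: _ \<Rightarrow> ('a discrete \<Rightarrow>\<^sub>C (real ^ 'n)) \<Rightarrow> _"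
  have fJ: "finite J" unfolding J_def using fin by auto
  have JV: "fst e \<in> V" "snd e \<in> V" if "e \<in> J" for e using that by (auto simp: J_def)
  define N where "N = {card F | F. F \<subseteq> J \<and> (\<exists>q. indep_at ?b F q)}"
  have "N \<subseteq> {..card J}" unfolding N_def using fJ by (auto intro: card_mono)
  then have "finite N" using finite_subset by blast
  moreover have "0 \<in> N" unfolding N_def by (auto simp: indep_at_def intro!: exI[of _ "{}"])
  ultimately have "Max N \<in> N" by (intro Max_in) auto
  then obtain F q1 where F: "F \<subseteq> J" "indep_at ?b F q1" "card F = Max N"
    unfolding N_def by (smt (verit) mem_Collect_eq)
  have fF: "finite F" using F fJ finite_subset by blast
  have max: "\<not> indep_at ?b F' q" if "F' \<subseteq> J" "card F' > card F" for F' q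
  proof
    assume "indep_at ?b F' q"
    then have "card F' \<in> N" using that by (auto simp: N_def)
    then show False using Max_ge[OF \<open>finite N\<close>] that F by force
  qed
  \<comment> \<open>Erasing \<open>q1\<close> off \<open>V\<close> changes no functional in
    \<open>J\<close> and makes closeness at the vertices suffice for closeness in norm.\<close>
  define q0 where "q0 = emb (conf q1)"
  have "(\<Sum>i\<in>F. c i * ?b i q0 z) = (\<Sum>i\<in>F. c i * ?b i q1 z)" for c z
    by (intro sum.cong refl) (simp only: q0_def pairing_cong JV subsetD[OF F(1)])
  then have "indep_at ?b F q0" using F(2) by (simp add: indep_at_def)
  then obtain \<epsilon> where \<epsilon>: "\<epsilon> > 0" "\<And>q. norm (q - q0) < \<epsilon> \<Longrightarrow> indep_at ?b F q"
    using indep_at_open[OF fF bounded_bilinear_pairing \<open>indep_at ?b F q0\<close>] by blast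
  obtain c where c: "generic V c" "\<And>x. norm (c x - conf q1 x) < \<epsilon> / 2"
    using generic_dense[OF gen, of "\<epsilon> / 2" "conf q1"] \<epsilon> by auto
  define P where "P = emb c"
  have "norm (P - q0) \<le> \<epsilon> / 2" unfolding P_def q0_def
    using c \<epsilon> by (intro norm_emb_diff_le) (auto intro: less_imp_le)
  then have near: "norm (q - q0) < \<epsilon>" if "norm (q - P) < \<epsilon> / 2" for q
    using that norm_triangle_ineq[of "q - P" "P - q0"] by simp
  have lin: "linear (?b i q)" for i q
    using bounded_bilinear.bounded_linear_right[OF bounded_bilinear_pairing] bounded_linear.linear
      by blast
  have ker: "?b e q z = 0"
    if q: "norm (q - P) < \<epsilon> / 2" and e: "e \<in> J" and z: "\<And>i. i \<in> F \<Longrightarrow> ?b i q z = 0" for q z e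
  proof (rule ccontr)
    assume nz: "?b e q z \<noteq> 0"
    then have "e \<notin> F" using z by blast
    have ind: "indep_at ?b F q" using \<epsilon>(2) near q by blast
    have "indep_at ?b (insert e F) q"
      unfolding indep_at_def
    proof (intro allI impI)
      fix a assume a: "\<forall>z. (\<Sum>i\<in>insert e F. a i * ?b i q z) = 0"
      have "(\<Sum>i\<in>F. a i * ?b i q z) = 0" using z by (intro sum.neutral) auto
      then have "a e = 0" using a[rule_format, of z] \<open>e \<notin> F\<close> fF nz by simp
      then have "\<forall>z. (\<Sum>i\<in>F. a i * ?b i q z) = 0" using a \<open>e \<notin> F\<close> fF by simp
      then show "\<forall>i\<in>insert e F. a i = 0" using ind \<open>a e = 0\<close> by (auto simp: indep_at_def)
    qed
    moreover have "insert e F \<subseteq> J" "card (insert e F) > card F" using e F fF \<open>e \<notin> F\<close> by auto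
    ultimately show False using max by blast
  qed
  have "indep_at ?b F P" using near[of P] \<epsilon> by simp
  then obtain w where w: "\<And>i j. i \<in> F \<Longrightarrow> j \<in> F \<Longrightarrow> ?b i P (w j) = (if i = j then 1 else 0)"
    using linear_functional_dual[of F "\<lambda>i. ?b i P"] fF lin unfolding indep_at_def by blast
  have w': "2 * ?b i P ((1/2) *\<^sub>R w j) = (if i = j then 1 else 0)" if "i \<in> F" "j \<in> F" for i j
    using w[OF that] linear_scale[OF lin, of i P "1/2" "w j"] by simp
  obtain r where r: "r > 0" "\<And>q :: 'a \<Rightarrow> real ^ 'n. equivalent E c q \<Longrightarrow> (\<And>x. x \<in> V \<Longrightarrow>
      norm (c x - q x) < r)
      \<Longrightarrow> congruent_on V c q"
    using rig c(1) unfolding rigid_def by blast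
  have "inf_rigid V E c"
    unfolding inf_rigid_def
  proof (intro allI impI ballI)
    fix v :: "'a \<Rightarrow> real ^ 'n" and x y
    assume v: "\<forall>x y. {x, y} \<in> E \<longrightarrow> (c x - c y) \<bullet> (v x - v y) = 0" and xy: "x \<in> V" "y \<in> V"
    define u where "u = emb v"
    have u: "?b i P u = 0" if "i \<in> F" for i
      using that F v by (auto simp: pairing_def P_def u_def J_def)
    have flex: "\<exists>\<delta>>0. \<exists>h C. \<forall>t. \<bar>t\<bar> < \<delta> \<longrightarrow> norm (h t) \<le> C * \<bar>t\<bar> \<and>
        norm (h t - t *\<^sub>R u) \<le> C * t\<^sup>2 \<and> (\<forall>e\<in>J. ?b e (P + h t) (P + h t) = ?b e P P)"
    proof (rule quadratic_flex[where b = ?b and p = P and v = u and \<epsilon> = "\<epsilon> / 2", OF fJ F(1)])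
      show "bounded_bilinear (?b e)" for e by (rule bounded_bilinear_pairing)
      show "?b e x y = ?b e y x" for e x y by (rule pairing_sym)
      show "2 * ?b i P ((1/2) *\<^sub>R w j) = (if i = j then 1 else 0)" if "i \<in> F" "j \<in> F" for i j
        by (rule w'[OF that])
      show "\<epsilon> / 2 > 0" using \<epsilon> by simp
      show "?b e q z = 0" if "norm (q - P) < \<epsilon> / 2" "e \<in> J" "\<And>i. i \<in> F \<Longrightarrow> ?b i q z = 0" for q z e
        by (rule ker[OF that])
      show "?b i P u = 0" if "i \<in> F" for i by (rule u[OF that])
    qed
    obtain \<delta> h C where \<delta>: "\<delta> > 0" and h: "\<And>t. \<bar>t\<bar> < \<delta> \<Longrightarrow> norm (h t) \<le> C * \<bar>t\<bar>"
      "\<And>t. \<bar>t\<bar> < \<delta> \<Longrightarrow> norm (h t - t *\<^sub>R u) \<le> C * t\<^sup>2"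
      "\<And>t e. \<bar>t\<bar> < \<delta> \<Longrightarrow> e \<in> J \<Longrightarrow> ?b e (P + h t) (P + h t) = ?b e P P"
      using flex by blast
    have C0: "C \<ge> 0"
      using order_trans[OF norm_ge_zero h(1)[of "\<delta>/2"]] \<delta> by (simp add: zero_le_mult_iff)
    let ?e = "(x, y)"
    interpret bounded_bilinear "?b ?e" by (rule bounded_bilinear_pairing)
    obtain K where K: "K \<ge> 0" "\<And>a b. \<bar>?b ?e a b\<bar> \<le> norm a * norm b * K"
      using nonneg_bounded by auto
    \<comment> \<open>Times below this bound also keep every vertex within the radius
      \<open>r\<close> in which equivalence implies congruence.\<close>
    define \<delta>' where "\<delta>' = min \<delta> (r / (C + 1))"
    have \<delta>': "\<delta>' > 0" using \<delta> r C0 by (simp add: \<delta>'_def)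
    define D where "D = 2 * norm P * C * K + C * C * K"
    have "D \<ge> 0" unfolding D_def using C0 K by (intro add_nonneg_nonneg mult_nonneg_nonneg) auto
    define \<beta> where "\<beta> = \<bar>?b ?e P u\<bar>"
    \<comment> \<open>Congruence along the flex cancels the constant terms of the squared distance,
      so the linear term is bounded by the quadratic ones. After division by \<open>t\<close> the
      bound tends to 0, which forces \<open>\<beta> = 0\<close>.\<close>
    have main: "2 * \<beta> \<le> D * t" if t: "0 < t" "t < \<delta>'" for t
    proof -
      have t\<delta>: "\<bar>t\<bar> < \<delta>" using t by (simp add: \<delta>'_def)
      define q where "q = conf (P + h t)"
      have q: "q z = c z + conf (h t) z" if "z \<in> V" for z
        using that conf_emb[OF that, of c] by (simp add: q_def P_def conf_def)
      have "equivalent E c q"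
        unfolding equivalent_def
      proof (intro allI impI)
        fix a b assume ab: "{a, b} \<in> E"
        then have V: "a \<in> V" "b \<in> V" using EV by blast+
        then have "(a, b) \<in> J" using ab by (simp add: J_def)
        from h(3)[OF t\<delta> this] show "norm (c a - c b) = norm (q a - q b)"
          using V by (simp add: pairing_def q_def norm_eq_sqrt_inner) (simp add: P_def)
      qed
      moreover have "norm (c z - q z) < r" if "z \<in> V" for z
      proof -
        have "norm (c z - q z) = norm (conf (h t) z)" using q[OF that] by simp
        also have "\<dots> \<le> norm (h t)" unfolding conf_def by (rule norm_bounded)
        also have "\<dots> \<le> C * t" using h(1)[OF t\<delta>] t by simp
        also have "\<dots> \<le> C * (r / (C + 1))"
          using t C0 by (intro mult_left_mono) (auto simp: \<delta>'_def)
        also have "\<dots> < r" using C0 r by (simp add: divide_simps algebra_simps)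
        finally show ?thesis .
      qed
      ultimately have "congruent_on V c q" using r by blast
      then have "norm (c x - c y) = norm (q x - q y)" using xy by (auto simp: congruent_on_def)
      then have "?b ?e P P = ?b ?e (P + h t) (P + h t)"
        using xy by (simp add: pairing_def q_def norm_eq_sqrt_inner) (simp add: P_def)
      then have "2 * ?b ?e P (h t) = - ?b ?e (h t) (h t)"
        using pairing_sym[of ?e "h t" P] by (simp add: add_left add_right)
      moreover have "?b ?e P (h t) = t * ?b ?e P u + ?b ?e P (h t - t *\<^sub>R u)"
        by (simp add: diff_right scaleR_right)
      ultimately have eq: "2 * (t * ?b ?e P u) = - 2 * ?b ?e P (h t - t *\<^sub>R u) - ?b ?e (h t) (h t)"
        by linarith
      have "\<bar>2 * (t * ?b ?e P u)\<bar> = 2 * t * \<beta>" using t by (simp add: \<beta>_def abs_mult)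
      then have "2 * t * \<beta> \<le> 2 * \<bar>?b ?e P (h t - t *\<^sub>R u)\<bar> + \<bar>?b ?e (h t) (h t)\<bar>"
        using eq by linarith
      also have "\<dots> \<le> 2 * (norm P * norm (h t - t *\<^sub>R u) * K) + norm (h t) * norm (h t) * K"
        using K(2)[of P "h t - t *\<^sub>R u"] K(2)[of "h t" "h t"] by linarith
      also have "\<dots> \<le> 2 * (norm P * (C * t\<^sup>2) * K) + (C * \<bar>t\<bar>) * (C * \<bar>t\<bar>) * K"
        using h(1)[OF t\<delta>] h(2)[OF t\<delta>] K C0
        by (intro add_mono mult_left_mono mult_right_mono mult_mono) auto
      also have "\<dots> = t * (D * t)" using t by (simp add: D_def power2_eq_square algebra_simps)
      finally have "t * (2 * \<beta>) \<le> t * (D * t)" by (simp add: mult_ac)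
      then show ?thesis using t by simp
    qed
    have "\<beta> = 0"
    proof (rule ccontr)
      assume "\<beta> \<noteq> 0"
      then have "\<beta> > 0" by (simp add: \<beta>_def)
      define t where "t = min (\<delta>' / 2) (\<beta> / (D + 1))"
      have "0 < t" "t < \<delta>'" using \<delta>' \<open>\<beta> > 0\<close> \<open>D \<ge> 0\<close> by (auto simp: t_def)
      then have "2 * \<beta> \<le> D * t" by (rule main)
      also have "\<dots> \<le> D * (\<beta> / (D + 1))" using \<open>D \<ge> 0\<close> by (intro mult_left_mono) (auto simp: t_def)
      also have "\<dots> \<le> \<beta>" using \<open>D \<ge> 0\<close> \<open>\<beta> > 0\<close> by (simp add: divide_simps algebra_simps)
      finally show False using \<open>\<beta> > 0\<close> by simp
    qed
    then show "(c x - c y) \<bullet> (v x - v y) = 0"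
      using xy by (simp add: \<beta>_def pairing_def P_def u_def)
  qed
  then show ?thesis using c(1) by blast
qed

end

section \<open>Menger's theorem\<close>

definition avoiding :: "('a \<times> 'a) set \<Rightarrow> 'a set \<Rightarrow> ('a \<times> 'a) set" where
  "avoiding R S = {(a, b) \<in> R. a \<notin> S \<and> b \<notin> S}"

text \<open>Vertices of \<open>A\<close> and \<open>B\<close> may belong to \<open>S\<close>;
  without edges, for instance, \<open>A \<inter> B\<close> is the separator from which the induction
  starts.\<close>

definition separates :: "('a \<times> 'a) set \<Rightarrow> 'a set \<Rightarrow> 'a set \<Rightarrow> 'a set \<Rightarrow> bool" where
  "separates R A B S \<longleftrightarrow> (\<forall>a\<in>A - S. \<forall>b\<in>B - S. (a, b) \<notin> (avoiding R S)\<^sup>*)"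

text \<open>With paths indexed by their last vertices, two linkages are spliced by using the first
  vertex of one path as an index into the other linkage.\<close>

definition linkage :: "('a \<times> 'a) set \<Rightarrow> 'a set \<Rightarrow> 'a set \<Rightarrow> ('a \<Rightarrow> 'a list) \<Rightarrow> bool" where
  "linkage R A X f \<longleftrightarrow>
     (\<forall>b\<in>X. f b \<noteq> [] \<and> hd (f b) \<in> A \<and> last (f b) = b \<and> distinct (f b) \<and>
        successively (\<lambda>a b. (a, b) \<in> R) (f b)) \<and>
     (\<forall>b\<in>X. \<forall>c\<in>X. b \<noteq> c \<longrightarrow> set (f b) \<inter> set (f c) = {})"

lemma avoiding_mono: "R \<subseteq> R' \<Longrightarrow> S' \<subseteq> S \<Longrightarrow> (avoiding R S)\<^sup>* \<subseteq> (avoiding R' S')\<^sup>*"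
  by (rule rtrancl_mono) (auto simp: avoiding_def)

lemma avoiding_prefix:
  assumes "successively (\<lambda>a b. (a, b) \<in> R) xs" "distinct xs" "set xs \<inter> S \<subseteq> {last xs}"
    "z \<in> set xs" "z \<notin> S"
  shows "hd xs \<notin> S \<and> (hd xs, z) \<in> (avoiding R S)\<^sup>*"
  using assms
proof (induction xs)
  case (Cons x xs)
  show ?case
  proof (cases "xs = []")
    case True
    then show ?thesis using Cons.prems by auto
  next
    case False
    then have x: "x \<notin> S" using Cons.prems last_in_set[OF False] by auto
    show ?thesis
    proof (cases "z = x")
      case False
      have "hd xs \<notin> S \<and> (hd xs, z) \<in> (avoiding R S)\<^sup>*"
        using Cons.prems \<open>xs \<noteq> []\<close> False by (intro Cons.IH) (auto simp: successively_Cons)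
      moreover have "(x, hd xs) \<in> R" using Cons.prems \<open>xs \<noteq> []\<close> by (auto simp: successively_Cons)
      ultimately show ?thesis using x
        by (auto simp: avoiding_def intro: converse_rtrancl_into_rtrancl)
    qed (use x in auto)
  qed
qed simp

lemma avoiding_suffix:
  assumes "successively (\<lambda>a b. (a, b) \<in> R) xs" "distinct xs" "set xs \<inter> S \<subseteq> {hd xs}"
    "z \<in> set xs" "z \<notin> S"
  shows "last xs \<notin> S \<and> (z, last xs) \<in> (avoiding R S)\<^sup>*"
  using assms
proof (induction xs arbitrary: z)
  case (Cons x xs)
  show ?case
  proof (cases "xs = []")
    case True
    then show ?thesis using Cons.prems by auto
  next
    case False
    have IH: "last xs \<notin> S \<and> (z', last xs) \<in> (avoiding R S)\<^sup>*" if "z' \<in> set xs" for z'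
      using Cons.prems that by (intro Cons.IH) (auto simp: successively_Cons)
    show ?thesis
    proof (cases "z = x")
      case True
      have "(x, hd xs) \<in> R" "hd xs \<notin> S"
        using Cons.prems True False by (cases xs; auto)+
      then have "(x, hd xs) \<in> avoiding R S" using Cons.prems True by (auto simp: avoiding_def)
      then show ?thesis using IH[of "hd xs"] False True
        by (auto intro: converse_rtrancl_into_rtrancl)
    qed (use IH[of z] Cons.prems False in auto)
  qed
qed simp

text \<open>Goering's proof: if deleting the edge \<open>xy\<close> creates a too small separator \<open>S\<close>, then
  \<open>S + x\<close> and \<open>S + y\<close> are separators of the right size, and linkages from \<open>A\<close> to \<open>S + x\<close> and from
  \<open>S + y\<close> to \<open>B\<close> meet only in \<open>S\<close>.\<close>

lemma menger_linkage:
  assumes "finite R" "finite A" "\<And>S. finite S \<Longrightarrow> separates R A B S \<Longrightarrow> k \<le> card S"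
  shows "\<exists>X f. X \<subseteq> B \<and> finite X \<and> card X = k \<and> linkage R A X f"
  using assms
proof (induction R arbitrary: A B rule: finite_induct)
  case empty
  have "separates {} A B (A \<inter> B)" by (auto simp: separates_def avoiding_def)
  then have "k \<le> card (A \<inter> B)" using empty by auto
  then obtain X where X: "X \<subseteq> A \<inter> B" "card X = k" "finite X"
    using obtain_subset_with_card_n by metis
  then have "linkage {} A X (\<lambda>b. [b])" by (auto simp: linkage_def)
  with X show ?case by blast
next
  case (insert e R)
  obtain x y where e: "e = (x, y)" by (cases e)
  show ?case
  proof (cases "\<exists>S. finite S \<and> separates R A B S \<and> card S < k")
    case False
    then have "\<exists>X f. X \<subseteq> B \<and> finite X \<and> card X = k \<and> linkage R A X f"
    proof (intro insert.IH[OF insert.prems(1)])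
      fix S assume "finite S" "separates R A B S"
      with False show "k \<le> card S" by (meson not_le)
    qed
    then obtain X f where X: "X \<subseteq> B" "finite X" "card X = k" "linkage R A X f" by blast
    have "linkage (insert e R) A X f"
      unfolding linkage_def
    proof (intro conjI ballI)
      fix b assume "b \<in> X"
      then have "successively (\<lambda>a b. (a, b) \<in> R) (f b)" using X(4) by (auto simp: linkage_def)
      then show "successively (\<lambda>a b. (a, b) \<in> insert e R) (f b)"
        by (rule successively_mono) auto
    qed (use X(4) in \<open>auto simp: linkage_def\<close>)
    then show ?thesis using X by blast
  next
    case True
    then obtain S where S: "finite S" "separates R A B S" "card S < k" by auto
    have "separates (insert e R) A B (insert x S)" "separates (insert e R) A B (insert y S)"
    proof -
      have *: "(avoiding (insert e R) (insert z S))\<^sup>* \<subseteq> (avoiding R S)\<^sup>*" if "z = x \<or> z = y" for z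
        by (rule rtrancl_mono) (use that in \<open>auto simp: avoiding_def e\<close>)
      show "separates (insert e R) A B (insert x S)" "separates (insert e R) A B (insert y S)"
        using S(2) *[of x] *[of y] unfolding separates_def by blast+
    qed
    then have "k \<le> card (insert x S)" "k \<le> card (insert y S)"
      using insert.prems(2) S(1) by auto
    then have xS: "x \<notin> S" "y \<notin> S" "card (insert x S) = k" "card (insert y S) = k"
      using S by (auto simp: card_insert_if split: if_splits)
    \<comment> \<open>A walk from \<open>A\<close> to \<open>B\<close> avoiding \<open>T\<close>
      reaches neither \<open>x\<close> nor \<open>S\<close>, as \<open>T\<close> separates
      \<open>A\<close> from both. So it does not use \<open>xy\<close> and contradicts that
      \<open>S\<close> separates in \<open>R\<close>.\<close>
    have sepP: "k \<le> card T" if T: "finite T" "separates R A (insert x S) T" for T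
    proof (rule insert.prems(2)[OF T(1)], unfold separates_def, intro ballI notI)
      fix a b assume a: "a \<in> A - T" and b: "b \<in> B - T" and ab:
          "(a, b) \<in> (avoiding (insert e R) T)\<^sup>*"
      have no: "(a, p) \<notin> (avoiding R T)\<^sup>*" if "p \<in> insert x S - T" for p
        using T(2) a that unfolding separates_def by blast
      have aS: "a \<notin> S" using no[of a] a by auto
      from ab have "b \<notin> S \<and> (a, b) \<in> (avoiding R (S \<union> T))\<^sup>*"
      proof (induction rule: rtrancl_induct)
        case (step z w)
        have z: "(a, z) \<in> (avoiding R T)\<^sup>*" using step.IH avoiding_mono[of R R T "S \<union> T"] by auto
        have zw: "(z, w) \<in> insert e R" "z \<notin> T" "w \<notin> T" using step.hyps by (auto simp: avoiding_def)
        have "z \<noteq> x" using no[of x] z zw by auto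
        then have zwR: "(z, w) \<in> avoiding R T" using zw e by (auto simp: avoiding_def)
        then have "w \<notin> S" using no[of w] rtrancl_into_rtrancl[OF z zwR] zw by auto
        then have "(z, w) \<in> avoiding R (S \<union> T)" using step.IH zwR by (auto simp: avoiding_def)
        then show ?case using step.IH \<open>w \<notin> S\<close> by (auto intro: rtrancl_into_rtrancl)
      qed (use aS in auto)
      then show False using S(2) a b aS avoiding_mono[of R R S "S \<union> T"] unfolding separates_def
        by blast
    qed
    have sepQ: "k \<le> card T" if T: "finite T" "separates R (insert y S) B T" for T
    proof (rule insert.prems(2)[OF T(1)], unfold separates_def, intro ballI notI)
      fix a b assume a: "a \<in> A - T" and b: "b \<in> B - T" and ab:
          "(a, b) \<in> (avoiding (insert e R) T)\<^sup>*"
      have no: "(p, b) \<notin> (avoiding R T)\<^sup>*" if "p \<in> insert y S - T" for p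
        using T(2) b that unfolding separates_def by blast
      have bS: "b \<notin> S" using no[of b] b by auto
      from ab have "a \<notin> S \<and> (a, b) \<in> (avoiding R (S \<union> T))\<^sup>*"
      proof (induction rule: converse_rtrancl_induct)
        case (step w z)
        have z: "(z, b) \<in> (avoiding R T)\<^sup>*" using step.IH avoiding_mono[of R R T "S \<union> T"] by auto
        have zw: "(w, z) \<in> insert e R" "z \<notin> T" "w \<notin> T" using step.hyps by (auto simp: avoiding_def)
        have "z \<noteq> y" using no[of y] z zw by auto
        then have zwR: "(w, z) \<in> avoiding R T" using zw e by (auto simp: avoiding_def)
        then have "w \<notin> S" using no[of w] converse_rtrancl_into_rtrancl[OF zwR z] zw by auto
        then have "(w, z) \<in> avoiding R (S \<union> T)" using step.IH zwR by (auto simp: avoiding_def)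
        then show ?case using step.IH \<open>w \<notin> S\<close> by (auto intro: converse_rtrancl_into_rtrancl)
      qed (use bS in auto)
      then show False using S(2) a b bS avoiding_mono[of R R S "S \<union> T"] unfolding separates_def
        by blast
    qed
    obtain P f where P: "P \<subseteq> insert x S" "card P = k" "linkage R A P f"
      using insert.IH[OF insert.prems(1) sepP] by blast
    have PS: "P = insert x S" using P(1,2) xS(3) S(1) by (metis card_subset_eq finite_insert)
    obtain X g where X: "X \<subseteq> B" "finite X" "card X = k" "linkage R (insert y S) X g"
      using insert.IH[OF _ sepQ] S(1) by blast
    have f: "f p \<noteq> []" "hd (f p) \<in> A" "last (f p) = p" "distinct (f p)"
        "successively (\<lambda>a b. (a, b) \<in> R) (f p)" if "p \<in> insert x S" for p
      using P(3) that unfolding PS linkage_def by auto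
    have fdis: "set (f p) \<inter> set (f q) = {}" if "p \<in> insert x S" "q \<in> insert x S" "p \<noteq> q" for p q
      using P(3) that unfolding PS linkage_def by blast
    have g: "g b \<noteq> []" "hd (g b) \<in> insert y S" "last (g b) = b" "distinct (g b)"
        "successively (\<lambda>a b. (a, b) \<in> R) (g b)" if "b \<in> X" for b
      using X(4) that unfolding linkage_def by auto
    have gdis: "set (g b) \<inter> set (g c) = {}" if "b \<in> X" "c \<in> X" "b \<noteq> c" for b c
      using X(4) that unfolding linkage_def by blast
    have ghd: "b = c" if "b \<in> X" "c \<in> X" "hd (g b) = hd (g c)" for b c
      using gdis[OF that(1,2)] g(1)[OF that(1)] g(1)[OF that(2)] that(3)
      by (metis disjoint_iff hd_in_set)
    have "inj_on (\<lambda>b. hd (g b)) X" using ghd by (auto simp: inj_on_def)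
    then have "card ((\<lambda>b. hd (g b)) ` X) = card (insert y S)" using X(3) xS(4)
      by (simp add: card_image)
    moreover have "(\<lambda>b. hd (g b)) ` X \<subseteq> insert y S" using g(2) by auto
    ultimately have hdg: "(\<lambda>b. hd (g b)) ` X = insert y S" using S(1) by (simp add: card_subset_eq)
    have fS: "set (f p) \<inter> insert x S \<subseteq> {p}" if p: "p \<in> insert x S" for p
    proof
      fix z assume z: "z \<in> set (f p) \<inter> insert x S"
      then have "z \<in> set (f z)" using f(1,3)[of z] last_in_set by (metis IntD2)
      then show "z \<in> {p}" using fdis[of p z] p z by auto
    qed
    have gS: "set (g b) \<inter> insert y S \<subseteq> {hd (g b)}" if b: "b \<in> X" for b
    proof
      fix z assume z: "z \<in> set (g b) \<inter> insert y S"
      then obtain c where c: "c \<in> X" "z = hd (g c)" using hdg by blast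
      then have "z \<in> set (g c)" using g(1) by simp
      then show "z \<in> {hd (g b)}" using gdis[OF b c(1)] z c by auto
    qed
    \<comment> \<open>At a common vertex outside \<open>S\<close>, a prefix of \<open>f p\<close>
      and a suffix of \<open>g b\<close> would combine to a walk from \<open>A\<close> to
      \<open>B\<close> avoiding \<open>S\<close>.\<close>
    have meet: "z \<in> S \<and> z = p \<and> z = hd (g b)"
      if p: "p \<in> insert x S" and b: "b \<in> X" and z: "z \<in> set (f p)" "z \<in> set (g b)" for p b z
    proof -
      have "z \<in> S"
      proof (rule ccontr)
        assume "z \<notin> S"
        have 1: "hd (f p) \<notin> S \<and> (hd (f p), z) \<in> (avoiding R S)\<^sup>*"
          using f[OF p] fS[OF p] z \<open>z \<notin> S\<close> by (intro avoiding_prefix) auto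
        have 2: "last (g b) \<notin> S \<and> (z, last (g b)) \<in> (avoiding R S)\<^sup>*"
          using g[OF b] gS[OF b] z \<open>z \<notin> S\<close> by (intro avoiding_suffix) auto
        have "(hd (f p), b) \<in> (avoiding R S)\<^sup>*" using 1 2 g(3)[OF b] by (metis rtrancl_trans)
        moreover have "hd (f p) \<in> A - S" "b \<in> B - S" using 1 2 f(2)[OF p] g(3)[OF b] b X(1) by auto
        ultimately show False using S(2) unfolding separates_def by blast
      qed
      then show ?thesis using fS[OF p] gS[OF b] z by auto
    qed
    \<comment> \<open>\<open>\<phi> b\<close> selects the path that \<open>g b\<close> continues:
      the one ending where \<open>g b\<close> starts or, if \<open>g b\<close> starts in
      \<open>y\<close>, the one ending in \<open>x\<close>, with the edge \<open>xy\<close> in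
      between.\<close>
    define \<phi> where "\<phi> b = (if hd (g b) = y then x else hd (g b))" for b
    define h where "h b = (if hd (g b) = y then f x @ g b else f (hd (g b)) @ tl (g b))" for b
    have \<phi>: "\<phi> b \<in> insert x S" if "b \<in> X" for b using g(2)[OF that] by (auto simp: \<phi>_def)
    have \<phi>inj: "b = c" if "b \<in> X" "c \<in> X" "\<phi> b = \<phi> c" for b c
      using that ghd[OF that(1,2)] g(2)[OF that(1)] g(2)[OF that(2)] xS
      by (auto simp: \<phi>_def split: if_splits)
    have hset: "set (h b) \<subseteq> set (f (\<phi> b)) \<union> set (g b)" if "b \<in> X" for b
      by (auto simp: h_def \<phi>_def dest: list.set_sel(2)[OF g(1)[OF that]])
    have tl: "tl (g b) = [] \<or> (last (tl (g b)) = b \<and> (hd (g b), hd (tl (g b))) \<in> R)" if "b \<in> X"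
        for b
      using g(1,3,5)[OF that] by (cases "g b") (auto simp: successively_Cons split: if_splits)
    have "linkage (insert e R) A X h"
      unfolding linkage_def
    proof (intro conjI ballI impI)
      fix b assume b: "b \<in> X"
      note fb = f[OF \<phi>[OF b]] and gb = g[OF b]
      show "h b \<noteq> []" using fb(1) gb(1) by (auto simp: h_def \<phi>_def split: if_splits)
      show "hd (h b) \<in> A" using fb(1,2) by (auto simp: h_def \<phi>_def split: if_splits)
      show "last (h b) = b"
        using fb(3) gb(1,3) tl[OF b] by (cases "g b") (auto simp: h_def \<phi>_def split: if_splits)
      have "set (f (\<phi> b)) \<inter> set (if hd (g b) = y then g b else tl (g b)) = {}"
      proof (rule ccontr)
        assume "\<not> ?thesis"
        then obtain z where z: "z \<in> set (f (\<phi> b))"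
            "z \<in> set (if hd (g b) = y then g b else tl (g b))"
          by blast
        then have "z \<in> set (g b)" using gb(1) by (auto split: if_splits dest: list.set_sel(2))
        from meet[OF \<phi>[OF b] b z(1) this] have "z \<in> S" "z = hd (g b)" by auto
        then show False using z(2) gb(1,4) xS by (cases "g b") (auto split: if_splits)
      qed
      then show "distinct (h b)"
        using fb(4) gb(4) by (auto simp: h_def \<phi>_def distinct_tl split: if_splits)
      have sub: "successively (\<lambda>a b. (a, b) \<in> insert e R) xs"
          if "successively (\<lambda>a b. (a, b) \<in> R) xs" for xs
        using that by (rule successively_mono) auto
      have "successively (\<lambda>a b. (a, b) \<in> R) (tl (g b))"
        using gb(5) by (cases "g b") (auto simp: successively_Cons)
      then show "successively (\<lambda>a b. (a, b) \<in> insert e R) (h b)"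
        using sub[OF fb(5)] sub[OF gb(5)] sub[of "tl (g b)"] tl[OF b] fb(3) e
        by (auto simp: h_def \<phi>_def successively_append_iff split: if_splits)
    next
      fix b c assume b: "b \<in> X" and c: "c \<in> X" and "b \<noteq> c"
      have *: "set (f (\<phi> b)) \<inter> set (g c) = {}" if "b \<in> X" "c \<in> X" "b \<noteq> c" for b c
      proof (rule ccontr)
        assume "\<not> ?thesis"
        then obtain z where z: "z \<in> set (f (\<phi> b))" "z \<in> set (g c)" by auto
        from meet[OF \<phi>[OF that(1)] that(2) z] have "z \<in> S" "z = \<phi> b" "z = hd (g c)" by auto
        then have "hd (g b) = hd (g c)" using xS by (auto simp: \<phi>_def split: if_splits)
        then show False using ghd that by blast
      qed
      have "\<phi> b \<noteq> \<phi> c" using \<phi>inj b c \<open>b \<noteq> c\<close> by blast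
      then show "set (h b) \<inter> set (h c) = {}"
        using hset[OF b] hset[OF c] fdis[OF \<phi>[OF b] \<phi>[OF c]] gdis[OF b c \<open>b \<noteq> c\<close>]
          *[OF b c \<open>b \<noteq> c\<close>] *[OF c b] \<open>b \<noteq> c\<close> by blast
    qed
    then show ?thesis using X by blast
  qed
qed

text \<open>Both sides are kept as data: they need not be connected, so the sides of two separations
  can be intersected and united.\<close>

definition separation :: "'a set \<Rightarrow> 'a set set \<Rightarrow> 'a set \<Rightarrow> 'a set \<Rightarrow> 'a set \<Rightarrow> bool" where
  "separation V E A S B \<longleftrightarrow>
     V = A \<union> S \<union> B \<and> A \<inter> S = {} \<and> A \<inter> B = {} \<and> S \<inter> B = {} \<and> A \<noteq> {} \<and> B \<noteq> {} \<and>
     (\<forall>a\<in>A. \<forall>b\<in>B. {a, b} \<notin> E)"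

text \<open>Delete \<open>x\<close> and \<open>y\<close> and link the neighbours of \<open>x\<close>
  to those of \<open>y\<close>; disjoint paths of the linkage become internally disjoint ones when
  both ends are attached.\<close>

lemma menger:
  fixes V :: "'a set"
  assumes "finite V" "x \<in> V" "y \<in> V" "x \<noteq> y" "{x, y} \<notin> E"
    and sep: "\<And>A S B. separation V E A S B \<Longrightarrow> x \<in> A \<Longrightarrow> y \<in> B \<Longrightarrow> k \<le> card S"
  shows "k \<le> kappa V E x y"
proof -
  define W where "W = V - {x, y}"
  define R where "R = {(a, b). a \<in> W \<and> b \<in> W \<and> {a, b} \<in> E}"
  define A where "A = {a \<in> W. {x, a} \<in> E}"
  define B where "B = {a \<in> W. {a, y} \<in> E}"
  have "finite W" using assms(1) by (simp add: W_def)
  then have fin: "finite R" "finite A"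
    by (auto simp: R_def A_def intro: finite_subset[of _ "W \<times> W"])
  have "\<exists>X f. X \<subseteq> B \<and> finite X \<and> card X = k \<and> linkage R A X f"
  proof (rule menger_linkage[OF fin])
    fix S assume S: "finite S" "separates R A B S"
    \<comment> \<open>The side of \<open>x\<close>: all that its neighbours reach outside
      \<open>S\<close>. The separator is \<open>S \<inter> W\<close>, since \<open>S\<close> may
      contain \<open>x\<close>, \<open>y\<close> or points outside \<open>V\<close>.\<close>
    define C where "C = insert x {z \<in> W - S. \<exists>a\<in>A - S. (a, z) \<in> (avoiding R S)\<^sup>*}"
    have "separation V E C (S \<inter> W) (V - (S \<inter> W) - C)"
      unfolding separation_def
    proof (intro conjI ballI)
      show "V - S \<inter> W - C \<noteq> {}" using assms(3,4) by (auto simp: C_def W_def)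
      fix a b assume a: "a \<in> C" and b: "b \<in> V - S \<inter> W - C"
      show "{a, b} \<notin> E"
      proof
        assume ab: "{a, b} \<in> E"
        show False
        proof (cases "b = y")
          case True
          have "a \<noteq> x" using ab True assms(5) by auto
          then obtain a' where a': "a \<in> W - S" "a' \<in> A - S" "(a', a) \<in> (avoiding R S)\<^sup>*"
            using a by (auto simp: C_def)
          then have "a \<in> B - S" using ab True by (auto simp: B_def)
          then show False using S(2) a' unfolding separates_def by blast
        next
          case False
          then have bW: "b \<in> W - S" using b by (auto simp: W_def C_def)
          show False
          proof (cases "a = x")
            case True
            then have "b \<in> A - S" using ab bW by (auto simp: A_def)
            then show False using b bW by (auto simp: C_def)
          next
            case False
            then obtain a' where a': "a \<in> W - S" "a' \<in> A - S" "(a', a) \<in> (avoiding R S)\<^sup>*"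
              using a by (auto simp: C_def)
            then have "(a, b) \<in> avoiding R S" using ab bW by (auto simp: avoiding_def R_def)
            then have "(a', b) \<in> (avoiding R S)\<^sup>*" using a'(3)
              by (rule rtrancl_into_rtrancl[rotated])
            then show False using b bW a' by (auto simp: C_def)
          qed
        qed
      qed
    qed (use assms(2) in \<open>auto simp: C_def W_def\<close>)
    then have "k \<le> card (S \<inter> W)" by (rule sep) (use assms(3,4) in \<open>auto simp: C_def W_def\<close>)
    also have "\<dots> \<le> card S" using S(1) by (intro card_mono) auto
    finally show "k \<le> card S" .
  qed
  then obtain X f where X: "X \<subseteq> B" "finite X" "card X = k" "linkage R A X f" by blast
  have f: "f b \<noteq> []" "hd (f b) \<in> A" "last (f b) = b" "distinct (f b)"
      "successively (\<lambda>a b. (a, b) \<in> R) (f b)" if "b \<in> X" for b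
    using X(4) that unfolding linkage_def by auto
  have inW: "set xs \<subseteq> W" if "successively (\<lambda>a b. (a, b) \<in> R) xs" "xs \<noteq> []" "hd xs \<in> W" for xs
    using that
  proof (induction xs)
    case (Cons a xs)
    then show ?case by (cases "xs = []") (auto simp: successively_Cons R_def)
  qed simp
  have fW: "set (f b) \<subseteq> W" if "b \<in> X" for b
    using inW f[OF that] by (auto simp: A_def)
  define \<P> where "\<P> = (\<lambda>b. x # f b @ [y]) ` X"
  have "inj_on (\<lambda>b. x # f b @ [y]) X" using f(3)
    by (intro inj_onI) (metis append_same_eq list.inject)
  then have card: "card \<P> = k" using X(3) by (simp add: \<P>_def card_image)
  have "is_path V E x y (x # f b @ [y])" if b: "b \<in> X" for b
  proof -
    have "successively (\<lambda>a b. {a, b} \<in> E) (f b)"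
      using f(5)[OF b] by (rule successively_mono) (auto simp: R_def)
    moreover have "{x, hd (f b)} \<in> E" "{last (f b), y} \<in> E"
      using f[OF b] b X(1) by (auto simp: A_def B_def)
    ultimately show ?thesis
      using f[OF b] fW[OF b] assms(2-4)
      by (auto simp: is_path_def W_def successively_Cons successively_append_iff)
  qed
  moreover have "set (x # f b @ [y]) \<inter> set (x # f c @ [y]) \<subseteq> {x, y}" if "b \<in> X" "c \<in> X" "b \<noteq> c"
      for b c
    using X(4) that unfolding linkage_def by auto
  ultimately have "internally_disjoint_paths V E x y \<P>"
    unfolding internally_disjoint_paths_def \<P>_def by (auto simp del: set_simps set_append)
  then show ?thesis
    unfolding kappa_def using card finite_kappa_set[OF assms(1)] by (intro Max_ge) auto
qed

text \<open>Every path from \<open>A\<close> to \<open>B\<close> meets \<open>S\<close>, and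
  vertices chosen there are distinct because paths share only \<open>x\<close> and \<open>y\<close>,
  which lie outside \<open>S\<close>.\<close>

lemma kappa_le_card_separation:
  assumes "finite V" "separation V E A S B" "x \<in> A" "y \<in> B"
  shows "kappa V E x y \<le> card S"
proof -
  have "card \<P> \<le> card S" if P: "internally_disjoint_paths V E x y \<P>" for \<P>
  proof -
    have hit: "\<exists>z\<in>set xs. z \<in> S" if "set xs \<subseteq> V" "xs \<noteq> []" "hd xs \<in> A" "last xs \<in> B"
        "successively (\<lambda>a b. {a, b} \<in> E) xs" for xs
      using that
    proof (induction xs)
      case (Cons a xs)
      show ?case
      proof (cases "xs = []")
        case True
        then show ?thesis using Cons.prems assms(2) by (auto simp: separation_def)
      next
        case False
        then have "{a, hd xs} \<in> E" "hd xs \<in> V" using Cons.prems by (auto simp: successively_Cons)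
        then have "hd xs \<in> A \<or> hd xs \<in> S"
          using Cons.prems assms(2) unfolding separation_def by auto
        then show ?thesis
        proof
          assume "hd xs \<in> A"
          then show ?thesis using Cons False by (auto simp: successively_Cons)
        qed (use False in auto)
      qed
    qed simp
    have "\<exists>z. z \<in> set xs \<and> z \<in> S" if "xs \<in> \<P>" for xs
    proof -
      have "is_path V E x y xs" using P that by (auto simp: internally_disjoint_paths_def)
      then show ?thesis using hit[of xs] assms(3,4) by (auto simp: is_path_def)
    qed
    then obtain z where z: "\<And>xs. xs \<in> \<P> \<Longrightarrow> z xs \<in> set xs" "\<And>xs. xs \<in> \<P> \<Longrightarrow> z xs \<in> S" by metis
    have xyS: "x \<notin> S" "y \<notin> S" using assms by (auto simp: separation_def)
    have "inj_on z \<P>"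
    proof (rule inj_onI)
      fix xs ys assume xs: "xs \<in> \<P>" and ys: "ys \<in> \<P>" and eq: "z xs = z ys"
      show "xs = ys"
      proof (rule ccontr)
        assume "xs \<noteq> ys"
        then have "set xs \<inter> set ys \<subseteq> {x, y}" using P xs ys
          by (auto simp: internally_disjoint_paths_def)
        then show False using z[OF xs] z[OF ys] eq xyS by auto
      qed
    qed
    moreover have "finite S" using assms(1,2) by (auto simp: separation_def)
    ultimately show ?thesis using z(2) by (intro card_inj_on_le) auto
  qed
  moreover have "{card \<P> |\<P>. internally_disjoint_paths V E x y \<P>} \<noteq> {}"
    by (auto simp: internally_disjoint_paths_def intro: exI[of _ "{}"])
  ultimately show ?thesis
    unfolding kappa_def using finite_kappa_set[OF assms(1)] by (subst Max_le_iff) auto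
qed

section \<open>Infinitesimal motions and small separators\<close>

text \<open>These are the affine fields with skew linear part, that is, the velocities of rigid
  motions.\<close>

definition inf_isometry :: "('b::real_inner \<Rightarrow> 'b) \<Rightarrow> bool" where
  "inf_isometry h \<longleftrightarrow> (\<forall>y z. (y - z) \<bullet> (h y - h z) = 0)"

text \<open>The affine map that interpolates \<open>v\<close> sends \<open>a i\<close> to
  \<open>u i\<close>; the conditions on pairs make the matrix of the products
  \<open>a i \<bullet> u j\<close> skew, hence also the linear part.\<close>

lemma inf_isometry_extend_simplex:
  fixes p :: "'a \<Rightarrow> real ^ 'n" and \<sigma> :: "'n \<Rightarrow> 'a"
  assumes det: "det (\<chi> i. p (\<sigma> i) - p z) \<noteq> 0"
    and v: "\<And>x y. x \<in> insert z (range \<sigma>) \<Longrightarrow> y \<in> insert z (range \<sigma>) \<Longrightarrow> (p x - p y) \<bullet> (v x - v y) = 0"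
  shows "\<exists>h. inf_isometry h \<and> (\<forall>x\<in>insert z (range \<sigma>). h (p x) = v x)"
proof -
  define a where "a i = p (\<sigma> i) - p z" for i
  define u where "u i = v (\<sigma> i) - v z" for i
  obtain c where c: "linear c" "\<And>y. y = (\<Sum>i\<in>UNIV. c y $ i *\<^sub>R a i)" "\<And>k. c (a k) = axis k 1"
    using matrix_row_coordinates[of a] det unfolding a_def by blast
  define h where "h y = v z + (\<Sum>i\<in>UNIV. c (y - p z) $ i *\<^sub>R u i)" for y
  have aa: "a i \<bullet> u i = 0" for i using v[of "\<sigma> i" z] by (simp add: a_def u_def)
  have pw: "(a i - a j) \<bullet> (u i - u j) = 0" for i j using v[of "\<sigma> i" "\<sigma> j"]
    by (simp add: a_def u_def)
  have skew: "a i \<bullet> u j + a j \<bullet> u i = 0" for i j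
    using pw[of i j] aa[of i] aa[of j] by (simp add: inner_diff_left inner_diff_right)
  have "inf_isometry h"
    unfolding inf_isometry_def
  proof (intro allI)
    fix y y'
    define e where "e i = c (y - y') $ i" for i
    have "y - y' = (\<Sum>i\<in>UNIV. e i *\<^sub>R a i)" unfolding e_def by (rule c(2))
    moreover have "h y - h y' = (\<Sum>i\<in>UNIV. e i *\<^sub>R u i)"
      by (simp add: h_def e_def linear_diff[OF c(1)] scaleR_diff_left flip: sum_subtractf)
    ultimately have eq: "(y - y') \<bullet> (h y - h y') = (\<Sum>i\<in>UNIV. \<Sum>j\<in>UNIV. e i * e j * (a i \<bullet> u j))"
      by (simp add: inner_sum_left inner_sum_right mult_ac sum_distrib_left, subst sum.swap) (simp add: mult_ac)
    also have "\<dots> = (\<Sum>i\<in>UNIV. \<Sum>j\<in>UNIV. e i * e j * (a j \<bullet> u i))"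
      by (subst sum.swap) (simp add: mult_ac)
    also have "\<dots> = (\<Sum>i\<in>UNIV. \<Sum>j\<in>UNIV. e i * e j * - (a i \<bullet> u j))"
      using skew by (intro sum.cong refl) (metis add_eq_0_iff)
    finally have "(y - y') \<bullet> (h y - h y') = - ((y - y') \<bullet> (h y - h y'))"
      using eq by (simp add: sum_negf)
    then show "(y - y') \<bullet> (h y - h y') = 0" by simp
  qed
  moreover have "h (p z) = v z" by (simp add: h_def linear_0[OF c(1)])
  moreover have "h (p (\<sigma> k)) = v (\<sigma> k)" for k
  proof -
    have "c (p (\<sigma> k) - p z) = axis k 1" using c(3)[of k] by (simp add: a_def)
    then show ?thesis
      by (simp add: h_def axis_def u_def if_distrib[of "\<lambda>r. r *\<^sub>R _"] cong: if_cong)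
  qed
  ultimately show ?thesis by blast
qed

context
  fixes V :: "'a set" and p :: "'a \<Rightarrow> real ^ 'n"
  assumes fin: "finite V" and cardV: "CARD('n) < card V" and gp: "general_position V p"
begin

text \<open>With fewer than d + 1 points another vertex is added. Its velocity has to satisfy at
  most d linear equations, which general position makes solvable; the full simplex is the base of
  the induction.\<close>

lemma inf_isometry_extend:
  assumes "W \<subseteq> V" "card W \<le> CARD('n) + 1"
    and "\<And>x y. x \<in> W \<Longrightarrow> y \<in> W \<Longrightarrow> (p x - p y) \<bullet> (v x - v y) = 0"
  shows "\<exists>h. inf_isometry h \<and> (\<forall>x\<in>W. h (p x) = v x)"
  using assms
proof (induction "CARD('n) + 1 - card W" arbitrary: W v)
  case 0
  then have card: "card W = CARD('n) + 1" by simp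
  then obtain z where z: "z \<in> W" by fastforce
  have "finite W" using 0 fin finite_subset by blast
  then have "card (W - {z}) = CARD('n)" using card z by simp
  then obtain \<sigma> :: "'n \<Rightarrow> 'a" where \<sigma>: "inj \<sigma>" "range \<sigma> = W - {z}" using obtain_enumeration by metis
  have W: "insert z (range \<sigma>) = W" using \<sigma> z by blast
  have "det (\<chi> i. p (\<sigma> i) - p z) \<noteq> 0"
    using gp \<sigma> z 0(2) unfolding general_position_def by blast
  from inf_isometry_extend_simplex[of p \<sigma> z v, OF this] show ?case unfolding W using 0 by blast
next
  case (Suc k)
  then have card: "card W \<le> CARD('n)" by simp
  have fW: "finite W" using Suc.prems fin finite_subset by blast
  have "W \<noteq> V" using card cardV by auto
  then obtain z where z: "z \<in> V" "z \<notin> W" using Suc.prems by blast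
  obtain u where u: "\<And>x. x \<in> W \<Longrightarrow> (p z - p x) \<bullet> u = (p z - p x) \<bullet> v x"
    using general_position_solve[OF gp fin cardV z(1), of W
        "\<lambda>x. (p z - p x) \<bullet> v x"] Suc.prems z card
    by blast
  have "\<exists>h. inf_isometry h \<and> (\<forall>x\<in>insert z W. h (p x) = (v(z := u)) x)"
  proof (rule Suc.hyps(1))
    show "k = CARD('n) + 1 - card (insert z W)" using Suc.hyps(2) z fW by simp
    show "card (insert z W) \<le> CARD('n) + 1" using card z fW by simp
    fix x y assume xy: "x \<in> insert z W" "y \<in> insert z W"
    have "(p x - p z) \<bullet> (v x - u) = 0" if "x \<in> W" for x
      using u[OF that] by (simp add: inner_diff_left inner_diff_right)
    then show "(p x - p y) \<bullet> ((v(z := u)) x - (v(z := u)) y) = 0"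
      using xy z Suc.prems(3)[of x y] u by (auto simp: inner_diff_right)
  qed (use z Suc.prems in auto)
  then obtain h where "inf_isometry h" "\<And>x. x \<in> insert z W \<Longrightarrow> h (p x) = (v(z := u)) x" by blast
  then show ?case using z by (intro exI[of _ h]) force
qed

text \<open>If \<open>S\<close> had fewer than d points, the side \<open>A\<close> could rotate
  about \<open>S\<close> while the rest stands still: edges within \<open>A\<close> or from
  \<open>A\<close> to \<open>S\<close> keep their lengths, and no others are affected.\<close>

lemma inf_rigid_connectivity:
  assumes EV: "\<And>e. e \<in> E \<Longrightarrow> e \<subseteq> V" and rig: "inf_rigid V E p" and sep: "separation V E A S B"
  shows "CARD('n) \<le> card S"
proof (rule ccontr)
  assume "\<not> ?thesis"
  then have S: "card S < CARD('n)" by simp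
  note sp = sep[unfolded separation_def]
  obtain x y where x: "x \<in> A" and y: "y \<in> B" using sp by blast
  have fS: "finite S" using sp fin by simp
  have xy: "x \<in> V" "y \<in> V" "x \<noteq> y" "x \<notin> S" "y \<notin> S" using sp x y by blast+
  \<comment> \<open>\<open>S\<close> and \<open>y\<close> are at most d points, so the velocity of
    \<open>x\<close> can respect the distances to \<open>S\<close> and violate the one to
    \<open>y\<close>.\<close>
  have "\<exists>u. \<forall>z\<in>insert y S. (p x - p z) \<bullet> u = (if z = y then 1 else 0)"
    by (rule general_position_solve[OF gp fin cardV xy(1)])
       (use xy sp S fS in \<open>auto simp: card_insert_if\<close>)
  then obtain u where u: "\<And>z. z \<in> insert y S \<Longrightarrow> (p x - p z) \<bullet> u = (if z = y then 1 else 0)" by blast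
  define v0 where "v0 z = (if z = x then u else 0)" for z
  have "\<exists>h. inf_isometry h \<and> (\<forall>z\<in>insert x S. h (p z) = v0 z)"
  proof (rule inf_isometry_extend)
    show "insert x S \<subseteq> V" using xy sp by blast
    show "card (insert x S) \<le> CARD('n) + 1" using S fS by (simp add: card_insert_if)
    have *: "(p x - p z) \<bullet> u = 0" if "z \<in> S" for z using u[of z] that xy by auto
    fix z z' assume "z \<in> insert x S" "z' \<in> insert x S"
    then show "(p z - p z') \<bullet> (v0 z - v0 z') = 0"
      using * by (auto simp: v0_def inner_diff_left)
  qed
  then obtain h where h: "inf_isometry h" "\<And>z. z \<in> insert x S \<Longrightarrow> h (p z) = v0 z" by blast
  define v where "v z = (if z \<in> A then h (p z) else 0)" for z
  have hS: "h (p z) = 0" if "z \<in> S" for z using h(2)[of z] that xy by (auto simp: v0_def)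
  have iso: "(y - z) \<bullet> (h y - h z) = 0" for y z using h(1) by (auto simp: inf_isometry_def)
  have "(p a - p b) \<bullet> (v a - v b) = 0" if ab: "{a, b} \<in> E" for a b
  proof -
    have V: "a \<in> V" "b \<in> V" using EV[OF ab] by auto
    have ba: "{b, a} \<in> E" using ab by (simp add: insert_commute)
    consider "a \<in> A" "b \<in> A" | "a \<in> A" "b \<in> S" | "a \<in> S" "b \<in> A" | "a \<notin> A" "b \<notin> A"
      using V sp ab ba by blast
    then show ?thesis
    proof cases
      case 2
      then have "b \<notin> A" using sp by blast
      then show ?thesis using 2 iso[of "p a" "p b"] hS[of b] by (simp add: v_def)
    next
      case 3
      then have "a \<notin> A" using sp by blast
      then show ?thesis using 3 iso[of "p a" "p b"] hS[of a] by (simp add: v_def)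
    qed (auto simp: v_def iso)
  qed
  then have "(p x - p y) \<bullet> (v x - v y) = 0" using rig xy unfolding inf_rigid_def by blast
  moreover have "v y = 0" "v x = u" using x y sp h(2)[of x] by (auto simp: v_def v0_def)
  ultimately show False using u[of y] by simp
qed

end

text \<open>Gaussian elimination, with linear maps on functions in place of a matrix: an equation
  either determines one unknown by the others or is void on the unknowns in
  \<open>I\<close>.\<close>

lemma homogeneous_system_nontrivial_solution:
  fixes L :: "'j \<Rightarrow> ('i \<Rightarrow> real) \<Rightarrow> real"
  assumes "finite J" "finite I" "card J < card I"
    and "\<And>j \<mu> \<nu> c. j \<in> J \<Longrightarrow> L j (\<lambda>i. \<mu> i + c * \<nu> i) = L j \<mu> + c * L j \<nu>"
  shows "\<exists>\<mu>. (\<exists>i\<in>I. \<mu> i \<noteq> 0) \<and> (\<forall>j\<in>J. L j \<mu> = 0)"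
  using assms
proof (induction J arbitrary: I L rule: finite_induct)
  case empty
  then obtain i where "i \<in> I" by fastforce
  then show ?case by (intro exI[of _ "\<lambda>_. 1"]) auto
next
  case (insert k J)
  define \<delta> :: "'i \<Rightarrow> 'i \<Rightarrow> real" where "\<delta> i = (\<lambda>i'. if i' = i then 1 else 0)" for i
  have lin: "L j (\<lambda>i. \<mu> i + c * \<nu> i) = L j \<mu> + c * L j \<nu>" if "j \<in> insert k J" for j \<mu> c \<nu>
    using insert.prems(3)[OF that] .
  show ?case
  proof (cases "\<exists>i\<in>I. L k (\<delta> i) \<noteq> 0")
    case True
    then obtain i0 where i0: "i0 \<in> I" "L k (\<delta> i0) \<noteq> 0" by auto
    \<comment> \<open>\<open>s\<close> is the value of the unknown \<open>i0\<close> that equation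
      \<open>k\<close> forces; \<open>fix0\<close> inserts it.\<close>
    define s where "s \<mu> = - L k (\<lambda>i. if i = i0 then 0 else \<mu> i) / L k (\<delta> i0)" for \<mu>
    define fix0 where "fix0 \<mu> = (\<lambda>i. (if i = i0 then 0 else \<mu> i) + s \<mu> * \<delta> i0 i)" for \<mu>
    have s_lin: "s (\<lambda>i. \<mu> i + c * \<nu> i) = s \<mu> + c * s \<nu>" for \<mu> \<nu> c
    proof -
      have "(\<lambda>i. if i = i0 then 0 else \<mu> i + c * \<nu> i)
          = (\<lambda>i. (if i = i0 then 0 else \<mu> i) + c * (if i = i0 then 0 else \<nu> i))" by auto
      then show ?thesis using i0 lin[of k] by (simp add: s_def field_simps)
    qed
    have fix_lin: "fix0 (\<lambda>i. \<mu> i + c * \<nu> i) = (\<lambda>i. fix0 \<mu> i + c * fix0 \<nu> i)" for \<mu> \<nu> c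
      by (auto simp: fix0_def s_lin algebra_simps)
    have "\<exists>\<mu>. (\<exists>i\<in>I - {i0}. \<mu> i \<noteq> 0) \<and> (\<forall>j\<in>J. L j (fix0 \<mu>) = 0)"
    proof (rule insert.IH)
      show "card J < card (I - {i0})" using insert.prems insert.hyps i0 by simp
      show "L j (fix0 (\<lambda>i. \<mu> i + c * \<nu> i)) = L j (fix0 \<mu>) + c * L j (fix0 \<nu>)" if "j \<in> J" for j \<mu> \<nu> c
        unfolding fix_lin using lin[of j] that by simp
    qed (use insert.prems in auto)
    then obtain \<mu> i where \<mu>: "i \<in> I - {i0}" "\<mu> i \<noteq> 0" "\<And>j. j \<in> J \<Longrightarrow> L j (fix0 \<mu>) = 0" by auto
    have "L k (fix0 \<mu>) = L k (\<lambda>i. if i = i0 then 0 else \<mu> i) + s \<mu> * L k (\<delta> i0)"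
      unfolding fix0_def by (rule lin) simp
    then have "L k (fix0 \<mu>) = 0" using i0 by (simp add: s_def)
    moreover have "fix0 \<mu> i \<noteq> 0" using \<mu> by (simp add: fix0_def \<delta>_def)
    ultimately show ?thesis using \<mu> by (intro exI[of _ "fix0 \<mu>"]) auto
  next
    case False
    \<comment> \<open>Equation \<open>k\<close> is void only on functions supported in
      \<open>I\<close>, so the solution is cut off outside \<open>I\<close>.\<close>
    have "\<exists>\<mu>. (\<exists>i\<in>I. \<mu> i \<noteq> 0) \<and> (\<forall>j\<in>J. L j (\<lambda>i. if i \<in> I then \<mu> i else 0) = 0)"
    proof (rule insert.IH)
      show "L j (\<lambda>i. if i \<in> I then \<mu> i + c * \<nu> i else 0)
        = L j (\<lambda>i. if i \<in> I then \<mu> i else 0) + c * L j (\<lambda>i.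
            if i \<in> I then \<nu> i else 0)" if "j \<in> J" for j \<mu> \<nu> c
      proof -
        have "(\<lambda>i. if i \<in> I then \<mu> i + c * \<nu> i else 0)
          = (\<lambda>i. (if i \<in> I then \<mu> i else 0) + c * (if i \<in> I then \<nu> i else 0))" by auto
        then show ?thesis using lin[of j] that by simp
      qed
    qed (use insert in auto)
    then obtain \<mu> where \<mu>: "\<exists>i\<in>I. \<mu> i \<noteq> 0" "\<forall>j\<in>J. L j (\<lambda>i. if i \<in> I then \<mu> i else 0) = 0" by auto
    have zero: "L k (\<lambda>_. 0) = 0" using lin[of k "\<lambda>_. 0" 1 "\<lambda>_. 0"] by simp
    have "L k (\<lambda>i. if i \<in> I' then \<mu> i else 0) = 0" if "I' \<subseteq> I" for I'
      using finite_subset[OF that insert.prems(1)] that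
    proof (induction I' rule: finite_induct)
      case (insert i I')
      have "(\<lambda>i'. if i' \<in> insert i I' then \<mu> i' else 0)
          = (\<lambda>i'. (if i' \<in> I' then \<mu> i' else 0) + \<mu> i * \<delta> i i')"
        using insert.hyps by (auto simp: \<delta>_def)
      then show ?case using lin[of k] insert False by simp
    qed (use zero in simp)
    then show ?thesis using \<mu> by (intro exI[of _ "\<lambda>i. if i \<in> I then \<mu> i else 0"]) auto
  qed
qed

lemma separation_swap: "separation V E A S B \<Longrightarrow> separation V E B S A"
  unfolding separation_def by (metis Int_commute Un_commute Un_assoc insert_commute)

text \<open>No neighbour of the corner \<open>A \<inter> C\<close> is in \<open>B\<close> or
  \<open>D\<close>; the remaining vertices outside the corner form its boundary, which lies in
  \<open>S \<union> T\<close>.\<close>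

lemma separation_corner:
  assumes "separation V E A S B" "separation V E C T D" "A \<inter> C \<noteq> {}"
  shows "separation V E (A \<inter> C) ((S \<inter> C) \<union> (S \<inter> T) \<union> (T \<inter> A)) (B \<union> D)"
proof -
  note ab = assms(1)[unfolded separation_def] and cd = assms(2)[unfolded separation_def]
  have V: "V = A \<union> S \<union> B" "V = C \<union> T \<union> D" using ab cd by simp_all
  have ab': "A \<inter> S = {}" "A \<inter> B = {}" "S \<inter> B = {}" and cd': "C \<inter> T = {}" "C \<inter> D = {}" "T \<inter> D = {}"
    using ab cd by simp_all
  have E: "{a, b} \<notin> E" if "a \<in> A" "b \<in> B" for a b using ab that by simp
  have E': "{a, b} \<notin> E" if "a \<in> C" "b \<in> D" for a b using cd that by simp
  show ?thesis
    unfolding separation_def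
  proof (intro conjI ballI)
    show "V = A \<inter> C \<union> (S \<inter> C \<union> S \<inter> T \<union> T \<inter> A) \<union> (B \<union> D)"
      using V by auto
    show "A \<inter> C \<inter> (S \<inter> C \<union> S \<inter> T \<union> T \<inter> A) = {}" using ab'(1) cd'(1) by blast
    show "A \<inter> C \<inter> (B \<union> D) = {}" using ab'(2) cd'(2) by blast
    show "(S \<inter> C \<union> S \<inter> T \<union> T \<inter> A) \<inter> (B \<union> D) = {}"
      using ab'(2,3) cd'(2,3) by blast
    show "{a, b} \<notin> E" if "a \<in> A \<inter> C" "b \<in> B \<union> D" for a b using that E E' by blast
    show "A \<inter> C \<noteq> {}" by (rule assms(3))
    show "B \<union> D \<noteq> {}" using ab by simp
  qed
qed

lemma card_strict_pairs_less:
  assumes "0 < a"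
  shows "card {(i, j :: nat). i < j \<and> j < a} < card {(i, j). i < j \<and> j \<le> a}"
proof (rule psubset_card_mono)
  show "finite {(i, j). i < j \<and> j \<le> a}"
    by (rule finite_subset[of _ "{..a} \<times> {..a}"]) auto
  have "(0, a) \<in> {(i, j). i < j \<and> j \<le> a}" "(0, a) \<notin> {(i, j :: nat). i < j \<and> j < a}"
    using assms by auto
  then show "{(i, j :: nat). i < j \<and> j < a} \<subset> {(i, j). i < j \<and> j \<le> a}" by auto
qed

lemma orthonormal_family:
  fixes X :: "'b::euclidean_space set"
  assumes "finite X" "card X + k \<le> DIM('b)"
  shows "\<exists>e :: nat \<Rightarrow> 'b. (\<forall>i<k. \<forall>j<k. e i \<bullet> e j = (if i = j then 1 else 0)) \<and>
           (\<forall>i<k. \<forall>x\<in>X. e i \<bullet> x = 0)"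
proof -
  define U where "U = {y. \<forall>x \<in> span X. orthogonal x y}"
  have "dim U + dim (span X) = dim (UNIV :: 'b set)"
  proof -
    have "dim {y \<in> UNIV. \<forall>x \<in> span X. orthogonal x y} + dim (span X) = dim (UNIV :: 'b set)"
      by (rule dim_subspace_orthogonal_to_vectors) auto
    then show ?thesis by (simp add: U_def)
  qed
  moreover have "dim (span X) \<le> card X" using assms(1) by (simp add: dim_le_card')
  ultimately have dim: "k \<le> dim U" using assms(2) by (simp add: dim_UNIV)
  have "subspace U" unfolding U_def by (rule subspace_orthogonal_to_vectors)
  then obtain B where B: "B \<subseteq> U" "pairwise orthogonal B" "\<And>x. x \<in> B \<Longrightarrow> norm x = 1"
    "independent B" "card B = dim U" "span B = U"
    using orthonormal_basis_subspace by blast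
  have "finite B" using B(4) by (rule independent_imp_finite)
  obtain f where f: "bij_betw f {..<card B} B"
    using \<open>finite B\<close> ex_bij_betw_nat_finite by (metis atLeast0LessThan)
  have fB: "f i \<in> B" if "i < k" for i
    using f that dim B(5) by (auto simp: bij_betw_def)
  show ?thesis
  proof (intro exI[of _ f] conjI allI impI ballI)
    fix i j assume ij: "i < k" "j < k"
    show "f i \<bullet> f j = (if i = j then 1 else 0)"
    proof (cases "i = j")
      case True
      then show ?thesis using B(3)[OF fB[OF ij(1)]] by (simp add: norm_eq_1)
    next
      case False
      then have "f i \<noteq> f j" using f ij dim B(5) by (auto simp: bij_betw_def inj_on_def)
      then show ?thesis using B(2) fB ij False by (auto simp: pairwise_def orthogonal_def)
    qed
  next
    fix i x assume "i < k" "x \<in> X"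
    then have "f i \<in> U" "x \<in> span X" using fB B(1) by (auto intro: span_base)
    then show "f i \<bullet> x = 0" by (auto simp: U_def orthogonal_def inner_commute)
  qed
qed

context
  fixes V :: "'a set" and E :: "'a set set" and p :: "'a \<Rightarrow> real ^ 'n"
  assumes fin: "finite V" and cardV: "CARD('n) < card V" and gp: "general_position V p"
    and EV: "\<And>e. e \<in> E \<Longrightarrow> e \<subseteq> V" and rig: "inf_rigid V E p"
begin

text \<open>The four corners of the crossing move as infinitesimally rigid bodies: the corner \<open>B, D\<close> is fixed, the corner
  \<open>A, D\<close> rotates about \<open>S - C\<close> with generator \<open>\<Sum>i<j. \<mu> i j (e i \<and> e j)\<close>, where \<open>e 0, \<dots>, e a\<close> are orthonormal to \<open>S - C\<close>
  and \<open>a = card (S \<inter> C)\<close>. Together with the velocities \<open>w\<close> of \<open>S \<inter> C\<close> these are \<open>a (a + 1) / 2 + a d\<close> unknowns,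
  subject to one equation for each pair in \<open>(S \<inter> C) \<times> T\<close> and each pair in \<open>S \<inter> C\<close>, that is to only
  \<open>a d + a (a - 1) / 2\<close> equations. The two corners in \<open>C\<close> follow because their boundaries have at most \<open>d\<close> points.\<close>

lemma no_crossing_small_corner:
  assumes AB: "separation V E A S B" and CD: "separation V E C T D"
    and card: "card S = CARD('n)" "card T = CARD('n)"
    and ne: "S \<inter> C \<noteq> {}" "S \<inter> D \<noteq> {}"
    and min: "card (S \<inter> C) \<le> card (T \<inter> A)" "card (S \<inter> C) \<le> card (T \<inter> B)"
  shows False
proof -
  note ab = AB[unfolded separation_def] and cd = CD[unfolded separation_def]
  have "S \<subseteq> V" "T \<subseteq> V" using ab cd by blast+
  then have fS: "finite S" "finite T" using fin finite_subset by blast+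
  define a where "a = card (S \<inter> C)"
  define H where "H = S - C"
  have "a > 0" using ne fS by (simp add: a_def card_gt_0_iff)
  obtain h0 where h0: "h0 \<in> S" "h0 \<in> D" using ne by blast
  have h0H: "h0 \<in> H" using h0 cd by (auto simp: H_def)
  have cardH: "card H + a = CARD('n)"
    unfolding H_def a_def using card fS
      by (metis card_Diff_subset_Int card_mono finite_Int inf_le1 le_add_diff_inverse2)
  have fH: "finite H" using fS by (simp add: H_def)
  \<comment> \<open>Seen from \<open>h0\<close>, the points of \<open>H\<close> span at most
    \<open>card H - 1\<close> directions, which leaves room for d - card H + 1 = a + 1 orthonormal
    vectors.\<close>
  define X where "X = (\<lambda>x. p x - p h0) ` (H - {h0})"
  have "card X \<le> card (H - {h0})" unfolding X_def using fH by (intro card_image_le) auto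
  moreover have "0 < card H" using h0H fH by (auto simp: card_gt_0_iff)
  ultimately have "card X + (a + 1) \<le> CARD('n)" using cardH fH h0H
    by (simp add: card_Diff_singleton)
  then have "\<exists>e :: nat \<Rightarrow> real ^ 'n. (\<forall>i<a + 1. \<forall>j<a + 1. e i \<bullet> e j = (if i = j then 1 else 0)) \<and>
      (\<forall>i<a + 1. \<forall>x\<in>X. e i \<bullet> x = 0)"
    by (intro orthonormal_family) (use fH in \<open>auto simp: X_def\<close>)
  then obtain e :: "nat \<Rightarrow> real ^ 'n" where
    e: "\<forall>i<a + 1. \<forall>j<a + 1. e i \<bullet> e j = (if i = j then 1 else 0)" "\<forall>i<a + 1. \<forall>x\<in>X. e i \<bullet> x = 0"
    by blast
  have e_on: "e i \<bullet> e j = (if i = j then 1 else 0)" if "i \<le> a" "j \<le> a" for i j using e(1) that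
    by simp
  have e_X: "e i \<bullet> x = 0" if "i \<le> a" "x \<in> X" for i x using e(2) that by simp
  have e_H: "e i \<bullet> (p x - p h0) = 0" if "i \<le> a" "x \<in> H" for i x
    using e_X[OF that(1)] that(2) by (cases "x = h0") (auto simp: X_def)
  define I1 where "I1 = {(i, j :: nat). i < j \<and> j \<le> a}"
  define J2 where "J2 = {(i, j :: nat). i < j \<and> j < a}"
  have fI1: "finite I1" unfolding I1_def by (rule finite_subset[of _ "{..a} \<times> {..a}"]) auto
  have fJ2: "finite J2" unfolding J2_def by (rule finite_subset[of _ "{..a} \<times> {..a}"]) auto
  have IJ: "card J2 < card I1" unfolding I1_def J2_def by (rule card_strict_pairs_less) fact
  define I :: "(nat \<times> nat + 'a \<times> 'n) set" where "I = I1 <+> ((S \<inter> C) \<times> UNIV)"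
  define J where "J = ((S \<inter> C) \<times> T) <+> J2"
  have fIJ: "finite I" "finite J" using fI1 fJ2 fS by (auto simp: I_def J_def)
  have cardIJ: "card J < card I"
    using fI1 fJ2 fS IJ card by (simp add: I_def J_def card_Plus card_cartesian_product)
  obtain \<gamma> where \<gamma>: "bij_betw \<gamma> {..<a} (S \<inter> C)"
    using fS ex_bij_betw_nat_finite[of "S \<inter> C"] by (metis a_def atLeast0LessThan finite_Int)
  define M where "M \<mu> z = (\<Sum>(i, j)\<in>I1. \<mu> (Inl (i, j)) *\<^sub>R ((e i \<bullet> z) *\<^sub>R e j - (e j \<bullet> z) *\<^sub>R e i))"
    for \<mu> :: "nat \<times> nat + 'a \<times> 'n \<Rightarrow> real" and z
  define w where "w \<mu> x = (\<chi> k. \<mu> (Inr (x, k)))" for \<mu> :: "nat \<times> nat + 'a \<times> 'n \<Rightarrow> real" and x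
  define vT where "vT \<mu> t = (if t \<in> A then M \<mu> (p t - p h0) else 0)" for \<mu> t
  define L where "L j \<mu> = (case j of Inl (x, t) \<Rightarrow> (p x - p t) \<bullet> (w \<mu> x - vT \<mu> t)
      | Inr (i, j) \<Rightarrow> (p (\<gamma> i) - p (\<gamma> j)) \<bullet> (w \<mu> (\<gamma> i) - w \<mu> (\<gamma> j)))" for j \<mu>
  have M_lin: "M (\<lambda>i. \<mu> i + c * \<nu> i) z = M \<mu> z + c *\<^sub>R M \<nu> z" for \<mu> \<nu> c z
    by (simp add: M_def case_prod_unfold sum.distrib scaleR_add_left scaleR_sum_right)
  have w_lin: "w (\<lambda>i. \<mu> i + c * \<nu> i) x = w \<mu> x + c *\<^sub>R w \<nu> x" for \<mu> \<nu> c x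
    by (simp add: w_def vec_eq_iff)
  have vT_lin: "vT (\<lambda>i. \<mu> i + c * \<nu> i) x = vT \<mu> x + c *\<^sub>R vT \<nu> x" for \<mu> \<nu> c x
    by (simp add: vT_def M_lin)
  have "\<exists>\<mu>. (\<exists>i\<in>I. \<mu> i \<noteq> 0) \<and> (\<forall>j\<in>J. L j \<mu> = 0)"
  proof (rule homogeneous_system_nontrivial_solution[OF fIJ(2,1) cardIJ])
    show "L j (\<lambda>i. \<mu> i + c * \<nu> i) = L j \<mu> + c * L j \<nu>" for j \<mu> \<nu> c
      by (auto simp: L_def w_lin vT_lin algebra_simps inner_simps split: sum.splits)
  qed
  then obtain \<mu> where \<mu>: "\<exists>i\<in>I. \<mu> i \<noteq> 0" "\<And>j. j \<in> J \<Longrightarrow> L j \<mu> = 0" by blast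
  have M_add: "M \<mu> (y - z) = M \<mu> y - M \<mu> z" for y z
    by (simp add: M_def case_prod_unfold inner_diff_right algebra_simps flip: sum_subtractf)
  have M_skew: "y \<bullet> M \<mu> z = - (z \<bullet> M \<mu> y)" for y z
    unfolding M_def case_prod_unfold inner_sum_right sum_negf[symmetric]
    by (intro sum.cong refl) (simp add: inner_simps inner_commute algebra_simps)
  have M_self: "y \<bullet> M \<mu> y = 0" for y using M_skew[of y y] by simp
  define h4 where "h4 z = M \<mu> (z - p h0)" for z
  have iso4: "(y - z) \<bullet> (h4 y - h4 z) = 0" for y z
    using M_self[of "y - z"] by (simp add: h4_def flip: M_add)
  have h4H: "h4 (p x) = 0" if "x \<in> H" for x
    unfolding h4_def M_def using e_H[OF _ that] by (intro sum.neutral) (auto simp: I1_def)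
  define v0 where "v0 x = (if x \<in> S \<inter> C then w \<mu> x else if x \<in> T \<inter> A then h4 (p x) else 0)" for x
  have SC: "(p x - p y) \<bullet> (v0 x - v0 y) = 0" if "x \<in> S \<inter> C" "y \<in> S \<inter> C" for x y
  proof -
    obtain i j where ij: "i < a" "j < a" "x = \<gamma> i" "y = \<gamma> j"
      using \<gamma> \<open>x \<in> S \<inter> C\<close> \<open>y \<in> S \<inter> C\<close> by (metis bij_betw_def imageE lessThan_iff)
    have *: "(p (\<gamma> i) - p (\<gamma> j)) \<bullet> (w \<mu> (\<gamma> i) - w \<mu> (\<gamma> j)) = 0" if "i < j" "j < a" for i j
    proof -
      have "Inr (i, j) \<in> J" using that unfolding J_def J2_def by blast
      from \<mu>(2)[OF this] show ?thesis by (simp add: L_def)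
    qed
    show ?thesis
    proof (cases i j rule: linorder_cases)
      case less
      then show ?thesis using *[of i j] ij that by (simp add: v0_def)
    next
      case greater
      then show ?thesis using *[of j i] ij that by (simp add: v0_def inner_simps algebra_simps)
    qed (use ij in simp)
  qed
  have ST: "(p x - p t) \<bullet> (v0 x - v0 t) = 0" if "x \<in> S \<inter> C" "t \<in> T" for x t
  proof -
    have "L (Inl (x, t)) \<mu> = 0" using that by (intro \<mu>(2)) (auto simp: J_def)
    moreover have "v0 t = vT \<mu> t" using that cd by (auto simp: v0_def vT_def h4_def)
    ultimately show ?thesis using that by (simp add: L_def v0_def)
  qed
  have v0H: "v0 x = 0" if "x \<in> H" for x
    using that h4H[OF that] by (auto simp: v0_def H_def)
  have v0X4: "v0 x = h4 (p x)" if "x \<in> H \<or> x \<in> T \<inter> A" for x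
  proof (cases "x \<in> H")
    case False
    then have "x \<in> T \<inter> A" "x \<notin> C" using that cd by blast+
    then show ?thesis by (simp add: v0_def)
  qed (simp add: h4H v0H)
  have TA: "(p x - p t) \<bullet> (v0 x - v0 t) = 0" if "x \<in> H \<or> x \<in> T \<inter> A" "t \<in> H \<or> t \<in> T \<inter> A" for x t
    using v0X4[OF that(1)] v0X4[OF that(2)] iso4 by simp
  have v0X3: "v0 x = 0" if "x \<in> H \<or> x \<in> T \<inter> B" for x
  proof (cases "x \<in> H")
    case False
    then have "x \<notin> A" "x \<notin> C" using that cd ab by blast+
    then show ?thesis by (simp add: v0_def)
  qed (simp add: v0H)
  have cardSum: "card (S \<inter> T) + card (T \<inter> A) + card (T \<inter> B) = CARD('n)"
  proof -
    have "T = (S \<inter> T) \<union> (T \<inter> A) \<union> (T \<inter> B)" using ab cd by blast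
    moreover have "card ((S \<inter> T) \<union> (T \<inter> A) \<union> (T \<inter> B)) = card (S \<inter> T) + card (T \<inter> A) + card (T \<inter> B)"
    proof -
      have "((S \<inter> T) \<union> (T \<inter> A)) \<inter> (T \<inter> B) = {}" "(S \<inter> T) \<inter> (T \<inter> A) = {}" using ab by blast+
      then show ?thesis using fS by (simp add: card_Un_disjoint)
    qed
    ultimately show ?thesis using card by simp
  qed
  define W1 where "W1 = (S \<inter> C) \<union> (S \<inter> T) \<union> (T \<inter> A)"
  define W2 where "W2 = (S \<inter> C) \<union> (S \<inter> T) \<union> (T \<inter> B)"
  \<comment> \<open>\<open>S \<inter> C\<close> is no larger than \<open>T \<inter> B\<close>, so
    \<open>W1\<close> has at most as many points as \<open>T\<close>, that is d; likewise
    \<open>W2\<close>, with \<open>T \<inter> A\<close>.\<close>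
  have cW: "card W1 \<le> CARD('n) + 1" "card W2 \<le> CARD('n) + 1"
  proof -
    have "card W1 \<le> card (S \<inter> C) + card (S \<inter> T) + card (T \<inter> A)"
      unfolding W1_def by (meson card_Un_le order_trans add_mono order_refl)
    then show "card W1 \<le> CARD('n) + 1" using min cardSum by linarith
    have "card W2 \<le> card (S \<inter> C) + card (S \<inter> T) + card (T \<inter> B)"
      unfolding W2_def by (meson card_Un_le order_trans add_mono order_refl)
    then show "card W2 \<le> CARD('n) + 1" using min cardSum by linarith
  qed
  have coreH: "x \<in> H" if "x \<in> S \<inter> T" for x using that cd by (auto simp: H_def)
  have sym: "(p x - p y) \<bullet> (v0 x - v0 y) = (p y - p x) \<bullet> (v0 y - v0 x)" for x y
    by (simp add: inner_simps algebra_simps)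
  have "\<exists>h. inf_isometry h \<and> (\<forall>x\<in>W1. h (p x) = v0 x)"
  proof (rule inf_isometry_extend[OF fin cardV gp _ cW(1)])
    show "W1 \<subseteq> V" using ab cd by (auto simp: W1_def)
    fix x y assume x: "x \<in> W1" and y: "y \<in> W1"
    consider "x \<in> S \<inter> C" "y \<in> S \<inter> C" | "x \<in> S \<inter> C" "y \<in> T" | "x \<in> T" "y \<in> S \<inter> C"
      | "x \<in> H \<or> x \<in> T \<inter> A" "y \<in> H \<or> y \<in> T \<inter> A"
      using x y coreH unfolding W1_def by blast
    then show "(p x - p y) \<bullet> (v0 x - v0 y) = 0"
      by cases (use SC ST TA sym in metis)+
  qed
  then obtain h1 where h1: "inf_isometry h1" "\<And>x. x \<in> W1 \<Longrightarrow> h1 (p x) = v0 x" by blast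
  have "\<exists>h. inf_isometry h \<and> (\<forall>x\<in>W2. h (p x) = v0 x)"
  proof (rule inf_isometry_extend[OF fin cardV gp _ cW(2)])
    show "W2 \<subseteq> V" using ab cd by (auto simp: W2_def)
    fix x y assume x: "x \<in> W2" and y: "y \<in> W2"
    consider "x \<in> S \<inter> C" "y \<in> S \<inter> C" | "x \<in> S \<inter> C" "y \<in> T" | "x \<in> T" "y \<in> S \<inter> C"
      | "x \<in> H \<or> x \<in> T \<inter> B" "y \<in> H \<or> y \<in> T \<inter> B"
      using x y coreH unfolding W2_def by blast
    then show "(p x - p y) \<bullet> (v0 x - v0 y) = 0"
    proof cases
      case 4
      then show ?thesis using v0X3[of x] v0X3[of y] by simp
    qed (use SC ST sym in metis)+
  qed
  then obtain h2 where h2: "inf_isometry h2" "\<And>x. x \<in> W2 \<Longrightarrow> h2 (p x) = v0 x" by blast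
  define v where "v z = (if z \<in> S \<union> T then v0 z else if z \<in> A \<inter> C then h1 (p z)
      else if z \<in> A then h4 (p z) else if z \<in> C then h2 (p z) else 0)" for z
  have v1: "v z = h1 (p z)" if "z \<in> A \<union> S" "z \<in> C \<union> T" for z
  proof (cases "z \<in> S \<union> T")
    case True
    then have "z \<in> W1" using that by (auto simp: W1_def)
    then show ?thesis using True h1(2) by (simp add: v_def)
  qed (use that in \<open>simp add: v_def\<close>)
  have v2: "v z = h2 (p z)" if "z \<in> B \<union> S" "z \<in> C \<union> T" for z
  proof (cases "z \<in> S \<union> T")
    case True
    then have "z \<in> W2" using that by (auto simp: W2_def)
    then show ?thesis using True h2(2) by (simp add: v_def)
  next
    case False
    then have "z \<notin> A" "z \<in> C" using that ab by blast+
    then show ?thesis using False by (simp add: v_def)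
  qed
  have v3: "v z = 0" if "z \<in> B \<union> S" "z \<in> D \<union> T" for z
  proof (cases "z \<in> S \<union> T")
    case True
    then have "z \<in> H \<or> z \<in> T \<inter> B" using that cd by (auto simp: H_def)
    then show ?thesis using True v0X3 by (simp add: v_def)
  next
    case False
    then have "z \<notin> A" "z \<notin> C" using that ab cd by blast+
    then show ?thesis using False by (simp add: v_def)
  qed
  have v4: "v z = h4 (p z)" if "z \<in> A \<union> S" "z \<in> D \<union> T" for z
  proof (cases "z \<in> S \<union> T")
    case True
    then have "z \<in> H \<or> z \<in> T \<inter> A" using that cd by (auto simp: H_def)
    then show ?thesis using True v0X4 by (simp add: v_def)
  next
    case False
    then have "z \<in> A" "z \<notin> C" using that ab cd by blast+
    then show ?thesis using False by (simp add: v_def)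
  qed
  have iso: "(y - z) \<bullet> (h1 y - h1 z) = 0" "(y - z) \<bullet> (h2 y - h2 z) = 0" for y z
    using h1(1) h2(1) by (auto simp: inf_isometry_def)
  have motion: "(p x - p y) \<bullet> (v x - v y) = 0" if xy: "{x, y} \<in> E" for x y
  proof -
    have V: "x \<in> V" "y \<in> V" using EV[OF xy] by auto
    have yx: "{y, x} \<in> E" using xy by (simp add: insert_commute)
    have "x \<in> A \<union> S \<and> y \<in> A \<union> S \<or> x \<in> B \<union> S \<and> y \<in> B \<union> S" using V ab xy yx by blast
    moreover have "x \<in> C \<union> T \<and> y \<in> C \<union> T \<or> x \<in> D \<union> T \<and> y \<in> D \<union> T" using V cd xy yx by blast
    ultimately show ?thesis
      using v1[of x] v1[of y] v2[of x] v2[of y] v3[of x] v3[of y] v4[of x] v4[of y] iso iso4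
      by (elim disjE conjE) simp_all
  qed
  have all: "(p x - p y) \<bullet> (v x - v y) = 0" if "x \<in> V" "y \<in> V" for x y
    using rig that motion unfolding inf_rigid_def by blast
  \<comment> \<open>\<open>T \<inter> A\<close> and \<open>T \<inter> B\<close> have at least
    \<open>a\<close> points each; together with \<open>H\<close> these are at least d, enough to
    determine the velocity of a further vertex.\<close>
  have cHT: "CARD('n) \<le> card (H \<union> (T \<inter> A))" "CARD('n) \<le> card (H \<union> (T \<inter> B))"
  proof -
    have "card (H \<union> (T \<inter> A)) = card H + card (T \<inter> A)" "card (H \<union> (T \<inter> B)) = card H + card (T \<inter> B)"
    proof -
      have "H \<inter> (T \<inter> A) = {}" "H \<inter> (T \<inter> B) = {}" using ab by (auto simp: H_def)
      then show "card (H \<union> (T \<inter> A)) = card H + card (T \<inter> A)"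
          "card (H \<union> (T \<inter> B)) = card H + card (T \<inter> B)"
        using fH fS by (simp_all add: card_Un_disjoint)
    qed
    then show "CARD('n) \<le> card (H \<union> (T \<inter> A))" "CARD('n) \<le> card (H \<union> (T \<inter> B))"
      using cardH min by (auto simp: a_def)
  qed
  have HV: "H \<subseteq> V" "T \<subseteq> V" "S \<subseteq> V" using ab cd by (auto simp: H_def)
  have vH: "v x = 0" if "x \<in> H \<or> x \<in> T \<inter> B" for x
  proof (rule v3)
    show "x \<in> B \<union> S" using that by (auto simp: H_def)
    show "x \<in> D \<union> T" using that cd HV by (auto simp: H_def)
  qed
  have h4T: "h4 (p t) = 0" if t: "t \<in> T \<inter> A" for t
  proof -
    have "v t = 0"
    proof (rule general_position_span[OF gp _ _ cHT(2)])
      show "t \<in> V" "H \<union> (T \<inter> B) \<subseteq> V - {t}" using t ab cd HV by (auto simp: H_def)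
      fix x assume x: "x \<in> H \<union> (T \<inter> B)"
      then have "x \<in> V" "v x = 0" using HV vH by auto
      then show "(p t - p x) \<bullet> v t = 0" using all[of t x] t HV by auto
    qed
    moreover have "v t = h4 (p t)" using t by (intro v4) auto
    ultimately show ?thesis by simp
  qed
  have w0: "w \<mu> x = 0" if x: "x \<in> S \<inter> C" for x
  proof (rule general_position_span[OF gp])
    show "x \<in> V" "T \<subseteq> V - {x}" using x cd HV by auto
    show "CARD('n) \<le> card T" using card by simp
    fix t assume t: "t \<in> T"
    have "v0 t = 0" using t h4T[of t] v0X3[of t] coreH[of t] cd ab by (auto simp: v0_def)
    then show "(p x - p t) \<bullet> w \<mu> x = 0" using ST[OF x t] x by (simp add: v0_def)
  qed
  obtain x0 where x0: "x0 \<in> S \<inter> C" using ne by blast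
  have QM: "M \<mu> (p x - p h0) = 0" if "x \<in> H \<union> (T \<inter> A)" for x
    using that h4H h4T by (auto simp: h4_def)
  have x0Q: "x0 \<in> V" "H \<union> (T \<inter> A) \<subseteq> V - {x0}" using x0 HV cd by (auto simp: H_def)
  \<comment> \<open>By skewness every value of \<open>M \<mu>\<close> is orthogonal to the
    differences that \<open>M \<mu>\<close> annihilates; one more orthogonality, at
    \<open>x0\<close>, leaves only 0.\<close>
  have M0: "M \<mu> y = 0" if y: "(p x0 - p h0) \<bullet> M \<mu> y = 0" for y
  proof (rule general_position_span[OF gp x0Q cHT(1)])
    fix x assume x: "x \<in> H \<union> (T \<inter> A)"
    have "(p x - p h0) \<bullet> M \<mu> y = 0" using M_skew[of "p x - p h0" y] QM[OF x] by simp
    moreover have "p x0 - p x = (p x0 - p h0) - (p x - p h0)" by simp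
    ultimately show "(p x0 - p x) \<bullet> M \<mu> y = 0" using y by (simp only: inner_diff_left)
  qed
  \<comment> \<open>A skew map supplies the missing orthogonality for this one vector; that its
    image is 0 then supplies it for every \<open>y\<close>.\<close>
  have "M \<mu> (p x0 - p h0) = 0" by (rule M0) (rule M_self)
  then have M0': "M \<mu> y = 0" for y
    using M_skew[of "p x0 - p h0" y] by (intro M0) simp
  have "\<mu> (Inl (k, l)) = 0" if kl: "(k, l) \<in> I1" for k l
  proof -
    have "0 = e l \<bullet> M \<mu> (e k)" by (simp add: M0')
    also have "\<dots> = (\<Sum>(i, j)\<in>I1. if (i, j) = (k, l) then \<mu> (Inl (i, j)) else 0)"
      unfolding M_def inner_sum_right case_prod_unfold
    proof (rule sum.cong[OF refl])
      fix q assume "q \<in> I1"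
      then obtain i j where q: "q = (i, j)" "i < j" "j \<le> a" by (auto simp: I1_def)
      have "k < l" "l \<le> a" using kl by (auto simp: I1_def)
      then show "e l \<bullet> (\<mu> (Inl (fst q,
          snd q)) *\<^sub>R ((e (fst q) \<bullet> e k) *\<^sub>R e (snd q) - (e (snd q) \<bullet> e k) *\<^sub>R e (fst q)))
          = (if (fst q, snd q) = (k, l) then \<mu> (Inl (fst q, snd q)) else 0)"
        using q by (auto simp: e_on inner_diff_right)
    qed
    also have "\<dots> = (\<Sum>q\<in>I1. if q = (k, l) then \<mu> (Inl (k, l)) else 0)"
      by (rule sum.cong) (auto split: if_splits)
    also have "\<dots> = \<mu> (Inl (k, l))" using kl fI1 by simp
    finally show ?thesis by simp
  qed
  moreover have "\<mu> (Inr (x, k)) = 0" if "x \<in> S \<inter> C" for x k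
    using w0[OF that] by (simp add: w_def vec_eq_iff)
  ultimately show False using \<mu>(1) by (auto simp: I_def)
qed

text \<open>If \<open>T\<close> missed \<open>A\<close>, the corners \<open>A \<inter> C\<close> and
  \<open>A \<inter> D\<close> would be bounded by proper subsets of \<open>S\<close>, too small to
  separate; with both empty, nothing would be left of \<open>A\<close>.\<close>

lemma crossing_meets:
  assumes AB: "separation V E A S B" and CD: "separation V E C T D"
    and card: "card S = CARD('n)" and ne: "S \<inter> C \<noteq> {}" "S \<inter> D \<noteq> {}"
  shows "T \<inter> A \<noteq> {}"
proof
  assume TA: "T \<inter> A = {}"
  have "S \<subseteq> V" using AB by (auto simp: separation_def)
  then have fS: "finite S" using fin finite_subset by blast
  have empty: "A \<inter> C = {}" if CD: "separation V E C T D" and SD: "S \<inter> D \<noteq> {}" for C D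
  proof (rule ccontr)
    assume "A \<inter> C \<noteq> {}"
    then have "separation V E (A \<inter> C) ((S \<inter> C) \<union> (S \<inter> T)) (B \<union> D)"
      using separation_corner[OF AB CD] TA by simp
    then have "CARD('n) \<le> card ((S \<inter> C) \<union> (S \<inter> T))"
      using EV by (intro inf_rigid_connectivity[OF fin cardV gp _ rig])
    moreover have "card ((S \<inter> C) \<union> (S \<inter> T)) < card S"
    proof (rule psubset_card_mono[OF fS])
      have "C \<inter> D = {}" "T \<inter> D = {}" using CD by (simp_all add: separation_def)
      then show "(S \<inter> C) \<union> (S \<inter> T) \<subset> S" using SD by blast
    qed
    ultimately show False using card by simp
  qed
  have "A \<inter> C = {}" "A \<inter> D = {}"
    using empty[OF CD ne(2)] empty[OF separation_swap[OF CD] ne(1)] by auto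
  moreover have "A \<noteq> {}" "A \<subseteq> V" "V = C \<union> T \<union> D" using AB CD by (auto simp: separation_def)
  ultimately show False using TA by blast
qed

text \<open>The least of the four cardinalities is moved to the position of
  \<open>S \<inter> C\<close> by swapping sides or the two separations.\<close>

lemma no_crossing:
  assumes AB: "separation V E A S B" and CD: "separation V E C T D"
    and card: "card S = CARD('n)" "card T = CARD('n)"
    and ne: "S \<inter> C \<noteq> {}" "S \<inter> D \<noteq> {}"
  shows False
proof -
  note BA = separation_swap[OF AB] and DC = separation_swap[OF CD]
  have ne': "T \<inter> A \<noteq> {}" "T \<inter> B \<noteq> {}"
    using crossing_meets[OF AB CD card(1) ne] crossing_meets[OF BA CD card(1) ne] by auto
  have "card (S \<inter> C) \<le> card (T \<inter> A) \<and> card (S \<inter> C) \<le> card (T \<inter> B) \<or>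
    card (S \<inter> D) \<le> card (T \<inter> A) \<and> card (S \<inter> D) \<le> card (T \<inter> B) \<or>
    card (T \<inter> A) \<le> card (S \<inter> C) \<and> card (T \<inter> A) \<le> card (S \<inter> D) \<or>
    card (T \<inter> B) \<le> card (S \<inter> C) \<and> card (T \<inter> B) \<le> card (S \<inter> D)"
    by linarith
  then show False
  proof (elim disjE conjE)
    assume "card (S \<inter> C) \<le> card (T \<inter> A)" "card (S \<inter> C) \<le> card (T \<inter> B)"
    then show False by (rule no_crossing_small_corner[OF AB CD card ne])
  next
    assume "card (S \<inter> D) \<le> card (T \<inter> A)" "card (S \<inter> D) \<le> card (T \<inter> B)"
    then show False by (rule no_crossing_small_corner[OF AB DC card ne(2,1)])
  next
    assume "card (T \<inter> A) \<le> card (S \<inter> C)" "card (T \<inter> A) \<le> card (S \<inter> D)"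
    then show False by (rule no_crossing_small_corner[OF CD AB card(2,1) ne'])
  next
    assume "card (T \<inter> B) \<le> card (S \<inter> C)" "card (T \<inter> B) \<le> card (S \<inter> D)"
    then show False by (rule no_crossing_small_corner[OF CD BA card(2,1) ne'(2,1)])
  qed
qed

end

section \<open>Graphs separated by cliques\<close>

text \<open>The combinatorial properties of \<open>L\<close>, detached from realizations. By
  \<open>clique\<close> no separator of d vertices is split by a separation, since a clique lies on
  one side of it.\<close>

locale clique_separated_graph =
  fixes V :: "'a set" and L :: "'a set set" and d :: nat
  assumes fin: "finite V" and cardV: "d < card V"
    and conn: "\<And>A S B. separation V L A S B \<Longrightarrow> d \<le> card S"
    and seps: "\<And>x y. x \<in> V \<Longrightarrow> y \<in> V \<Longrightarrow> x \<noteq> y \<Longrightarrow> {x, y} \<notin> L \<Longrightarrow>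
      \<exists>A S B. separation V L A S B \<and> card S = d \<and> x \<in> A \<and> y \<in> B"
    and clique: "\<And>A S B s t. separation V L A S B \<Longrightarrow> card S = d \<Longrightarrow> s \<in> S \<Longrightarrow> t \<in> S \<Longrightarrow> s \<noteq> t \<Longrightarrow>
      {s, t} \<in> L"
begin

abbreviation sep :: "'a set \<Rightarrow> 'a set \<Rightarrow> 'a set \<Rightarrow> bool" where
  "sep A S B \<equiv> separation V L A S B \<and> card S = d"

definition is_clique :: "'a set \<Rightarrow> bool" where
  "is_clique K \<longleftrightarrow> K \<subseteq> V \<and> (\<forall>s\<in>K. \<forall>t\<in>K. s \<noteq> t \<longrightarrow> {s, t} \<in> L)"

lemma clique_subset: "is_clique K \<Longrightarrow> K' \<subseteq> K \<Longrightarrow> is_clique K'"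
  unfolding is_clique_def by (meson subsetD order_trans)

lemma sepD:
  assumes "separation V L A S B"
  shows "V = A \<union> S \<union> B" "A \<inter> S = {}" "A \<inter> B = {}" "S \<inter> B = {}" "A \<subseteq> V" "S \<subseteq> V" "B \<subseteq> V"
    "\<And>a b. a \<in> A \<Longrightarrow> b \<in> B \<Longrightarrow> {a, b} \<notin> L" "finite A" "finite S" "finite B"
proof -
  show *: "V = A \<union> S \<union> B" using assms by (simp add: separation_def)
  show "A \<subseteq> V" "S \<subseteq> V" "B \<subseteq> V" using * by auto
  then show "finite A" "finite S" "finite B" using fin finite_subset by blast+
qed (use assms in \<open>simp_all add: separation_def\<close>)

lemma sep_clique: "sep A S B \<Longrightarrow> is_clique S"
  using clique sepD(6) unfolding is_clique_def by blast

lemma clique_side: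
  assumes "separation V L A S B" "is_clique K"
  shows "K \<subseteq> A \<union> S \<or> K \<subseteq> B \<union> S"
proof (rule ccontr)
  assume "\<not> ?thesis"
  then obtain b a where "b \<in> K" "b \<notin> A \<union> S" "a \<in> K" "a \<notin> B \<union> S" by blast
  moreover have "K \<subseteq> V" using assms(2) by (simp add: is_clique_def)
  ultimately have ab: "a \<in> A" "b \<in> B" "a \<in> K" "b \<in> K"
    using sepD(1)[OF assms(1)] by blast+
  then have "a \<noteq> b" using sepD(3)[OF assms(1)] by blast
  then show False using sepD(8)[OF assms(1) ab(1,2)] assms(2) ab by (auto simp: is_clique_def)
qed

text \<open>Take the side of \<open>x\<close> as small as possible. A separator \<open>S'\<close>
  between \<open>x\<close> and a nonneighbour \<open>s\<close> in \<open>S\<close> leaves the clique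
  \<open>S\<close> on the side of \<open>s\<close>; the corner at \<open>x\<close> is then bounded
  by \<open>S'\<close>, and minimality forces \<open>S' = S\<close>, although \<open>s\<close> is
  not in \<open>S'\<close>.\<close>

lemma closest_separation:
  assumes "sep A0 S0 B0" "x \<in> A0" "y \<in> B0"
  shows "\<exists>A S B. sep A S B \<and> x \<in> A \<and> y \<in> B \<and> (\<forall>s\<in>S. {x, s} \<in> L)"
proof -
  define P where "P n \<longleftrightarrow> (\<exists>A S B. sep A S B \<and> x \<in> A \<and> y \<in> B \<and> card A = n)" for n
  have "P (card A0)" using assms by (auto simp: P_def)
  then have "P (LEAST n. P n)" by (rule LeastI)
  then obtain A S B where AB: "separation V L A S B" "card S = d" and x: "x \<in> A" and y: "y \<in> B"
    and min: "card A = (LEAST n. P n)" by (auto simp: P_def)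
  have least: "card A \<le> card A'" if "sep A' S' B'" "x \<in> A'" "y \<in> B'" for A' S' B'
    unfolding min using that by (intro Least_le) (auto simp: P_def)
  note D = sepD[OF AB(1)]
  have "{x, s} \<in> L" if s: "s \<in> S" for s
  proof (rule ccontr)
    assume "{x, s} \<notin> L"
    moreover have "x \<in> V" "s \<in> V" "x \<noteq> s" using x s D by auto
    ultimately obtain A' S' B' where AB': "separation V L A' S' B'" "card S' = d" "x \<in> A'" "s \<in> B'"
      using seps by metis
    note D' = sepD[OF AB'(1)]
    have "S \<subseteq> B' \<union> S'"
      using clique_side[OF AB'(1), of S] sep_clique AB s AB'(4) D'(3,4) by blast
    then have SA: "S \<inter> A' = {}" using D'(2,3) by blast
    have AA: "A \<inter> A' \<noteq> {}" using x AB' by blast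
    note c = separation_corner[OF AB(1) AB'(1) AA]
    have "(S \<inter> A') \<union> (S \<inter> S') \<union> (S' \<inter> A) \<subseteq> S'" using SA by blast
    moreover have "d \<le> card ((S \<inter> A') \<union> (S \<inter> S') \<union> (S' \<inter> A))" using conn[OF c] .
    ultimately have eq: "(S \<inter> A') \<union> (S \<inter> S') \<union> (S' \<inter> A) = S'"
      using AB'(2) D'(10) by (simp add: card_seteq)
    then have "card A \<le> card (A \<inter> A')"
      using c AB'(2) x y AB'(3) by (intro least[of _ S' "B \<union> B'"]) auto
    then have "A \<subseteq> A'" using D(9) by (metis card_seteq inf_le1 inf.absorb_iff2 inf_commute)
    then have "S' \<subseteq> S" using eq SA D'(2) by blast
    then have "S' = S" using AB(2) AB'(2) D(10) by (simp add: card_subset_eq)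
    then show False using s AB'(4) D'(4) by blast
  qed
  then show ?thesis using AB x y by blast
qed

text \<open>A vertex \<open>a\<close> with the most neighbours in \<open>T\<close> works. For a
  nonneighbour \<open>t\<close>, a separator closest to \<open>t\<close> contains all neighbours of
  \<open>a\<close> in \<open>T\<close> and, by connectivity, a vertex \<open>a'\<close> of
  \<open>A\<close>. Adjacent to \<open>t\<close> and to the rest of that separator,
  \<open>a'\<close> has more neighbours in \<open>T\<close> than \<open>a\<close>.\<close>

lemma complete_vertex:
  assumes AB: "sep A T B"
  shows "\<exists>a\<in>A. \<forall>t\<in>T. {a, t} \<in> L"
proof -
  have AB1: "separation V L A T B" and cT: "card T = d" using AB by auto
  note D = sepD[OF AB1]
  define N where "N a = {t \<in> T. {a, t} \<in> L}" for a
  have fN: "finite (N a)" for a using D(10) by (simp add: N_def)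
  have "A \<noteq> {}" using AB1 by (simp add: separation_def)
  obtain a where a: "a \<in> A" "\<And>b. b \<in> A \<Longrightarrow> card (N b) \<le> card (N a)"
  proof -
    have "Max ((\<lambda>a. card (N a)) ` A) \<in> (\<lambda>a. card (N a)) ` A"
      using D(9) \<open>A \<noteq> {}\<close> by (intro Max_in) auto
    then obtain a where "a \<in> A" "card (N a) = Max ((\<lambda>a. card (N a)) ` A)" by force
    then show ?thesis using that D(9) by (metis Max_ge finite_imageI imageI)
  qed
  have "{a, t} \<in> L" if t: "t \<in> T" for t
  proof (rule ccontr)
    assume nt: "{a, t} \<notin> L"
    have "a \<in> V" "t \<in> V" "a \<noteq> t" using a t D(2,5,6) by blast+
    then obtain C0 S0 D0 where 0: "sep C0 S0 D0" "a \<in> C0" "t \<in> D0" using seps nt by metis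
    have "sep D0 S0 C0" using 0(1) separation_swap by blast
    from closest_separation[OF this 0(3,2)] obtain B' T' A' where BA: "sep B' T' A'"
      and ta: "t \<in> B'" "a \<in> A'" and tT: "\<And>s. s \<in> T' \<Longrightarrow> {t, s} \<in> L" by blast
    have sA: "separation V L A' T' B'" using BA separation_swap by blast
    note D' = sepD[OF sA]
    have "T \<subseteq> B' \<union> T'"
      using clique_side[OF sA, of T] sep_clique[OF AB] t ta D'(3,4) by blast
    then have TA: "T \<inter> A' = {}" using D'(2,3) by blast
    have NT: "N a \<subseteq> T \<inter> T'"
    proof
      fix s assume s: "s \<in> N a"
      then have "s \<in> T" "{a, s} \<in> L" by (auto simp: N_def)
      then show "s \<in> T \<inter> T'" using D'(8)[OF ta(2), of s] \<open>T \<subseteq> B' \<union> T'\<close> by blast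
    qed
    have AA: "A \<inter> A' \<noteq> {}" using a ta by blast
    have "T' \<inter> A \<noteq> {}"
    proof
      assume "T' \<inter> A = {}"
      then have "d \<le> card (T \<inter> T')"
        using conn[OF separation_corner[OF AB1 sA AA]] TA by simp
      moreover have "T \<inter> T' \<subset> T" using t ta D'(4) by blast
      then have "card (T \<inter> T') < card T" using D(10) by (rule psubset_card_mono[rotated])
      ultimately show False using cT by simp
    qed
    then obtain a' where a': "a' \<in> T'" "a' \<in> A" by blast
    have "insert t (T \<inter> T') \<subseteq> N a'"
    proof
      fix s assume "s \<in> insert t (T \<inter> T')"
      then consider "s = t" | "s \<in> T" "s \<in> T'" by blast
      then show "s \<in> N a'"
      proof cases
        case 1
        then show ?thesis using tT[OF a'(1)] t by (simp add: N_def insert_commute)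
      next
        case 2
        then have "a' \<noteq> s" using a' D(2) by blast
        then show ?thesis using 2 a' sep_clique[OF BA] by (auto simp: N_def is_clique_def)
      qed
    qed
    then have "insert t (N a) \<subseteq> N a'" using NT by blast
    moreover have "t \<notin> N a" using nt by (simp add: N_def)
    ultimately have "Suc (card (N a)) \<le> card (N a')" using fN
      by (metis card_insert_disjoint card_mono)
    then show False using a(2)[OF a'(2)] by simp
  qed
  then show ?thesis using a(1) by blast
qed

section \<open>Components left by a separator\<close>

definition component :: "'a set \<Rightarrow> 'a \<Rightarrow> 'a set" where
  "component S x = {y. (x, y) \<in> {(a, b). {a, b} \<in> L \<and> a \<in> V - S \<and> b \<in> V - S}\<^sup>*}"

lemma component_refl [simp]: "x \<in> component S x"
  by (simp add: component_def)

lemma component_closed: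
  assumes "y \<in> component S x" "{y, z} \<in> L" "y \<in> V - S" "z \<in> V - S"
  shows "z \<in> component S x"
  using assms unfolding component_def by (auto intro: rtrancl_into_rtrancl)

lemma component_subset_closed:
  assumes "x \<in> X" "\<And>y z. y \<in> X \<Longrightarrow> {y, z} \<in> L \<Longrightarrow> y \<in> V - S \<Longrightarrow> z \<in> V - S \<Longrightarrow> z \<in> X"
  shows "component S x \<subseteq> X"
proof
  fix y assume "y \<in> component S x"
  then have "(x, y) \<in> {(a, b). {a, b} \<in> L \<and> a \<in> V - S \<and> b \<in> V - S}\<^sup>*" by (simp add: component_def)
  then show "y \<in> X" by (induction rule: rtrancl_induct) (use assms in auto)
qed

lemma component_subset: "x \<in> V - S \<Longrightarrow> component S x \<subseteq> V - S"
  by (rule component_subset_closed) auto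

lemma component_sym: "y \<in> component S x \<Longrightarrow> x \<in> component S y"
proof -
  have "sym ({(a, b). {a, b} \<in> L \<and> a \<in> V - S \<and> b \<in> V - S}\<^sup>*)"
    by (rule sym_rtrancl) (auto simp: sym_def insert_commute)
  then show "y \<in> component S x \<Longrightarrow> x \<in> component S y" by (auto simp: component_def sym_def)
qed

lemma component_eq: "y \<in> component S x \<Longrightarrow> component S y = component S x"
  using component_sym unfolding component_def by (auto intro: rtrancl_trans)

lemma component_separation:
  assumes "S \<subseteq> V" "x \<in> V - S" "y \<in> V - S" "y \<notin> component S x"
  shows "separation V L (component S x) S (V - S - component S x)"
proof -
  have C: "component S x \<subseteq> V - S" using component_subset[OF assms(2)] .
  have "{a, b} \<notin> L" if "a \<in> component S x" "b \<in> V - S - component S x" for a b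
    using component_closed[of a S x b] that C by blast
  moreover have "x \<in> component S x" by simp
  ultimately show ?thesis using assms C unfolding separation_def by blast
qed

lemma component_subset_side:
  assumes "separation V L A S B" "x \<in> A"
  shows "component S x \<subseteq> A"
proof (rule component_subset_closed)
  fix y z assume "y \<in> A" "{y, z} \<in> L" "z \<in> V - S"
  then show "z \<in> A" using sepD(1)[OF assms(1)] sepD(8)[OF assms(1), of y z] by blast
qed fact

text \<open>Any separator of \<open>a\<close> and \<open>b\<close> contains their common neighbours;
  one with only d vertices is therefore \<open>S\<close>.\<close>

lemma common_neighbours_separate:
  assumes "a \<in> V" "b \<in> V" "a \<noteq> b" "{a, b} \<notin> L" "S \<subseteq> V" "card S = d"
    and "\<And>s. s \<in> S \<Longrightarrow> {a, s} \<in> L" "\<And>s. s \<in> S \<Longrightarrow> {b, s} \<in> L"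
  shows "\<exists>A B. sep A S B \<and> a \<in> A \<and> b \<in> B"
proof -
  obtain A T B where AB: "separation V L A T B" "card T = d" "a \<in> A" "b \<in> B"
    using seps[OF assms(1-4)] by blast
  note D = sepD[OF AB(1)]
  have "S \<subseteq> T"
  proof
    fix s assume s: "s \<in> S"
    have "s \<notin> B" using D(8)[OF AB(3)] assms(7)[OF s] by blast
    moreover have "s \<notin> A" using D(8)[OF _ AB(4), of s] assms(8)[OF s] by (auto simp: insert_commute)
    ultimately show "s \<in> T" using s assms(5) D(1) by blast
  qed
  then have "S = T" using AB(2) assms(6) D(10) by (simp add: card_subset_eq)
  then show ?thesis using AB by blast
qed

lemma same_component_adjacent:
  assumes "S \<subseteq> V" "card S = d" "a \<in> V" "c \<in> V" "a \<noteq> c" "c \<in> component S a"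
    and "\<And>s. s \<in> S \<Longrightarrow> {a, s} \<in> L" "\<And>s. s \<in> S \<Longrightarrow> {c, s} \<in> L"
  shows "{a, c} \<in> L"
proof (rule ccontr)
  assume "{a, c} \<notin> L"
  then obtain A B where AB: "sep A S B" "a \<in> A" "c \<in> B"
    using common_neighbours_separate[of a c S] assms by blast
  then have "component S a \<subseteq> A" using component_subset_side by blast
  then show False using AB assms(6) sepD(3)[of A S B] by blast
qed

section \<open>Chambers and their adjacency\<close>

definition chamber :: "'a set \<Rightarrow> bool" where
  "chamber \<Delta> \<longleftrightarrow> is_clique \<Delta> \<and> card \<Delta> = d + 1"

definition adjacent_chambers :: "('a set \<times> 'a set) set" where
  "adjacent_chambers = {(\<Delta>, \<Delta>'). chamber \<Delta> \<and> chamber \<Delta>' \<and> card (\<Delta> \<inter> \<Delta>') = d}"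

lemma chamber_finite: "chamber \<Delta> \<Longrightarrow> finite \<Delta>"
  using fin finite_subset by (auto simp: chamber_def is_clique_def)

lemma chamber_insert:
  assumes "sep A S B" "a \<in> V" "a \<notin> S" "\<And>s. s \<in> S \<Longrightarrow> {a, s} \<in> L"
  shows "chamber (insert a S)"
proof -
  have S: "separation V L A S B" "card S = d" using assms(1) by auto
  show ?thesis
    using sep_clique[OF assms(1)] assms(2-4) S(2) sepD(6,10)[OF S(1)]
    by (auto simp: chamber_def is_clique_def insert_commute)
qed

text \<open>Vertices are exchanged one at a time; all intermediate sets stay inside the big
  clique.\<close>

lemma chambers_in_clique_connected:
  assumes "chamber \<Delta>" "chamber \<Delta>'" "is_clique (\<Delta> \<union> \<Delta>')"
  shows "(\<Delta>, \<Delta>') \<in> adjacent_chambers\<^sup>*"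
  using assms
proof (induction "card (\<Delta> - \<Delta>')" arbitrary: \<Delta>)
  case 0
  then have "\<Delta> \<subseteq> \<Delta>'" using chamber_finite by fastforce
  then have "\<Delta> = \<Delta>'" using 0 chamber_finite[of \<Delta>'] by (simp add: chamber_def card_subset_eq)
  then show ?case by simp
next
  case (Suc k)
  have f: "finite \<Delta>" "finite \<Delta>'" using Suc chamber_finite by auto
  obtain \<delta> where \<delta>: "\<delta> \<in> \<Delta>" "\<delta> \<notin> \<Delta>'" using Suc.hyps(2)
    by (metis DiffE card.empty equals0I nat.distinct(1))
  have "\<not> \<Delta>' \<subseteq> \<Delta>" using Suc.prems \<delta> f by (metis card_subset_eq chamber_def)
  then obtain \<delta>' where \<delta>': "\<delta>' \<in> \<Delta>'" "\<delta>' \<notin> \<Delta>" by blast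
  define \<Delta>1 where "\<Delta>1 = insert \<delta>' (\<Delta> - {\<delta>})"
  have c1: "chamber \<Delta>1" using Suc.prems \<delta> \<delta>' f
    by (auto simp: chamber_def is_clique_def \<Delta>1_def card_Diff_singleton)
  have "\<Delta> \<inter> \<Delta>1 = \<Delta> - {\<delta>}" using \<delta>' by (auto simp: \<Delta>1_def)
  then have "card (\<Delta> \<inter> \<Delta>1) = d" using Suc.prems(1) \<delta> f by (simp add: chamber_def)
  then have step: "(\<Delta>, \<Delta>1) \<in> adjacent_chambers"
    using Suc.prems c1 by (simp add: adjacent_chambers_def)
  have "\<Delta>1 - \<Delta>' = (\<Delta> - \<Delta>') - {\<delta>}" using \<delta>' by (auto simp: \<Delta>1_def)
  then have k: "k = card (\<Delta>1 - \<Delta>')" using Suc.hyps(2) \<delta> f by simp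
  have "\<Delta>1 \<union> \<Delta>' \<subseteq> \<Delta> \<union> \<Delta>'" using \<delta>' by (auto simp: \<Delta>1_def)
  then have "is_clique (\<Delta>1 \<union> \<Delta>')" by (rule clique_subset[OF Suc.prems(3)])
  then have "(\<Delta>1, \<Delta>') \<in> adjacent_chambers\<^sup>*" by (rule Suc.hyps(1)[OF k c1 Suc.prems(2)])
  with step show ?case by (rule converse_rtrancl_into_rtrancl)
qed

text \<open>Two chambers that do not span a clique are separated by some \<open>T\<close>, which may be taken complete to a vertex \<open>\<delta>\<close>
  of the first one. Passing to \<open>T + \<delta>\<close> enlarges the intersection with the first chamber; passing from there to \<open>T + b\<close>,
  with \<open>b\<close> on the other side of \<open>T\<close>, shrinks the component that contains the rest of the second one.\<close>

lemma chambers_connected_step: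
  assumes IH: "\<And>\<Delta> \<Delta>'. chamber \<Delta> \<Longrightarrow> chamber \<Delta>' \<Longrightarrow> i < card (\<Delta> \<inter> \<Delta>') \<Longrightarrow> (\<Delta>, \<Delta>') \<in> adjacent_chambers\<^sup>*"
  assumes "chamber \<Delta>" "chamber \<Delta>'" "i \<le> card (\<Delta> \<inter> \<Delta>')"
    and "\<And>A T y. sep A T (component T y) \<Longrightarrow> y \<in> \<Delta>' - T \<Longrightarrow> \<Delta> \<subseteq> A \<union> T \<Longrightarrow> \<Delta>' \<subseteq> component T y \<union> T
           \<Longrightarrow> card (component T y) < N"
  shows "(\<Delta>, \<Delta>') \<in> adjacent_chambers\<^sup>*"
  using assms(2-)
proof (induction N arbitrary: \<Delta> rule: less_induct)
  case (less N)
  show ?case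
  proof (cases "is_clique (\<Delta> \<union> \<Delta>')")
    case True
    then show ?thesis using chambers_in_clique_connected less.prems by blast
  next
    case False
    have cl: "is_clique \<Delta>" "is_clique \<Delta>'" using less.prems by (simp_all add: chamber_def)
    obtain \<delta> \<delta>' where \<delta>: "\<delta> \<in> \<Delta>" "\<delta>' \<in> \<Delta>'" "\<delta> \<noteq> \<delta>'" "{\<delta>, \<delta>'} \<notin> L"
      using False cl unfolding is_clique_def by (auto simp: insert_commute)
    have \<delta>V: "\<delta> \<in> V" "\<delta>' \<in> V" using \<delta> cl by (auto simp: is_clique_def)
    obtain A0 S0 B0 where 0: "sep A0 S0 B0" "\<delta> \<in> A0" "\<delta>' \<in> B0"
      using seps[OF \<delta>V \<delta>(3,4)] by blast
    from closest_separation[OF this] obtain A T B where AB: "separation V L A T B" "card T = d"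
      and \<delta>A: "\<delta> \<in> A" "\<delta>' \<in> B" and \<delta>T: "\<And>s. s \<in> T \<Longrightarrow> {\<delta>, s} \<in> L" by blast
    note D = sepD[OF AB(1)]
    \<comment> \<open>\<open>B\<close> is shrunk to a component because the induction measures
      components; \<open>T\<close> still separates it from the rest.\<close>
    define B' where "B' = component T \<delta>'"
    have B'B: "B' \<subseteq> B"
      unfolding B'_def using component_subset_side[OF separation_swap[OF AB(1)] \<delta>A(2)] .
    have \<delta>T': "\<delta> \<in> V - T" "\<delta>' \<in> V - T" using \<delta>V \<delta>A D(2,4) by blast+
    have "\<delta> \<notin> B'" using B'B \<delta>A D(3) by blast
    then have "separation V L B' T (V - T - B')"
      unfolding B'_def using component_separation[OF D(6) \<delta>T'(2,1)] by blast
    then have sB: "sep B' T (V - T - B')" "sep (V - T - B') T B'"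
      using AB(2) separation_swap by blast+
    note D' = sepD[OF conjunct1[OF sB(2)]]
    have \<Delta>A: "\<Delta> \<subseteq> (V - T - B') \<union> T"
      using clique_side[OF conjunct1[OF sB(2)] cl(1)] \<delta>(1) \<delta>T'(1) \<open>\<delta> \<notin> B'\<close> by blast
    have "\<delta>' \<in> B'" by (simp add: B'_def)
    then have \<Delta>B: "\<Delta>' \<subseteq> B' \<union> T"
      using clique_side[OF conjunct1[OF sB(2)] cl(2)] \<delta>(2) \<delta>T'(2) by blast
    have lessN: "card B' < N"
      unfolding B'_def
      by (rule less.prems(4)[of "V - T - B'" T \<delta>'])
         (use sB \<delta> \<delta>T' \<Delta>A \<Delta>B in \<open>simp_all add: B'_def\<close>)
    have int: "\<Delta> \<inter> \<Delta>' \<subseteq> T" using \<Delta>A \<Delta>B by blast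
    have f: "finite \<Delta>" "finite \<Delta>'" "finite T" using less.prems chamber_finite D(10) by blast+
    have c1: "chamber (insert \<delta> T)"
      by (rule chamber_insert[OF sB(1)]) (use \<delta>T' \<delta>T in auto)
    obtain b where b: "b \<in> B'" "\<And>t. t \<in> T \<Longrightarrow> {b, t} \<in> L" using complete_vertex[OF sB(1)] by blast
    have bT: "b \<in> V - T" using b(1) B'B D(4,7) by blast
    have c2: "chamber (insert b T)"
      by (rule chamber_insert[OF sB(1)]) (use b bT in auto)
    have "\<delta> \<notin> \<Delta>'" using \<Delta>B \<open>\<delta> \<notin> B'\<close> \<delta>T' by blast
    then have "Suc (card (\<Delta> \<inter> \<Delta>')) = card (insert \<delta> (\<Delta> \<inter> \<Delta>'))" using f by simp
    also have "\<dots> \<le> card (\<Delta> \<inter> insert \<delta> T)"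
      using f \<delta>(1) int by (intro card_mono) auto
    finally have "i < card (\<Delta> \<inter> insert \<delta> T)" using less.prems(3) by simp
    then have 1: "(\<Delta>, insert \<delta> T) \<in> adjacent_chambers\<^sup>*" by (rule IH[OF less.prems(1) c1])
    have "insert \<delta> T \<inter> insert b T = T" using b(1) \<open>\<delta> \<notin> B'\<close> bT \<delta>T' by blast
    then have 2: "(insert \<delta> T, insert b T) \<in> adjacent_chambers"
      using c1 c2 AB(2) by (simp add: adjacent_chambers_def)
    have "i \<le> card (insert b T \<inter> \<Delta>')"
    proof -
      have "card (\<Delta> \<inter> \<Delta>') \<le> card (insert b T \<inter> \<Delta>')" using f int by (intro card_mono) auto
      then show ?thesis using less.prems(3) by simp
    qed
    then have 3: "(insert b T, \<Delta>') \<in> adjacent_chambers\<^sup>*"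
    proof (rule less.IH[OF lessN c2 less.prems(2)])
      fix A2 T2 y
      assume s2: "sep A2 T2 (component T2 y)" and y: "y \<in> \<Delta>' - T2" and \<Delta>2: "insert b T \<subseteq> A2 \<union> T2"
        and \<Delta>'2: "\<Delta>' \<subseteq> component T2 y \<union> T2"
      have s2': "separation V L A2 T2 (component T2 y)" using s2 by blast
      note D2 = sepD[OF s2']
      have dis: "insert b T \<inter> component T2 y = {}" using \<Delta>2 D2(3,4) by blast
      have "y \<notin> T" using dis by auto
      then have "y \<in> B'" using y \<Delta>B by blast
      then have yB: "component T y = B'" unfolding B'_def by (rule component_eq)
      \<comment> \<open>The component avoids \<open>T\<close>, which lies in \<open>A2\<close> or
        \<open>T2\<close>, so it stays within \<open>B'\<close>; as it also misses \<open>b\<close>,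
        it is strictly smaller.\<close>
      have sub: "component T2 y \<subseteq> component T y \<inter> component T2 y"
      proof (rule component_subset_closed)
        fix z w assume z: "z \<in> component T y \<inter> component T2 y" "{z, w} \<in> L" "z \<in> V - T2"
            "w \<in> V - T2"
        then have w: "w \<in> component T2 y" using component_closed by blast
        then have "z \<in> V - T" "w \<in> V - T" using z dis by blast+
        then show "w \<in> component T y \<inter> component T2 y" using z w component_closed by blast
      qed simp
      then have "component T2 y \<subset> B'" using yB dis b(1) by blast
      moreover have "finite B'" using sepD(9)[OF conjunct1[OF sB(1)]] .
      ultimately show "card (component T2 y) < card B'" by (rule psubset_card_mono[rotated])
    qed
    show ?thesis using 1 2 3 by (meson rtrancl.rtrancl_into_rtrancl rtrancl_trans)
  qed
qed

text \<open>In the outer induction pairs with a larger intersection come first;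
  \<open>Suc (card V)\<close> is a trivial bound that starts the inner one.\<close>

lemma chambers_connected:
  assumes "chamber \<Delta>" "chamber \<Delta>'"
  shows "(\<Delta>, \<Delta>') \<in> adjacent_chambers\<^sup>*"
  using assms
proof (induction "d + 1 - card (\<Delta> \<inter> \<Delta>')" arbitrary: \<Delta> \<Delta>' rule: less_induct)
  case less
  show ?case
  proof (rule chambers_connected_step[OF _ less.prems order_refl])
    fix \<Gamma> \<Gamma>' assume c: "chamber \<Gamma>" "chamber \<Gamma>'" and i: "card (\<Delta> \<inter> \<Delta>') < card (\<Gamma> \<inter> \<Gamma>')"
    have "card (\<Gamma> \<inter> \<Gamma>') \<le> d + 1"
      using c chamber_finite[OF c(1)] by (metis card_mono chamber_def inf_le1)
    then show "(\<Gamma>, \<Gamma>') \<in> adjacent_chambers\<^sup>*" using i c by (intro less.hyps) auto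
  next
    fix A T y assume "sep A T (component T y)"
    then have "component T y \<subseteq> V" using sepD(7) by blast
    then show "card (component T y) < Suc (card V)" using fin
      by (simp add: card_mono less_Suc_eq_le)
  qed
qed

text \<open>A vertex with a nonneighbour is completed by its closest separator. A vertex adjacent to
  all others extends a separator of d vertices or lies in one; if there is none, \<open>V\<close>
  itself is a clique.\<close>

lemma vertex_in_chamber:
  assumes "x \<in> V"
  shows "\<exists>\<Delta>. chamber \<Delta> \<and> x \<in> \<Delta>"
proof (cases "\<exists>y\<in>V. x \<noteq> y \<and> {x, y} \<notin> L")
  case True
  then obtain y A0 S0 B0 where "sep A0 S0 B0" "x \<in> A0" "y \<in> B0" using seps assms by metis
  from closest_separation[OF this] obtain A S B where
    S: "sep A S B" "x \<in> A" "\<And>s. s \<in> S \<Longrightarrow> {x, s} \<in> L" by blast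
  have "x \<notin> S" using S(2) sepD(2)[OF conjunct1[OF S(1)]] by blast
  then have "chamber (insert x S)" using S assms by (intro chamber_insert[OF S(1)]) auto
  then show ?thesis by blast
next
  case False
  then have x: "{x, y} \<in> L" if "y \<in> V" "y \<noteq> x" for y using that by metis
  show ?thesis
  proof (cases "is_clique V")
    case True
    have "card {x} \<le> d + 1" "{x} \<subseteq> V" "d + 1 \<le> card V" using assms cardV by auto
    then obtain K where K: "{x} \<subseteq> K" "K \<subseteq> V" "card K = d + 1"
      using exists_subset_between[of "{x}" "d + 1" V] fin by auto
    then have "chamber K" using clique_subset[OF True] by (simp add: chamber_def)
    then show ?thesis using K by blast
  next
    case False
    then obtain a b where ab: "a \<in> V" "b \<in> V" "a \<noteq> b" "{a, b} \<notin> L" unfolding is_clique_def by blast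
    obtain A0 S0 B0 where "sep A0 S0 B0" "a \<in> A0" "b \<in> B0" using seps[OF ab] by blast
    from closest_separation[OF this] obtain A S B where
      S: "sep A S B" "a \<in> A" "\<And>s. s \<in> S \<Longrightarrow> {a, s} \<in> L" by blast
    note D = sepD[OF conjunct1[OF S(1)]]
    show ?thesis
    proof (cases "x \<in> S")
      case True
      have "chamber (insert a S)" using S D(2) ab(1) by (intro chamber_insert[OF S(1)]) auto
      then show ?thesis using True by blast
    next
      case False
      have "{x, s} \<in> L" if "s \<in> S" for s using x[of s] that D(6) False by blast
      then have "chamber (insert x S)" using False assms by (intro chamber_insert[OF S(1)]) auto
      then show ?thesis by blast
    qed
  qed
qed

section \<open>Galleries and geodesics\<close>

definition gallery :: "'a \<Rightarrow> 'a \<Rightarrow> nat \<Rightarrow> (nat \<Rightarrow> 'a set) \<Rightarrow> bool" where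
  "gallery x y n f \<longleftrightarrow> x \<in> f 0 \<and> y \<in> f n \<and> (\<forall>i\<le>n. chamber (f i)) \<and>
     (\<forall>i<n. card (f i \<inter> f (Suc i)) = d)"

text \<open>The end chambers are not fixed: minimising over all chambers at \<open>x\<close> and
  \<open>y\<close> keeps both vertices off every wall, as the reflection argument requires.\<close>

definition geodesic :: "'a \<Rightarrow> 'a \<Rightarrow> nat \<Rightarrow> (nat \<Rightarrow> 'a set) \<Rightarrow> bool" where
  "geodesic x y n f \<longleftrightarrow> gallery x y n f \<and> (\<forall>m g. gallery x y m g \<longrightarrow> n \<le> m)"

lemma geodesic_exists:
  assumes "x \<in> V" "y \<in> V"
  shows "\<exists>n f. geodesic x y n f"
proof -
  obtain \<Delta> \<Delta>' where \<Delta>: "chamber \<Delta>" "x \<in> \<Delta>" "chamber \<Delta>'" "y \<in> \<Delta>'"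
    using vertex_in_chamber assms by metis
  then have "(\<Delta>, \<Delta>') \<in> adjacent_chambers\<^sup>*" using chambers_connected by blast
  then obtain n where "(\<Delta>, \<Delta>') \<in> adjacent_chambers ^^ n" using rtrancl_imp_relpow by blast
  then obtain f where f: "f 0 = \<Delta>" "f n = \<Delta>'" "\<forall>i<n. (f i, f (Suc i)) \<in> adjacent_chambers"
    unfolding relpow_fun_conv by blast
  have "chamber (f i)" if "i \<le> n" for i
    using f \<Delta> that by (cases "i = n") (auto simp: adjacent_chambers_def)
  then have "gallery x y n f" using f \<Delta> by (auto simp: gallery_def adjacent_chambers_def)
  then have ex: "\<exists>n. \<exists>f. gallery x y n f" by blast
  define m where "m = (LEAST n. \<exists>f. gallery x y n f)"
  have "\<exists>f. gallery x y m f" unfolding m_def using ex by (rule LeastI_ex)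
  moreover have "m \<le> k" if "gallery x y k g" for k g
    unfolding m_def using that by (intro Least_le) blast
  ultimately show ?thesis by (auto simp: geodesic_def)
qed

text \<open>Two chambers that share d vertices are equal or adjacent, so the chambers between them
  can be left out. The bound is that of the adjacent case.\<close>

lemma gallery_shortcut:
  assumes "gallery x y n f" "i < j" "j \<le> n" "S \<subseteq> f i" "S \<subseteq> f j" "card S = d"
  shows "\<exists>m g. gallery x y m g \<and> m \<le> n + 1 - (j - i)"
proof -
  have ch: "chamber (f k)" if "k \<le> n" for k using assms(1) that by (simp add: gallery_def)
  have ij: "chamber (f i)" "chamber (f j)" using ch assms by auto
  note fi = chamber_finite[OF ij(1)] and fj = chamber_finite[OF ij(2)]
  show ?thesis
  proof (cases "f i = f j")
    case True
    define g where "g k = (if k \<le> i then f k else f (k + (j - i)))" for k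
    have gj: "g k = f (k + (j - i))" if "i \<le> k" for k
      using that True assms(2) by (cases "k = i") (auto simp: g_def)
    have "gallery x y (n - (j - i)) g"
      unfolding gallery_def
    proof (intro conjI allI impI)
      show "x \<in> g 0" using assms(1) by (simp add: g_def gallery_def)
      show "y \<in> g (n - (j - i))" using assms by (subst gj) (auto simp: gallery_def)
      show "chamber (g k)" if "k \<le> n - (j - i)" for k
        using that ch assms(2,3) by (auto simp: g_def)
      show "card (g k \<inter> g (Suc k)) = d" if k: "k < n - (j - i)" for k
      proof (cases "k < i")
        case True
        then show ?thesis using assms by (simp add: g_def gallery_def)
      next
        case False
        then have "g k = f (k + (j - i))" "g (Suc k) = f (Suc (k + (j - i)))"
          using gj[of k] gj[of "Suc k"] by auto
        then show ?thesis using assms k by (simp add: gallery_def)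
      qed
    qed
    then show ?thesis by (intro exI[of _ "n - (j - i)"] exI[of _ g]) auto
  next
    case False
    have S: "S \<subseteq> f i \<inter> f j" using assms by blast
    have "card (f i \<inter> f j) < d + 1"
    proof -
      have "f i \<inter> f j \<noteq> f i"
        using False ij fj by (metis card_subset_eq chamber_def inf.absorb_iff1)
      then have "f i \<inter> f j \<subset> f i" by blast
      then show ?thesis using psubset_card_mono[OF fi] ij(1) by (metis chamber_def)
    qed
    moreover have "d \<le> card (f i \<inter> f j)" using S fi assms(6) by (metis card_mono finite_Int)
    ultimately have cij: "card (f i \<inter> f j) = d" by simp
    define s where "s = j - i - 1"
    define g where "g k = (if k \<le> i then f k else f (k + s))" for k
    have js: "j = Suc i + s" using assms(2) by (simp add: s_def)
    have "gallery x y (n - s) g"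
      unfolding gallery_def
    proof (intro conjI allI impI)
      show "x \<in> g 0" using assms(1) by (simp add: g_def gallery_def)
      have "n - s > i" "n - s + s = n" using assms(3) js by auto
      then show "y \<in> g (n - s)" using assms(1) by (simp add: g_def gallery_def)
      show "chamber (g k)" if "k \<le> n - s" for k
        using that ch assms(3) js by (auto simp: g_def)
      show "card (g k \<inter> g (Suc k)) = d" if k: "k < n - s" for k
      proof (cases k i rule: linorder_cases)
        case less
        then show ?thesis using assms by (simp add: g_def gallery_def)
      next
        case equal
        then show ?thesis using cij by (simp add: g_def js)
      next
        case greater
        then show ?thesis using assms(1) k by (simp add: g_def gallery_def)
      qed
    qed
    moreover have "n - s \<le> n + 1 - (j - i)" by (simp add: s_def)
    ultimately show ?thesis by blast
  qed
qed

lemma geodesic_shortcut: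
  assumes "geodesic x y n f" "i < j" "j \<le> n" "S \<subseteq> f i" "S \<subseteq> f j" "card S = d"
  shows "j = Suc i"
proof -
  obtain m g where "gallery x y m g" "m \<le> n + 1 - (j - i)"
    using gallery_shortcut[OF _ assms(2-), of x y] assms(1) unfolding geodesic_def by blast
  then have "n \<le> n + 1 - (j - i)" using assms(1) by (auto simp: geodesic_def)
  then show ?thesis using assms(2,3) by linarith
qed

lemma geodesic_start:
  assumes "geodesic x y n f" "0 < i" "i \<le> n"
  shows "x \<notin> f i"
proof
  assume "x \<in> f i"
  then have "gallery x y (n - i) (\<lambda>k. f (k + i))"
    using assms by (auto simp: geodesic_def gallery_def)
  then have "n \<le> n - i" using assms(1) by (auto simp: geodesic_def)
  then show False using assms(2,3) by linarith
qed

lemma geodesic_end: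
  assumes "geodesic x y n f" "i < n"
  shows "y \<notin> f i"
proof
  assume "y \<in> f i"
  then have "gallery x y i f" using assms by (auto simp: geodesic_def gallery_def)
  then have "n \<le> i" using assms(1) by (auto simp: geodesic_def)
  then show False using assms(2) by linarith
qed

lemma geodesic_chamber: "geodesic x y n f \<Longrightarrow> i \<le> n \<Longrightarrow> chamber (f i)"
  by (simp add: geodesic_def gallery_def)

lemma geodesic_wall:
  assumes "geodesic x y n f" "i < n"
  obtains S a b where "f i = insert a S" "f (Suc i) = insert b S" "a \<notin> S" "b \<notin> S" "a \<noteq> b"
    "card S = d" "S \<subseteq> V" "a \<in> V" "b \<in> V" "is_clique S"
    "\<And>s. s \<in> S \<Longrightarrow> {a, s} \<in> L" "\<And>s. s \<in> S \<Longrightarrow> {b, s} \<in> L"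
proof -
  define S where "S = f i \<inter> f (Suc i)"
  have ch: "chamber (f i)" "chamber (f (Suc i))" using geodesic_chamber[OF assms(1)] assms(2)
    by auto
  have card: "card S = d" using assms by (simp add: S_def geodesic_def gallery_def)
  have "\<exists>a. a \<notin> S \<and> \<Delta> = insert a S" if "chamber \<Delta>" "S \<subseteq> \<Delta>" for \<Delta>
  proof -
    have "finite S" using that chamber_finite finite_subset by blast
    then have "card (\<Delta> - S) = 1" using that card by (simp add: card_Diff_subset chamber_def)
    then obtain a where "\<Delta> - S = {a}" by (rule card_1_singletonE)
    then show ?thesis using that(2) by blast
  qed
  then obtain a b where ab: "a \<notin> S" "f i = insert a S" "b \<notin> S" "f (Suc i) = insert b S"
    using ch by (metis S_def inf_le1 inf_le2)
  have "a \<noteq> b"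
  proof
    assume "a = b"
    then have "a \<in> f i" "a \<in> f (Suc i)" using ab(2,4) by (metis insertI1)+
    then have "a \<in> S" unfolding S_def by (rule IntI)
    then show False using ab(1) by simp
  qed
  moreover have cl: "is_clique (insert a S)" "is_clique (insert b S)" using ch ab
    by (simp_all add: chamber_def)
  moreover have "is_clique S" using cl(1) clique_subset by blast
  moreover have "S \<subseteq> V" "a \<in> V" "b \<in> V" using cl by (simp_all add: is_clique_def)
  moreover have "{a, s} \<in> L" "{b, s} \<in> L" if "s \<in> S" for s
    using cl ab that unfolding is_clique_def by (metis insertI1 insertI2)+
  ultimately show ?thesis using that ab card by blast
qed

lemma chamber_in_component:
  assumes "chamber \<Delta>" "e \<in> \<Delta>" "e \<notin> S"
  shows "\<Delta> \<subseteq> component S e \<union> S"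
proof
  fix z assume z: "z \<in> \<Delta>"
  have cl: "is_clique \<Delta>" using assms(1) by (simp add: chamber_def)
  show "z \<in> component S e \<union> S"
  proof (cases "z \<in> S \<or> z = e")
    case False
    have "{e, z} \<in> L" "e \<in> V - S" "z \<in> V - S"
      using cl z assms(2,3) False unfolding is_clique_def by auto
    then show ?thesis using component_closed[of e S e z] by simp
  qed auto
qed

text \<open>Consecutive chambers share a vertex outside \<open>S\<close>, which keeps them in the
  same component, unless their wall is \<open>S\<close>. By \<open>geodesic_shortcut\<close> the
  wall \<open>S\<close> occurs only at step \<open>i\<close>.\<close>

lemma geodesic_crossing_unique:
  assumes geo: "geodesic x y n f" and i: "i < n" "S \<subseteq> f i" "S \<subseteq> f (Suc i)" "card S = d"
    and a: "f i \<subseteq> component S a \<union> S" and b: "f (Suc i) \<subseteq> component S b \<union> S"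
    and dis: "a \<in> V - S" "b \<in> V - S"
  shows "j \<le> i \<Longrightarrow> f j \<subseteq> component S a \<union> S"
    and "Suc i \<le> j \<Longrightarrow> j \<le> n \<Longrightarrow> f j \<subseteq> component S b \<union> S"
proof -
  have ch: "chamber (f k)" if "k \<le> n" for k using geodesic_chamber[OF geo that] .
  have common: "f k \<subseteq> component S c \<union> S"
    if k: "k \<le> n" and k': "f k' \<subseteq> component S c \<union> S" and e: "e \<in> f k" "e \<in> f k'" "e \<notin> S"
        for k k' e c
  proof -
    have "e \<in> component S c" using k' e by blast
    then show ?thesis using chamber_in_component[OF ch[OF k] e(1,3)] component_eq by blast
  qed
  have eqS: "S \<subseteq> f k \<and> S \<subseteq> f (Suc k)" if k: "k < n" "f k \<inter> f (Suc k) \<subseteq> S" for k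
  proof -
    have "card (f k \<inter> f (Suc k)) = d" using geo k by (simp add: geodesic_def gallery_def)
    moreover have "finite S" using i(2) chamber_finite[OF ch[of i]] i(1) finite_subset by auto
    ultimately have "f k \<inter> f (Suc k) = S" using k(2) i(4) by (simp add: card_subset_eq)
    then show ?thesis by blast
  qed
  have down: "f (i - k) \<subseteq> component S a \<union> S" for k
  proof (induction k)
    case (Suc k)
    show ?case
    proof (cases "k < i")
      case True
      then have e: "i - k = Suc (i - Suc k)" by simp
      show ?thesis
      proof (cases "f (i - Suc k) \<inter> f (i - k) \<subseteq> S")
        case True
        then have "S \<subseteq> f (i - Suc k)" using eqS[of "i - Suc k"] e i(1) by auto
        then have "Suc i = Suc (i - Suc k)"
          using geodesic_shortcut[OF geo, of "i - Suc k" "Suc i" S] i \<open>k < i\<close> by auto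
        then show ?thesis using \<open>k < i\<close> by simp
      next
        case False
        then obtain e where "e \<in> f (i - Suc k)" "e \<in> f (i - k)" "e \<notin> S" by blast
        then show ?thesis using common[OF _ Suc.IH] i(1) by auto
      qed
    next
      case False
      then show ?thesis using Suc.IH by simp
    qed
  qed (use a in simp)
  have up: "f (Suc i + k) \<subseteq> component S b \<union> S" if "Suc i + k \<le> n" for k
    using that
  proof (induction k)
    case (Suc k)
    show ?case
    proof (cases "f (Suc i + k) \<inter> f (Suc i + Suc k) \<subseteq> S")
      case True
      then have "S \<subseteq> f (Suc i + Suc k)" using eqS[of "Suc i + k"] Suc.prems by auto
      then have "Suc i + Suc k = Suc i"
        using geodesic_shortcut[OF geo, of i "Suc i + Suc k" S] i Suc.prems by auto
      then show ?thesis by simp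
    next
      case False
      then obtain e where "e \<in> f (Suc i + k)" "e \<in> f (Suc i + Suc k)" "e \<notin> S" by blast
      then show ?thesis using common[OF Suc.prems, of "Suc i + k"] Suc by auto
    qed
  qed (use b in simp)
  show "f j \<subseteq> component S a \<union> S" if "j \<le> i" using down[of "i - j"] that by simp
  show "f j \<subseteq> component S b \<union> S" if "Suc i \<le> j" "j \<le> n" using up[of "j - Suc i"] that by simp
qed

text \<open>The tips \<open>a\<close> and \<open>b\<close> are complete to \<open>S\<close> and not
  adjacent, so \<open>S\<close> itself separates them and the geodesic changes sides for
  good.\<close>

lemma geodesic_bend:
  assumes geo: "geodesic x y n f" and i: "i < n" and f: "f i = insert a S" "f (Suc i) = insert b S"
    and ab: "a \<in> V" "b \<in> V" "a \<noteq> b" "{a, b} \<notin> L" "a \<notin> S" "b \<notin> S" and S: "S \<subseteq> V" "card S = d"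
      "\<And>s. s \<in> S \<Longrightarrow> {a, s} \<in> L" "\<And>s. s \<in> S \<Longrightarrow> {b, s} \<in> L"
  shows "component S a \<inter> component S b = {}"
    and "j \<le> i \<Longrightarrow> f j \<subseteq> component S a \<union> S"
    and "Suc i \<le> j \<Longrightarrow> j \<le> n \<Longrightarrow> f j \<subseteq> component S b \<union> S"
proof -
  obtain A B where AB: "separation V L A S B" "a \<in> A" "b \<in> B"
    using common_neighbours_separate[OF ab(1-4) S] by blast
  have "component S a \<subseteq> A" "component S b \<subseteq> B"
    using component_subset_side[OF AB(1,2)] component_subset_side[OF separation_swap[OF AB(1)] AB(3)] .
  then show "component S a \<inter> component S b = {}" using sepD(3)[OF AB(1)] by blast
  show "j \<le> i \<Longrightarrow> f j \<subseteq> component S a \<union> S"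
    "Suc i \<le> j \<Longrightarrow> j \<le> n \<Longrightarrow> f j \<subseteq> component S b \<union> S"
    using geodesic_crossing_unique[OF geo i, of S a b j] f ab S by auto
qed

text \<open>An earlier wall inside \<open>S\<close> would permit a shortcut, so it has a vertex off
  \<open>S\<close>, on the first side; later chambers lie on the other side or in \<open>S\<close>.
  This yields the vertex that occurs in only one reflection.\<close>

lemma geodesic_wall_pivot:
  assumes geo: "geodesic x y n f" and ij: "i < j" "j < n"
    and ab: "a \<in> f j - f (Suc j)" "b \<in> f (Suc j) - f j" "{a, b} \<notin> L"
  shows "\<exists>w\<in>f i \<inter> f (Suc i). \<forall>k. j \<le> k \<longrightarrow> k < n \<longrightarrow> w \<notin> f k \<inter> f (Suc k)"
proof -
  obtain S a' b' where w: "f j = insert a' S" "f (Suc j) = insert b' S" "a' \<notin> S" "b' \<notin> S" "a' \<noteq> b'"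
    "card S = d" "S \<subseteq> V" "a' \<in> V" "b' \<in> V" "is_clique S"
    "\<And>s. s \<in> S \<Longrightarrow> {a', s} \<in> L" "\<And>s. s \<in> S \<Longrightarrow> {b', s} \<in> L" by (rule geodesic_wall[OF geo ij(2)]) blast
  have "a' = a" "b' = b" using ab w by auto
  then have nL: "{a', b'} \<notin> L" using ab by simp
  note bend = geodesic_bend[OF geo ij(2) w(1,2,8,9,5) nL w(3,4,7,6,11,12)]
  define T where "T = f i \<inter> f (Suc i)"
  have T: "card T = d" using geo ij by (simp add: T_def geodesic_def gallery_def)
  have "\<not> T \<subseteq> S"
  proof
    assume "T \<subseteq> S"
    then have "T \<subseteq> f (Suc j)" using w(2) by blast
    moreover have "T \<subseteq> f i" unfolding T_def by blast
    ultimately have "Suc j = Suc i"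
      by (intro geodesic_shortcut[OF geo, of i "Suc j" T]) (use T ij in auto)
    then show False using ij by simp
  qed
  then obtain z where z: "z \<in> T" "z \<notin> S" by blast
  have "z \<in> component S a'" using bend(2)[of "Suc i"] ij z by (auto simp: T_def)
  then have zb: "z \<notin> component S b' \<union> S" using bend(1) z by blast
  have "z \<notin> f k \<inter> f (Suc k)" if "j \<le> k" "k < n" for k
    using bend(3)[of "Suc k"] that zb by auto
  then show ?thesis using z(1) unfolding T_def by blast
qed

text \<open>\<open>K\<close> abstracts the set of pairs whose distance is preserved; the second assumption holds because
  a point is determined by its distances to \<open>d + 1\<close> affinely independent points.\<close>

lemma separation_not_crossed:
  fixes K :: "'a \<Rightarrow> 'a \<Rightarrow> bool"
  assumes LK: "\<And>a b. {a, b} \<in> L \<Longrightarrow> K a b"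
    and trans: "\<And>S a c e. S \<subseteq> V \<Longrightarrow> card S = d \<Longrightarrow> is_clique S \<Longrightarrow> a \<in> V \<Longrightarrow> c \<in> V \<Longrightarrow> e \<in> V \<Longrightarrow> c \<notin> S \<Longrightarrow>
      (\<And>s. s \<in> S \<Longrightarrow> K a s \<and> K c s \<and> K e s) \<Longrightarrow> K a c \<Longrightarrow> K c e \<Longrightarrow> K a e"
    and sym: "\<And>a b. K a b \<Longrightarrow> K b a" and refl: "\<And>a. K a a"
    and straight: "\<And>n f i a b. geodesic u v n f \<Longrightarrow> i < n \<Longrightarrow> a \<in> f i - f (Suc i) \<Longrightarrow>
      b \<in> f (Suc i) - f i \<Longrightarrow> K a b"
    and V: "u \<in> V" "v \<in> V" "x \<in> V" "y \<in> V" and nK: "\<not> K x y"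
  shows "\<exists>A S B. sep A S B \<and> x \<in> A \<and> y \<in> B \<and> \<not> (u \<in> A \<and> v \<in> B) \<and> \<not> (u \<in> B \<and> v \<in> A)"
proof -
  obtain n f where geo: "geodesic x y n f" using geodesic_exists V by blast
  have "\<exists>i<n. \<exists>a\<in>f i - f (Suc i). \<exists>b\<in>f (Suc i) - f i. \<not> K a b"
  proof (rule ccontr)
    assume no: "\<not> ?thesis"
    \<comment> \<open>If every wall kept the distance of its two tips, preservation from
      \<open>x\<close> would spread through the gallery, by \<open>trans\<close> at each wall, up to
      \<open>y\<close>.\<close>
    have "\<forall>z\<in>f i. K x z" if "i \<le> n" for i
      using that
    proof (induction i)
      case 0
      have "x \<in> f 0" "is_clique (f 0)" using geo geodesic_chamber[OF geo, of 0]
        by (simp_all add: geodesic_def gallery_def chamber_def)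
      then show ?case using LK refl unfolding is_clique_def by metis
    next
      case (Suc i)
      then have "i < n" by simp
      then obtain S a b where w: "f i = insert a S" "f (Suc i) = insert b S" "a \<notin> S" "b \<notin> S" "a \<noteq> b"
        "card S = d" "S \<subseteq> V" "a \<in> V" "b \<in> V" "is_clique S"
        "\<And>s. s \<in> S \<Longrightarrow> {a, s} \<in> L" "\<And>s. s \<in> S \<Longrightarrow> {b, s} \<in> L" by (rule geodesic_wall[OF geo]) blast
      have IH: "\<forall>z\<in>f i. K x z" using Suc by simp
      have "K a b" using no \<open>i < n\<close> w(1-5) by auto
      have "K x b"
      proof (rule trans[of S x a b])
        show "K x s \<and> K a s \<and> K b s" if "s \<in> S" for s
          using IH w LK that by auto
      qed (use w V IH \<open>K a b\<close> in auto)
      then show ?case using IH w(1,2) by auto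
    qed
    moreover have "y \<in> f n" using geo by (simp add: geodesic_def gallery_def)
    ultimately show False using nK by blast
  qed
  then obtain i a' b' where i: "i < n" and ab': "a' \<in> f i - f (Suc i)" "b' \<in> f (Suc i) - f i"
      "\<not> K a' b'"
    by blast
  obtain S a b where w: "f i = insert a S" "f (Suc i) = insert b S" "a \<notin> S" "b \<notin> S" "a \<noteq> b"
    "card S = d" "S \<subseteq> V" "a \<in> V" "b \<in> V" "is_clique S"
    "\<And>s. s \<in> S \<Longrightarrow> {a, s} \<in> L" "\<And>s. s \<in> S \<Longrightarrow> {b, s} \<in> L" by (rule geodesic_wall[OF geo i]) blast
  have "a' = a" "b' = b" using ab' w by auto
  then have nKab: "\<not> K a b" using ab' by simp
  then have nL: "{a, b} \<notin> L" using LK by blast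
  note bend = geodesic_bend[OF geo i w(1,2,8,9,5) nL w(3,4,7,6,11,12)]
  define X where "X = component S a"
  define Y where "Y = component S b"
  have XY: "X \<inter> Y = {}" using bend(1) by (simp add: X_def Y_def)
  have aX: "a \<in> X" "b \<in> Y" by (simp_all add: X_def Y_def)
  have XV: "X \<subseteq> V - S" "Y \<subseteq> V - S" unfolding X_def Y_def using component_subset w by blast+
  have "x \<in> f 0" "y \<in> f n" using geo by (simp_all add: geodesic_def gallery_def)
  moreover have "f 0 \<subseteq> X \<union> S" "f n \<subseteq> Y \<union> S" using bend(2)[of 0] bend(3)[of n] i
    by (simp_all add: X_def Y_def)
  moreover have "x \<notin> S" using geodesic_start[OF geo, of "Suc i"] i w(2) by simp
  moreover have "y \<notin> S" using geodesic_end[OF geo i] w(1) by simp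
  ultimately have xX: "x \<in> X" and yY: "y \<in> Y" by blast+
  \<comment> \<open>Further components can be put on either side. If both placements are crossed by
    \<open>u\<close> and \<open>v\<close>, these lie in \<open>X\<close> and \<open>Y\<close> in
    some order.\<close>
  have sX: "sep X S (V - S - X)" and sY: "sep (V - S - Y) S Y"
    using component_separation[of S a b] component_separation[of S b a] w XY aX separation_swap
    unfolding X_def Y_def by blast+
  show ?thesis
  proof (rule ccontr)
    assume no: "\<not> ?thesis"
    have "\<not> (\<not> (u \<in> X \<and> v \<in> V - S - X) \<and> \<not> (u \<in> V - S - X \<and> v \<in> X))"
      using no sX xX yY XY XV by blast
    moreover have "\<not> (\<not> (u \<in> V - S - Y \<and> v \<in> Y) \<and> \<not> (u \<in> Y \<and> v \<in> V - S - Y))"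
      using no sY xX yY XY XV by blast
    ultimately have uv: "u \<in> X \<and> v \<in> Y \<or> u \<in> Y \<and> v \<in> X" using XY by blast
    \<comment> \<open>Stated with fresh names to cover both orders of \<open>u\<close> and
      \<open>v\<close>; here \<open>a'\<close> and \<open>b'\<close> are the tips of the bend,
      possibly exchanged.\<close>
    have contra: False
      if X': "X' = component S a'" and Y': "Y' = component S b'" and dis: "X' \<inter> Y' = {}"
        and u: "u \<in> X'" and v: "v \<in> Y'" and ab: "a' \<in> V - S" "b' \<in> V - S" "\<not> K a' b'"
        and adj: "\<And>s. s \<in> S \<Longrightarrow> {a', s} \<in> L" "\<And>s. s \<in> S \<Longrightarrow> {b', s} \<in> L" for X' Y' a' b'
    proof -
      have XV': "X' \<subseteq> V - S" "Y' \<subseteq> V - S" unfolding X' Y' using component_subset ab by blast+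
      obtain m g where g: "geodesic u v m g" using geodesic_exists V by blast
      have gm: "u \<in> g 0" "v \<in> g m" using g by (simp_all add: geodesic_def gallery_def)
      have ch: "chamber (g k)" if "k \<le> m" for k using geodesic_chamber[OF g that] .
      have inX: "g k \<subseteq> X' \<union> S" if "k \<le> m" "e \<in> g k" "e \<in> X'" for k e
        using chamber_in_component[OF ch[OF that(1)] that(2), of S] that(3) XV' component_eq X'
          by blast
      have inY: "g k \<subseteq> Y' \<union> S" if "k \<le> m" "e \<in> g k" "e \<in> Y'" for k e
        using chamber_in_component[OF ch[OF that(1)] that(2), of S] that(3) XV' component_eq Y'
          by blast
      have fS: "finite S" using w(7) fin finite_subset by blast
      have notS: "\<not> g k \<subseteq> S" if "k \<le> m" for k
        using ch[OF that] w(6) card_mono[OF fS, of "g k"] by (auto simp: chamber_def)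
      have g0: "g 0 \<subseteq> X' \<union> S" using inX[OF _ gm(1) u] by simp
      have "v \<notin> X' \<union> S" using v dis XV' by blast
      then have ngm: "\<not> g m \<subseteq> X' \<union> S" using gm(2) by blast
      define l where "l = (LEAST k. \<not> g k \<subseteq> X' \<union> S)"
      have l: "\<not> g l \<subseteq> X' \<union> S" unfolding l_def using ngm by (rule LeastI)
      have lm: "l \<le> m" unfolding l_def using ngm by (rule Least_le)
      have "l \<noteq> 0" using l g0 by metis
      then obtain k where k: "l = Suc k" by (cases l) auto
      have gk: "g k \<subseteq> X' \<union> S" using not_less_Least[of k "\<lambda>k. \<not> g k \<subseteq> X' \<union> S"] k by (simp add: l_def)
      have km: "k < m" using k lm by simp
      obtain T c e where wg: "g k = insert c T" "g (Suc k) = insert e T" "c \<notin> T" "e \<notin> T" "c \<noteq> e"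
        "card T = d" "T \<subseteq> V" "c \<in> V" "e \<in> V" "is_clique T"
        "\<And>s. s \<in> T \<Longrightarrow> {c, s} \<in> L" "\<And>s. s \<in> T \<Longrightarrow> {e, s} \<in> L" by (rule geodesic_wall[OF g km]) blast
      \<comment> \<open>A vertex of this wall outside \<open>S\<close> would keep the next chamber
        in \<open>X' \<union> S\<close>, against the choice of \<open>l\<close>.\<close>
      have "T \<subseteq> S"
      proof
        fix z assume z: "z \<in> T"
        show "z \<in> S"
        proof (rule ccontr)
          assume "z \<notin> S"
          then have "z \<in> X'" using gk wg(1) z by blast
          then have "g (Suc k) \<subseteq> X' \<union> S" using inX[of "Suc k" z] km wg(2) z by auto
          then show False using l k by simp
        qed
      qed
      then have TS: "T = S" using fS wg(6) w(6) by (simp add: card_subset_eq)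
      have cX: "c \<in> X'" using gk wg(1,3) TS by blast
      have eS: "e \<in> V - S" using wg TS by blast
      have ge: "g (Suc k) \<subseteq> component S e \<union> S"
        using chamber_in_component[of "g (Suc k)" e S] ch[of "Suc k"] km wg(2) eS by auto
      have gc: "g k \<subseteq> component S c \<union> S"
        using chamber_in_component[of "g k" c S] ch[of k] km wg(1,3) TS by auto
      have "g m \<subseteq> component S e \<union> S"
        by (rule geodesic_crossing_unique(2)[OF g km _ _ w(6) gc ge]) (use wg TS eS km in auto)
      then have "v \<in> component S e" using gm(2) v XV' by blast
      then have "component S e = component S v" using component_eq by blast
      also have "\<dots> = Y'" using v component_eq Y' by blast
      finally have eY: "e \<in> Y'" using component_refl[of e S] by simp
      \<comment> \<open>\<open>c\<close> and \<open>e\<close> are the tips where the second geodesic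
        crosses \<open>S\<close>. As \<open>a'\<close> and \<open>c\<close> share a component and
        are complete to \<open>S\<close>, they are equal or adjacent, likewise \<open>e\<close> and
        \<open>b'\<close>; \<open>trans\<close> over \<open>S\<close> carries \<open>K c e\<close>
        to \<open>a'\<close> and \<open>b'\<close>.\<close>
      have "K c e" using straight[OF g km, of c e] wg by auto
      moreover have "K a' c"
      proof (cases "a' = c")
        case False
        have "{a', c} \<in> L"
          by (rule same_component_adjacent[of S]) (use w wg TS False ab adj cX X' in auto)
        then show ?thesis by (rule LK)
      qed (use refl in simp)
      moreover have "K e b'"
      proof (cases "b' = e")
        case False
        have "{b', e} \<in> L"
          by (rule same_component_adjacent[of S]) (use w wg TS False ab adj eY Y' in auto)
        then show ?thesis using LK sym by blast
      qed (use refl in simp)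
      moreover have "K a' s" "K b' s" "K c s" "K e s" if "s \<in> S" for s
        using adj wg(11,12) TS LK that by blast+
      ultimately have "K a' e" by (intro trans[of S a' c e]) (use w wg TS ab in auto)
      then have "K a' b'" using \<open>K e b'\<close> \<open>\<And>s. s \<in> S \<Longrightarrow> K a' s\<close> \<open>\<And>s. s \<in> S \<Longrightarrow> K b' s\<close> \<open>\<And>s. s \<in> S \<Longrightarrow> K e s\<close>
        by (intro trans[of S a' e b']) (use w wg TS ab in auto)
      then show False using ab by blast
    qed
    show False
      using uv
    proof
      assume "u \<in> X \<and> v \<in> Y"
      then show False
        using contra[OF X_def Y_def XY] w nKab by blast
    next
      assume "u \<in> Y \<and> v \<in> X"
      moreover have "\<not> K b a" using nKab sym by blast
      ultimately show False
        using contra[OF Y_def X_def] XY w by blast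
    qed
  qed
qed

end

section \<open>Reflections of generic points\<close>

text \<open>\<open>n\<close> is not normalised, so the image is a rational function of the
  coordinates of \<open>n\<close>, \<open>s\<close> and \<open>x\<close>.\<close>

definition refl_plane :: "'b::real_inner \<Rightarrow> 'b \<Rightarrow> 'b \<Rightarrow> 'b" where
  "refl_plane n s x = x - (2 * (n \<bullet> (x - s)) / (n \<bullet> n)) *\<^sub>R n"

lemma refl_plane_fixed: "n \<bullet> (x - s) = 0 \<Longrightarrow> refl_plane n s x = x"
  by (simp add: refl_plane_def)

lemma inner_refl_plane: "n \<noteq> 0 \<Longrightarrow> n \<bullet> (refl_plane n s x - s) = - (n \<bullet> (x - s))"
  by (simp add: refl_plane_def inner_diff_right)

lemma refl_plane_involution: "n \<noteq> 0 \<Longrightarrow> refl_plane n s (refl_plane n s x) = x"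
  using inner_refl_plane[of n s x] by (subst refl_plane_def) (simp add: refl_plane_def)

lemma refl_plane_fixedD: "n \<noteq> 0 \<Longrightarrow> refl_plane n s x = x \<Longrightarrow> n \<bullet> (x - s) = 0"
  by (simp add: refl_plane_def)

text \<open>The change is four times the product of the signed distances of \<open>x\<close> and
  \<open>y\<close> from the mirror, so it is 0 only if one of them lies on it.\<close>

lemma norm_diff_refl_plane:
  assumes "n \<noteq> 0"
  shows "(norm (x - refl_plane n s y))\<^sup>2 =
    (norm (x - y))\<^sup>2 + 4 * (n \<bullet> (x - s)) * (n \<bullet> (y - s)) / (n \<bullet> n)"
proof -
  define k where "k = 2 * (n \<bullet> (y - s)) / (n \<bullet> n)"
  have k: "k * (n \<bullet> n) = 2 * (n \<bullet> (y - s))" using assms by (simp add: k_def)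
  have "x - refl_plane n s y = (x - y) + k *\<^sub>R n" by (simp add: refl_plane_def k_def)
  moreover have "(norm (z + k *\<^sub>R n))\<^sup>2 = (norm z)\<^sup>2 + 2 * k * (n \<bullet> z) + k * (k * (n \<bullet> n))" for z
    by (simp add: power2_norm_eq_inner inner_add_left inner_add_right inner_commute)
  ultimately have "(norm (x - refl_plane n s y))\<^sup>2 = (norm (x - y))\<^sup>2 + 2 * k * (n \<bullet> (x - y)) +
      k * (k * (n \<bullet> n))"
    by (simp only:)
  also have "\<dots> = (norm (x - y))\<^sup>2 + 2 * k * (n \<bullet> (x - y) + n \<bullet> (y - s))"
    by (simp only: k) (simp add: algebra_simps)
  also have "n \<bullet> (x - y) + n \<bullet> (y - s) = n \<bullet> (x - s)" by (simp add: inner_diff_right)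
  finally show ?thesis by (simp add: k_def)
qed

lemma norm_refl_plane_diff:
  assumes "n \<noteq> 0"
  shows "norm (refl_plane n s x - refl_plane n s y) = norm (x - y)"
proof -
  have "(norm (refl_plane n s x - refl_plane n s y))\<^sup>2
      = (norm (refl_plane n s x - y))\<^sup>2 + 4 * (n \<bullet> (refl_plane n s x - s)) * (n \<bullet> (y - s)) / (n \<bullet> n)"
    by (rule norm_diff_refl_plane[OF assms])
  also have "(norm (refl_plane n s x - y))\<^sup>2 = (norm (x - y))\<^sup>2 +
      4 * (n \<bullet> (y - s)) * (n \<bullet> (x - s)) / (n \<bullet> n)"
    using norm_diff_refl_plane[OF assms, of y s x] by (simp add: norm_minus_commute)
  finally have "(norm (refl_plane n s x - refl_plane n s y))\<^sup>2 = (norm (x - y))\<^sup>2"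
    using inner_refl_plane[OF assms] by (simp add: mult_ac)
  then show ?thesis by simp
qed

text \<open>The generalised cross product of the directions of the hyperplane through the points \<open>P i\<close>;
  its coordinates are polynomials in those of the points. The index \<open>undefined\<close> serves as an arbitrary
  base point.\<close>

definition normal :: "('n \<Rightarrow> real ^ 'n) \<Rightarrow> real ^ 'n" where
  "normal P = (\<chi> k. det (\<chi> i. if i = undefined then axis k 1 else P i - P undefined))"

lemma inner_normal: "normal P \<bullet> z = det (\<chi> i. if i = undefined then z else P i - P undefined)"
proof -
  have "z = (\<Sum>k\<in>UNIV. z $ k *s axis k 1)"
    by (simp add: vec_eq_iff axis_def if_distrib[of "\<lambda>r. _ * r"] cong: if_cong)
  then have "det (\<chi> i. if i = undefined then z else P i - P undefined)
      = det (\<chi> i. if i = undefined then (\<Sum>k\<in>UNIV. z $ k *s axis k 1) else P i - P undefined)"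
    by (rule arg_cong[where f = "\<lambda>z. det (\<chi> i. if i = undefined then z else P i - P undefined)"])
  also have "\<dots> = (\<Sum>k\<in>UNIV. z $ k * det (\<chi> i. if i =
      undefined then axis k 1 else P i - P undefined))"
    by (simp add: det_linear_row_sum det_row_mul)
  also have "\<dots> = normal P \<bullet> z" by (simp add: normal_def inner_vec_def mult.commute)
  finally show ?thesis by simp
qed

lemma inner_normal_point: "normal P \<bullet> (P i - P undefined) = 0"
proof (cases "i = undefined")
  case False
  show ?thesis unfolding inner_normal
    by (rule det_identical_rows[of i undefined]) (use False in \<open>auto simp: row_def\<close>)
qed simp

text \<open>The inner product is again a determinant from \<open>general_position\<close>, with
  \<open>y\<close> replacing the base vertex and the old base vertex as reference point.\<close>

lemma inner_normal_nonzero: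
  fixes p :: "'a \<Rightarrow> real ^ 'n"
  assumes gp: "general_position V p" and \<sigma>: "inj \<sigma>" "range \<sigma> \<subseteq> V" "y \<in> V" "y \<notin> range \<sigma>"
  shows "normal (\<lambda>i. p (\<sigma> i)) \<bullet> (p y - p (\<sigma> undefined)) \<noteq> 0"
proof -
  define \<tau> where "\<tau> = \<sigma>(undefined := y)"
  have "inj \<tau>" using \<sigma> unfolding \<tau>_def by (intro inj_on_fun_updI) auto
  moreover have "range \<tau> \<subseteq> V" using \<sigma> by (auto simp: \<tau>_def)
  moreover have "\<sigma> undefined \<in> V - range \<tau>"
    using \<sigma> by (auto simp: \<tau>_def inj_eq split: if_splits)
  ultimately have "det (\<chi> i. p (\<tau> i) - p (\<sigma> undefined)) \<noteq> 0"
    using gp unfolding general_position_def by blast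
  moreover have "(\<chi> i. p (\<tau> i) - p (\<sigma> undefined)) =
      (\<chi> i. if i = undefined then p y - p (\<sigma> undefined) else p (\<sigma> i) - p (\<sigma> undefined))"
    by (simp add: \<tau>_def vec_eq_iff)
  ultimately show ?thesis by (simp add: inner_normal)
qed

definition reflect :: "('n \<Rightarrow> real ^ 'n) \<Rightarrow> real ^ 'n \<Rightarrow> real ^ 'n" where
  "reflect P = refl_plane (normal P) (P undefined)"

lemma reflect_point: "reflect P (P i) = P i"
  unfolding reflect_def by (rule refl_plane_fixed) (rule inner_normal_point)

text \<open>\<open>z - z'\<close> is orthogonal to all directions of the hyperplane, hence a
  multiple \<open>c\<close> of its normal; equal distance to the base point is a quadratic equation
  for \<open>c\<close>, and its roots are the two cases.\<close>

lemma equidistant_imp_reflect: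
  fixes p :: "'a \<Rightarrow> real ^ 'n"
  assumes gp: "general_position V p" and \<sigma>: "inj \<sigma>" "range \<sigma> \<subseteq> V" "y \<in> V" "y \<notin> range \<sigma>"
    and eq: "\<And>i. norm (z - p (\<sigma> i)) = norm (z' - p (\<sigma> i))"
  shows "z' = z \<or> z' = reflect (\<lambda>i. p (\<sigma> i)) z"
proof -
  define n where "n = normal (\<lambda>i. p (\<sigma> i))"
  define s where "s = p (\<sigma> undefined)"
  have n: "n \<bullet> (p y - s) \<noteq> 0" unfolding n_def s_def by (rule inner_normal_nonzero[OF gp \<sigma>])
  then have n0: "n \<noteq> 0" by auto
  define c where "c = (z - z') \<bullet> (p y - s) / (n \<bullet> (p y - s))"
  have perp: "(z - z') \<bullet> (p (\<sigma> i) - s) = 0" for i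
  proof -
    have "(z - p (\<sigma> i)) \<bullet> (z - p (\<sigma> i)) = (z' - p (\<sigma> i)) \<bullet> (z' - p (\<sigma> i))"
      "(z - s) \<bullet> (z - s) = (z' - s) \<bullet> (z' - s)"
      using eq[of i] eq[of undefined] unfolding s_def by (simp_all add: norm_eq_sqrt_inner)
    then show ?thesis by (simp add: inner_diff_left inner_diff_right inner_commute)
  qed
  have np: "n \<bullet> (p (\<sigma> i) - s) = 0" for i unfolding n_def s_def by (rule inner_normal_point)
  \<comment> \<open>Directions within the hyperplane do not suffice to identify the two vectors; the
    vertex \<open>y\<close> off it supplies the last one, and \<open>c\<close> is defined by testing
    there.\<close>
  have "(z - z') - c *\<^sub>R n = 0"
  proof (rule general_position_span[OF gp \<sigma>(3), of "range \<sigma>"])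
    show "range \<sigma> \<subseteq> V - {y}" using \<sigma> by blast
    show "CARD('n) \<le> card (range \<sigma>)" using \<sigma> by (simp add: card_image)
    fix x assume "x \<in> range \<sigma>"
    then obtain i where i: "x = \<sigma> i" by blast
    have "((z - z') - c *\<^sub>R n) \<bullet> (p y - s) = 0" using n by (simp add: inner_diff_left c_def)
    moreover have "((z - z') - c *\<^sub>R n) \<bullet> (p x - s) = 0"
      using perp[of i] np[of i] by (simp add: inner_diff_left i)
    ultimately have "((z - z') - c *\<^sub>R n) \<bullet> ((p y - s) - (p x - s)) = 0"
      by (simp only: inner_diff_right)
    then show "(p y - p x) \<bullet> ((z - z') - c *\<^sub>R n) = 0" by (simp add: inner_commute)
  qed
  then have z': "z' = z - c *\<^sub>R n" by (simp add: algebra_simps)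
  have "(z - s) \<bullet> (z - s) = (z - c *\<^sub>R n - s) \<bullet> (z - c *\<^sub>R n - s)"
    using eq[of undefined] unfolding s_def z' by (simp add: norm_eq_sqrt_inner)
  also have "z - c *\<^sub>R n - s = (z - s) - c *\<^sub>R n" by simp
  finally have "c * (c * (n \<bullet> n)) = c * (2 * (n \<bullet> (z - s)))"
    by (simp add: inner_diff_left[of "z - s"] inner_diff_right[of _
        "z - s"] inner_commute algebra_simps)
  then have "c = 0 \<or> c = 2 * (n \<bullet> (z - s)) / (n \<bullet> n)" using n0 by (simp add: field_simps)
  then show ?thesis using z' by (auto simp: reflect_def refl_plane_def n_def s_def)
qed

text \<open>The head of the list is applied last. All mirrors pass through points of
  \<open>p\<close> itself, not through images under earlier reflections.\<close>

primrec reflections :: "('n \<Rightarrow> 'a) list \<Rightarrow> ('a \<Rightarrow> real ^ 'n) \<Rightarrow> real ^ 'n \<Rightarrow> real ^ 'n" where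
  "reflections [] p z = z"
| "reflections (\<sigma> # \<sigma>s) p z = reflect (\<lambda>i. p (\<sigma> i)) (reflections \<sigma>s p z)"

lemma reflections_cong:
  assumes "\<And>\<sigma> i. \<sigma> \<in> set \<sigma>s \<Longrightarrow> p (\<sigma> i) = q (\<sigma> i)"
  shows "reflections \<sigma>s p z = reflections \<sigma>s q z"
  using assms by (induction \<sigma>s) (auto simp: fun_eq_iff)

text \<open>Together with \<open>refl_num\<close>, homogeneous coordinates of the reflected point:
  each step multiplies by the square of the normal instead of dividing by it, so both stay
  polynomial.\<close>

primrec refl_den :: "('n \<Rightarrow> 'a) list \<Rightarrow> ('a \<Rightarrow> real ^ 'n) \<Rightarrow> real" where
  "refl_den [] p = 1"
| "refl_den (\<sigma> # \<sigma>s) p = (normal (\<lambda>i. p (\<sigma> i)) \<bullet> normal (\<lambda>i. p (\<sigma> i))) * refl_den \<sigma>s p"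

primrec refl_num :: "('n \<Rightarrow> 'a) list \<Rightarrow> ('a \<Rightarrow> real ^ 'n) \<Rightarrow> 'a \<Rightarrow> real ^ 'n" where
  "refl_num [] p v = p v"
| "refl_num (\<sigma> # \<sigma>s) p v =
     (normal (\<lambda>i. p (\<sigma> i)) \<bullet> normal (\<lambda>i. p (\<sigma> i))) *\<^sub>R refl_num \<sigma>s p v -
     (2 * (normal (\<lambda>i. p (\<sigma> i)) \<bullet> (refl_num \<sigma>s p v - refl_den \<sigma>s p *\<^sub>R p (\<sigma> undefined)))) *\<^sub>R
       normal (\<lambda>i. p (\<sigma> i))"

lemma refl_num_den:
  assumes "\<And>\<sigma>. \<sigma> \<in> set \<sigma>s \<Longrightarrow> normal (\<lambda>i. p (\<sigma> i)) \<noteq> 0"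
  shows "refl_den \<sigma>s p \<noteq> 0 \<and> refl_num \<sigma>s p v = refl_den \<sigma>s p *\<^sub>R reflections \<sigma>s p (p v)"
  using assms
proof (induction \<sigma>s)
  case (Cons \<sigma> \<sigma>s)
  define n where "n = normal (\<lambda>i. p (\<sigma> i))"
  define z where "z = reflections \<sigma>s p (p v)"
  have n: "n \<bullet> n \<noteq> 0" using Cons.prems by (simp add: n_def)
  have IH: "refl_den \<sigma>s p \<noteq> 0" "refl_num \<sigma>s p v = refl_den \<sigma>s p *\<^sub>R z"
    using Cons by (auto simp: z_def)
  have "refl_num (\<sigma> # \<sigma>s) p v = ((n \<bullet> n) * refl_den \<sigma>s p) *\<^sub>R z
      - (2 * (refl_den \<sigma>s p * (n \<bullet> (z - p (\<sigma> undefined))))) *\<^sub>R n"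
    by (simp add: IH(2) n_def flip: scaleR_diff_right)
  also have "\<dots> = ((n \<bullet> n) * refl_den \<sigma>s p) *\<^sub>R (z - (2 * (n \<bullet> (z - p (\<sigma> undefined))) / (n \<bullet> n)) *\<^sub>R n)"
    using n by (simp add: scaleR_diff_right mult_ac)
  finally show ?case using n IH(1) by (simp add: reflect_def refl_plane_def n_def z_def)
qed simp

definition points :: "('a \<times> 'n \<Rightarrow> real) \<Rightarrow> 'a \<Rightarrow> real ^ 'n" where
  "points c x = (\<chi> i. c (x, i))"

lemma points_coords [simp]: "points (coords p) = p"
  by (simp add: points_def fun_eq_iff vec_eq_iff)

definition polyvec :: "'k set \<Rightarrow> (('k \<Rightarrow> real) \<Rightarrow> real ^ 'n) \<Rightarrow> bool" where
  "polyvec K F \<longleftrightarrow> (\<forall>i. polyfun K (\<lambda>c. F c $ i))"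

lemma polyvec_points: "x \<in> V \<Longrightarrow> polyvec (V \<times> (UNIV :: 'n::finite set)) (\<lambda>c. points c x :: real ^ 'n)"
  by (auto simp: polyvec_def points_def intro: polyfun_intros)

lemma polyvec_diff: "polyvec K F \<Longrightarrow> polyvec K G \<Longrightarrow> polyvec K (\<lambda>c. F c - G c)"
  by (auto simp: polyvec_def intro: polyfun_intros)

lemma polyvec_scaleR: "polyfun K f \<Longrightarrow> polyvec K G \<Longrightarrow> polyvec K (\<lambda>c. f c *\<^sub>R G c)"
  by (auto simp: polyvec_def intro: polyfun_intros)

lemma polyfun_inner: "polyvec K F \<Longrightarrow> polyvec K G \<Longrightarrow> polyfun K (\<lambda>c. F c \<bullet> G c)"
  unfolding polyvec_def inner_vec_def inner_real_def by (intro polyfun_intros) auto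

lemma polyvec_normal:
  fixes P :: "('k \<Rightarrow> real) \<Rightarrow> 'n::finite \<Rightarrow> real ^ 'n"
  assumes "\<And>i. polyvec K (\<lambda>c. P c i)"
  shows "polyvec K (\<lambda>c. normal (P c))"
proof -
  have ax: "polyfun K (\<lambda>c. axis k 1 $ j)" for k j :: 'n
    by (cases "j = k") (auto simp: axis_def intro: polyfun_intros)
  have "polyfun K (\<lambda>c. det (\<chi> i. if i = undefined then axis k 1 else P c i - P c undefined))" for k
  proof (rule polyfun_det)
    fix i j
    show "polyfun K (\<lambda>c. (\<chi> i. if i = undefined then axis k 1 else P c i - P c undefined) $ i $ j)"
      using assms ax by (cases "i = undefined") (auto simp: polyvec_def intro: polyfun_intros)
  qed
  then show ?thesis by (simp add: polyvec_def normal_def)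
qed

lemma polyfun_refl:
  fixes \<sigma>s :: "('n::finite \<Rightarrow> 'a) list"
  assumes "\<And>\<sigma>. \<sigma> \<in> set \<sigma>s \<Longrightarrow> range \<sigma> \<subseteq> V" "v \<in> V"
  shows "polyfun (V \<times> (UNIV :: 'n set)) (\<lambda>c. refl_den \<sigma>s (points c)) \<and>
         polyvec (V \<times> (UNIV :: 'n set)) (\<lambda>c. refl_num \<sigma>s (points c) v)"
  using assms
proof (induction \<sigma>s)
  case Nil
  then show ?case by (auto intro: polyfun_intros polyvec_points)
next
  case (Cons \<sigma> \<sigma>s)
  have p: "polyvec (V \<times> (UNIV :: 'n set)) (\<lambda>c. points c (\<sigma> i))" for i
    using Cons.prems by (intro polyvec_points) auto
  then have n: "polyvec (V \<times> (UNIV :: 'n set)) (\<lambda>c. normal (\<lambda>i. points c (\<sigma> i)))"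
    by (rule polyvec_normal)
  have IH: "polyfun (V \<times> (UNIV :: 'n set)) (\<lambda>c. refl_den \<sigma>s (points c))"
    "polyvec (V \<times> (UNIV :: 'n set)) (\<lambda>c. refl_num \<sigma>s (points c) v)" using Cons by auto
  show ?case
    by (simp, intro conjI polyfun.mult polyvec_diff polyvec_scaleR polyfun_inner polyfun_numeral IH n p)
qed

text \<open>Clearing denominators turns the hypothesis into a polynomial identity, which genericity extends to
  all configurations. Putting \<open>u\<close> and \<open>v\<close> at one arbitrary point shows that the composed reflections
  are the identity; moving \<open>w\<close> only changes the first of them, a contradiction.\<close>

lemma generic_reflections_change_distance:
  fixes p :: "'a \<Rightarrow> real ^ 'n" and \<sigma> :: "'n \<Rightarrow> 'a"
  assumes gen: "generic V p" and uv: "u \<in> V" "v \<in> V" "u \<noteq> v"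
    and \<sigma>s: "\<And>\<tau>. \<tau> \<in> set (\<sigma> # \<sigma>s) \<Longrightarrow> inj \<tau> \<and> range \<tau> \<subseteq> V \<and> u \<notin> range \<tau> \<and> v \<notin> range \<tau>"
    and w: "w \<in> range \<sigma>" "\<And>\<tau>. \<tau> \<in> set \<sigma>s \<Longrightarrow> w \<notin> range \<tau>"
  shows "norm (p u - reflections (\<sigma> # \<sigma>s) p (p v)) \<noteq> norm (p u - p v)"
proof
  assume eq: "norm (p u - reflections (\<sigma> # \<sigma>s) p (p v)) = norm (p u - p v)"
  let ?s = "\<sigma> # \<sigma>s"
  have gp: "general_position V p" by (rule generic_imp_general_position[OF gen])
  have nz: "normal (\<lambda>i. p (\<tau> i)) \<noteq> 0" if "inj \<tau>" "range \<tau> \<subseteq> V" "y \<in> V" "y \<notin> range \<tau>" for \<tau> y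
    using inner_normal_nonzero[OF gp that] by auto
  define F where "F q = (refl_den ?s q)\<^sup>2 * ((q u - q v) \<bullet> (q u - q v)) -
    (refl_den ?s q *\<^sub>R q u - refl_num ?s q v) \<bullet> (refl_den ?s q *\<^sub>R q u - refl_num ?s q v)" for q
  have F: "F q = (refl_den ?s q)\<^sup>2 * ((norm (q u - q v))\<^sup>2 - (norm (q u - reflections ?s q (q v)))\<^sup>2)"
    if "\<And>\<tau>. \<tau> \<in> set ?s \<Longrightarrow> normal (\<lambda>i. q (\<tau> i)) \<noteq> 0" for q
  proof -
    have "refl_den ?s q \<noteq> 0 \<and> refl_num ?s q v = refl_den ?s q *\<^sub>R reflections ?s q (q v)"
      by (rule refl_num_den) (rule that)
    note num = conjunct2[OF this]
    have "refl_den ?s q *\<^sub>R q u - refl_num ?s q v =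
        refl_den ?s q *\<^sub>R (q u - reflections ?s q (q v))"
      by (simp only: scaleR_diff_right num)
    then show ?thesis
      unfolding F_def by (simp only: power2_norm_eq_inner inner_scaleR_left inner_scaleR_right)
        (simp add: power2_eq_square algebra_simps)
  qed
  have polyF: "polyfun (V \<times> (UNIV :: 'n set)) (\<lambda>c. F (points c))"
    unfolding F_def
    using polyfun_refl[of ?s V v] \<sigma>s uv
    by (intro polyfun_diff polyfun.mult polyfun_power polyfun_inner polyvec_diff polyvec_scaleR polyvec_points) auto
  have "F p = 0"
  proof -
    have "normal (\<lambda>i. p (\<tau> i)) \<noteq> 0" if "\<tau> \<in> set ?s" for \<tau> using \<sigma>s[OF that] nz uv by blast
    then show ?thesis using F[of p] eq
      by (simp del: refl_den.simps refl_num.simps reflections.simps)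
  qed
  then have F0: "F q = 0" for q
    using generic_polyfun[OF gen polyF, of q] by (simp only: points_coords)
  have ident: "reflections ?s q z = z" if q: "\<And>\<tau>. \<tau> \<in> set ?s \<Longrightarrow> normal (\<lambda>i. q (\<tau> i)) \<noteq> 0" for q z
  proof -
    \<comment> \<open>\<open>u\<close> and \<open>v\<close> span no mirror, so both can be moved to
      \<open>z\<close> without changing the composition.\<close>
    define r where "r = q(u := z, v := z)"
    have rq: "r (\<tau> i) = q (\<tau> i)" if "\<tau> \<in> set ?s" for \<tau> i using \<sigma>s[OF that] by (auto simp: r_def)
    then have nr: "normal (\<lambda>i. r (\<tau> i)) \<noteq> 0" if "\<tau> \<in> set ?s" for \<tau> using q[OF that] that by simp
    have "refl_den ?s r \<noteq> 0 \<and> refl_num ?s r v = refl_den ?s r *\<^sub>R reflections ?s r (r v)"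
      by (rule refl_num_den) (rule nr)
    moreover have "F r = (refl_den ?s r)\<^sup>2 * ((norm (r u - r v))\<^sup>2 - (norm (r u - reflections ?s r (r v)))\<^sup>2)"
      by (rule F) (rule nr)
    moreover have "r u = z" "r v = z" by (simp_all add: r_def)
    ultimately have "reflections ?s r z = z" using F0[of r]
      by (simp del: refl_den.simps refl_num.simps reflections.simps)
    moreover have "reflections ?s r z = reflections ?s q z" by (rule reflections_cong) (rule rq)
    ultimately show ?thesis by simp
  qed
  \<comment> \<open>\<open>w\<close> moves to the place of \<open>u\<close>. The new mirror is that
    of \<open>\<sigma>\<close> with \<open>u\<close> in place of \<open>w\<close>, so general
    position, tested at \<open>v\<close>, still gives a nonzero normal.\<close>
  define p' where "p' = p(w := p u)"
  obtain i where i: "\<sigma> i = w" using w(1) by blast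
  have \<sigma>: "inj \<sigma>" "range \<sigma> \<subseteq> V" "u \<notin> range \<sigma>" "v \<notin> range \<sigma>" using \<sigma>s by auto
  have p'\<sigma>s: "p' (\<tau> j) = p (\<tau> j)" if "\<tau> \<in> set \<sigma>s" for \<tau> j using w(2)[OF that] by (auto simp: p'_def)
  define \<tau> where "\<tau> = \<sigma>(i := u)"
  have "(\<lambda>j. p' (\<sigma> j)) = (\<lambda>j. p (\<tau> j))" using \<sigma>(1) i by (auto simp: p'_def \<tau>_def fun_eq_iff inj_eq)
  moreover have "inj \<tau>" unfolding \<tau>_def using \<sigma> by (intro inj_on_fun_updI) auto
  moreover have "range \<tau> \<subseteq> V" "v \<notin> range \<tau>" using \<sigma> uv by (auto simp: \<tau>_def)
  ultimately have nz': "normal (\<lambda>j. p' (\<sigma> j)) \<noteq> 0" using nz[of \<tau> v] uv by simp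
  have nzp: "normal (\<lambda>j. p (\<sigma> j)) \<noteq> 0" using nz[of \<sigma> v] \<sigma> uv by blast
  have "reflections ?s p z = z" for z by (rule ident) (use \<sigma>s nz uv in blast)
  then have 1: "reflect (\<lambda>j. p (\<sigma> j)) (reflections \<sigma>s p z) = z" for z by simp
  have "reflections ?s p' z = z" for z
  proof (rule ident)
    fix \<rho> assume \<rho>: "\<rho> \<in> set ?s"
    show "normal (\<lambda>j. p' (\<rho> j)) \<noteq> 0"
    proof (cases "\<rho> = \<sigma>")
      case False
      then have "\<rho> \<in> set \<sigma>s" using \<rho> by simp
      then have "(\<lambda>j. p' (\<rho> j)) = (\<lambda>j. p (\<rho> j))" using p'\<sigma>s by blast
      then show ?thesis using \<sigma>s[OF \<rho>] nz uv by metis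
    qed (use nz' in simp)
  qed
  moreover have "reflections \<sigma>s p' z = reflections \<sigma>s p z" for z
    by (rule reflections_cong) (rule p'\<sigma>s)
  ultimately have 2: "reflect (\<lambda>j. p' (\<sigma> j)) (reflections \<sigma>s p z) = z" for z by simp
  \<comment> \<open>Both mirrors invert the same product of the remaining reflections, hence agree
    at \<open>p u\<close>; the moved mirror contains \<open>p u\<close>, the original one does
    not.\<close>
  have "reflect (\<lambda>j. p (\<sigma> j)) (p u) = reflections \<sigma>s p (p u)"
    using 1[of "p u"] refl_plane_involution[OF nzp] unfolding reflect_def by metis
  moreover have "reflect (\<lambda>j. p' (\<sigma> j)) (p u) = reflections \<sigma>s p (p u)"
    using 2[of "p u"] refl_plane_involution[OF nz'] unfolding reflect_def by metis
  moreover have "reflect (\<lambda>j. p' (\<sigma> j)) (p u) = p u"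
    using reflect_point[of "\<lambda>j. p' (\<sigma> j)" i] i by (simp add: p'_def)
  ultimately have "reflect (\<lambda>j. p (\<sigma> j)) (p u) = p u" by simp
  then have "normal (\<lambda>j. p (\<sigma> j)) \<bullet> (p u - p (\<sigma> undefined)) = 0"
    unfolding reflect_def by (rule refl_plane_fixedD[OF nzp])
  then show False using inner_normal_nonzero[OF gp \<sigma>(1,2) uv(1) \<sigma>(3)] by simp
qed

section \<open>Adding an edge\<close>

definition euclidean_isometry :: "('b::real_normed_vector \<Rightarrow> 'b) \<Rightarrow> bool" where
  "euclidean_isometry h \<longleftrightarrow> (\<forall>y z. norm (h y - h z) = norm (y - z)) \<and> surj h"

text \<open>Equal distances mean equal Gram matrices of the edge vectors, so the linear map from
  \<open>a i\<close> to \<open>b i\<close> is orthogonal.\<close>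

lemma simplex_isometry:
  fixes p q :: "'a \<Rightarrow> real ^ 'n" and \<sigma> :: "'n \<Rightarrow> 'a"
  assumes det: "det (\<chi> i. p (\<sigma> i) - p z) \<noteq> 0"
    and eq: "\<And>x y. x \<in> insert z (range \<sigma>) \<Longrightarrow> y \<in> insert z (range \<sigma>) \<Longrightarrow>
        norm (p x - p y) = norm (q x - q y)"
  shows "\<exists>h. euclidean_isometry h \<and> (\<forall>x\<in>insert z (range \<sigma>). h (p x) = q x)"
proof -
  define a where "a i = p (\<sigma> i) - p z" for i
  define b where "b i = q (\<sigma> i) - q z" for i
  obtain c where c: "linear c" "\<And>y. y = (\<Sum>i\<in>UNIV. c y $ i *\<^sub>R a i)" "\<And>k. c (a k) = axis k 1"
    using matrix_row_coordinates[of a] det unfolding a_def by blast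
  have "norm (a i) = norm (b i)" "norm (a i - a j) = norm (b i - b j)" for i j
    using eq[of "\<sigma> i" z] eq[of "\<sigma> i" "\<sigma> j"] by (simp_all add: a_def b_def)
  then have ab: "a i \<bullet> a j = b i \<bullet> b j" for i j by (simp add: dot_norm_neg)
  define g where "g y = (\<Sum>i\<in>UNIV. c y $ i *\<^sub>R b i)" for y
  have "linear g"
    by (rule linearI) (simp_all add: g_def linear_add[OF c(1)] linear_scale[OF c(1)] scaleR_add_left
        sum.distrib scaleR_sum_right)
  moreover have "norm (g y) = norm y" for y
  proof -
    have "g y \<bullet> g y = (\<Sum>i\<in>UNIV. \<Sum>j\<in>UNIV. c y $ i * (c y $ j * (b i \<bullet> b j)))"
      by (simp add: g_def inner_sum_left inner_sum_right sum_distrib_left inner_commute mult.left_commute)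
    also have "\<dots> = (\<Sum>i\<in>UNIV. c y $ i *\<^sub>R a i) \<bullet> (\<Sum>i\<in>UNIV. c y $ i *\<^sub>R a i)"
      by (simp add: inner_sum_left inner_sum_right sum_distrib_left ab inner_commute mult.left_commute)
    finally show ?thesis using c(2)[of y] by (simp add: norm_eq_sqrt_inner)
  qed
  ultimately have g: "orthogonal_transformation g" by (simp add: orthogonal_transformation)
  define h where "h y = q z + g (y - p z)" for y
  have "norm (h y - h y') = norm (y - y')" for y y'
  proof -
    have "h y - h y' = g (y - y')"
      using orthogonal_transformation_linear[OF g] by (simp add: h_def flip: linear_diff)
    then show ?thesis using g by (simp add: orthogonal_transformation)
  qed
  moreover have "surj h"
  proof (rule surjI)
    fix y show "h (p z + inv g (y - q z)) = y"
      using orthogonal_transformation_surj[OF g] by (simp add: h_def surj_f_inv_f)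
  qed
  moreover have "h (p z) = q z"
    using orthogonal_transformation_linear[OF g] by (simp add: h_def linear_0)
  moreover have "h (p (\<sigma> k)) = q (\<sigma> k)" for k
  proof -
    have "g (a k) = b k" by (simp add: g_def c(3) axis_def if_distrib[of
        "\<lambda>r. r *\<^sub>R _"] cong: if_cong)
    then show ?thesis by (simp add: h_def a_def b_def)
  qed
  ultimately show ?thesis by (auto simp: euclidean_isometry_def)
qed

lemma frame_isometry:
  fixes p q :: "'a \<Rightarrow> real ^ 'n"
  assumes gp: "general_position V p" and W: "W \<subseteq> V" "card W = CARD('n) + 1"
    and eq: "\<And>x y. x \<in> W \<Longrightarrow> y \<in> W \<Longrightarrow> norm (p x - p y) = norm (q x - q y)"
  shows "\<exists>h. euclidean_isometry h \<and> (\<forall>x\<in>W. h (p x) = q x)"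
proof -
  obtain z where z: "z \<in> W" using W by fastforce
  have "finite W" using W by (metis card.infinite add_is_0 one_neq_zero)
  then have "card (W - {z}) = CARD('n)" using W z by simp
  then obtain \<sigma> :: "'n \<Rightarrow> 'a" where \<sigma>: "inj \<sigma>" "range \<sigma> = W - {z}" using obtain_enumeration by metis
  have W': "insert z (range \<sigma>) = W" using \<sigma> z by blast
  have "det (\<chi> i. p (\<sigma> i) - p z) \<noteq> 0"
    using gp \<sigma> z W unfolding general_position_def by blast
  from simplex_isometry[of p \<sigma> z q, OF this] show ?thesis unfolding W' using eq by blast
qed

lemma point_determined_by_distances:
  fixes p :: "'a \<Rightarrow> real ^ 'n"
  assumes gp: "general_position V p" and W: "W \<subseteq> V" "card W = CARD('n) + 1"
    and eq: "\<And>s. s \<in> W \<Longrightarrow> norm (y - p s) = norm (y' - p s)"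
  shows "y = y'"
proof -
  obtain z where z: "z \<in> W" using W by fastforce
  have "finite W" using W by (metis card.infinite add_is_0 one_neq_zero)
  have "y - y' = 0"
  proof (rule general_position_span[OF gp, of z "W - {z}"])
    show "CARD('n) \<le> card (W - {z})" using W z \<open>finite W\<close> by simp
    fix s assume "s \<in> W - {z}"
    then have "(y - p s) \<bullet> (y - p s) = (y' - p s) \<bullet> (y' - p s)"
        "(y - p z) \<bullet> (y - p z) = (y' - p z) \<bullet> (y' - p z)"
      using eq z by (auto simp: norm_eq_sqrt_inner)
    then show "(p z - p s) \<bullet> (y - y') = 0"
      by (simp add: inner_diff_left inner_diff_right inner_commute)
  qed (use W z in auto)
  then show ?thesis by simp
qed

text \<open>The preimage of \<open>y'\<close> under \<open>h\<close> has the same distances to the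
  frame as \<open>y\<close>, and d + 1 such distances determine a point.\<close>

lemma isometry_eq_of_distances:
  fixes p q :: "'a \<Rightarrow> real ^ 'n"
  assumes gp: "general_position V p" and W: "W \<subseteq> V" "card W = CARD('n) + 1"
    and h: "euclidean_isometry h" "\<And>s. s \<in> W \<Longrightarrow> h (p s) = q s"
    and eq: "\<And>s. s \<in> W \<Longrightarrow> norm (y - p s) = norm (y' - q s)"
  shows "h y = y'"
proof -
  obtain x where x: "y' = h x" using h(1) by (metis euclidean_isometry_def surjD)
  have "y = x"
  proof (rule point_determined_by_distances[OF gp W])
    fix s assume s: "s \<in> W"
    then have "norm (y - p s) = norm (h x - h (p s))" using eq h(2) x by simp
    then show "norm (y - p s) = norm (x - p s)" using h(1) by (simp add: euclidean_isometry_def)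
  qed
  then show ?thesis using x by simp
qed

text \<open>Distances to \<open>S\<close> alone would leave a reflection open. With \<open>c\<close>
  added there are d + 1 points, whose isometry carries \<open>p a\<close> to \<open>q a\<close> and
  \<open>p e\<close> to \<open>q e\<close>.\<close>

lemma preserved_distance_trans:
  fixes p q :: "'a \<Rightarrow> real ^ 'n"
  defines "K \<equiv> \<lambda>a b. norm (p a - p b) = norm (q a - q b)"
  assumes gp: "general_position V p" and S: "S \<subseteq> V" "card S = CARD('n)" "finite S" "c \<in> V" "c \<notin> S"
    and KS: "\<And>s t. s \<in> S \<Longrightarrow> t \<in> S \<Longrightarrow> K s t"
    and Ks: "\<And>s. s \<in> S \<Longrightarrow> K a s \<and> K c s \<and> K e s" and ac: "K a c" and ce: "K c e"
  shows "K a e"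
proof -
  have sym: "K a b \<Longrightarrow> K b a" for a b by (simp add: K_def norm_minus_commute)
  define W where "W = insert c S"
  have W: "W \<subseteq> V" "card W = CARD('n) + 1" using S by (auto simp: W_def)
  have KW: "K x y" if "x \<in> W" "y \<in> W" for x y
  proof -
    have "K c c" by (simp add: K_def)
    then show ?thesis using that KS Ks sym unfolding W_def by blast
  qed
  then obtain h where h: "euclidean_isometry h" "\<And>s. s \<in> W \<Longrightarrow> h (p s) = q s"
    using frame_isometry[OF gp W, of q] unfolding K_def by blast
  have "K a s" "K e s" if "s \<in> W" for s using that Ks ac ce sym unfolding W_def by blast+
  then have "h (p a) = q a" "h (p e) = q e"
    using isometry_eq_of_distances[OF gp W h] unfolding K_def by blast+
  then show ?thesis using h(1) unfolding K_def euclidean_isometry_def by metis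
qed

text \<open>With \<open>h\<close> the isometry of the first chamber, \<open>q u\<close> is
  \<open>h (p u)\<close> and \<open>q v\<close> is \<open>h\<close> of the image of
  \<open>p v\<close> under the reflections at the bent walls. So \<open>K u v\<close> says that this
  product keeps the distance to \<open>p u\<close>, which is impossible if some wall is
  bent.\<close>

lemma (in clique_separated_graph) geodesic_straight:
  fixes p q :: "'a \<Rightarrow> real ^ 'n"
  defines "K \<equiv> \<lambda>a b. norm (p a - p b) = norm (q a - q b)"
  assumes d: "d = CARD('n)" and gen: "generic V p" and LK: "\<And>a b. {a, b} \<in> L \<Longrightarrow> K a b"
    and uv: "u \<in> V" "v \<in> V" "u \<noteq> v" "K u v" and geo: "geodesic u v n f"
    and i: "i < n" and ab: "a \<in> f i - f (Suc i)" "b \<in> f (Suc i) - f i"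
  shows "K a b"
proof (rule ccontr)
  assume nK: "\<not> K a b"
  have gp: "general_position V p" by (rule generic_imp_general_position[OF gen])
  define bent where "bent j \<longleftrightarrow> (\<exists>a\<in>f j - f (Suc j). \<exists>b\<in>f (Suc j) - f j. \<not> K a b)" for j
  have card_wall: "card (f j \<inter> f (Suc j)) = CARD('n)" if "j < n" for j
  proof -
    have "card (f j \<inter> f (Suc j)) = d" using geo that by (simp add: geodesic_def gallery_def)
    then show ?thesis using d by (rule trans)
  qed
  then have "\<exists>\<sigma> :: 'n \<Rightarrow> 'a. inj \<sigma> \<and> range \<sigma> = f j \<inter> f (Suc j)" if "j < n" for j
    using that obtain_enumeration by metis
  then obtain \<sigma> :: "nat \<Rightarrow> 'n \<Rightarrow> 'a" where \<sigma>: "\<And>j. j < n \<Longrightarrow> inj (\<sigma> j)"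
      "\<And>j. j < n \<Longrightarrow> range (\<sigma> j) = f j \<inter> f (Suc j)"
    by metis
  have ch: "f j \<subseteq> V" "card (f j) = CARD('n) + 1" "is_clique (f j)" if "j \<le> n" for j
  proof -
    have "is_clique (f j)" "card (f j) = d + 1" using geodesic_chamber[OF geo that]
      by (simp_all add: chamber_def)
    then show "f j \<subseteq> V" "card (f j) = CARD('n) + 1" "is_clique (f j)"
      unfolding d by (simp_all add: is_clique_def)
  qed
  have Kf: "K x y" if "j \<le> n" "x \<in> f j" "y \<in> f j" for j x y
    using ch(3)[OF that(1)] that(2,3) LK by (cases "x = y") (auto simp: is_clique_def K_def)
  have main: "\<exists>h. euclidean_isometry h \<and> (\<forall>x\<in>f k. h (p x) = q x) \<and>
      q v = h (reflections (map \<sigma> (filter bent [k..<n])) p (p v))" if "k \<le> n" for k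
    using that
  proof (induction k rule: inc_induct)
    case base
    obtain h where "euclidean_isometry h" "\<forall>x\<in>f n. h (p x) = q x"
      using frame_isometry[OF gp ch(1,2)[of n], of q] Kf[of n] unfolding K_def by blast
    moreover have "v \<in> f n" using geo by (simp add: geodesic_def gallery_def)
    ultimately show ?case by auto
  next
    case (step k)
    obtain h1 where h1: "euclidean_isometry h1" "\<And>x. x \<in> f (Suc k) \<Longrightarrow> h1 (p x) = q x"
      and v1: "q v = h1 (reflections (map \<sigma> (filter bent [Suc k..<n])) p (p v))" using step.IH
        by blast
    have kn: "k < n" "k \<le> n" "Suc k \<le> n" using step.hyps by auto
    obtain h where h: "euclidean_isometry h" "\<And>x. x \<in> f k \<Longrightarrow> h (p x) = q x"
      using frame_isometry[OF gp ch(1,2)[OF kn(2)], of q] Kf[OF kn(2)] unfolding K_def by blast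
    obtain S a b where w: "f k = insert a S" "f (Suc k) = insert b S" "a \<notin> S" "b \<notin> S" "a \<noteq> b"
      "card S = d" "S \<subseteq> V" "a \<in> V" "b \<in> V" "is_clique S"
      "\<And>s. s \<in> S \<Longrightarrow> {a, s} \<in> L" "\<And>s. s \<in> S \<Longrightarrow> {b, s} \<in> L" by (rule geodesic_wall[OF geo kn(1)]) blast
    have bent: "bent k \<longleftrightarrow> \<not> K a b" using w(1-5) by (auto simp: bent_def)
    have Kb: "K b s" if "s \<in> S" for s using LK w(12) that by blast
    have upt: "[k..<n] = k # [Suc k..<n]" using kn by (simp add: upt_conv_Cons)
    have unique: "h1 y = y'" if "\<And>s. s \<in> f (Suc k) \<Longrightarrow> norm (y - p s) = norm (y' - q s)" for y y'
      by (rule isometry_eq_of_distances[OF gp ch(1,2)[OF kn(3)] h1]) (use that in auto)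
    show ?case
    proof (cases "K a b")
      case True
      have Kbk: "norm (p b - p s) = norm (q b - q s)" if "s \<in> f k" for s
      proof (cases "s = a")
        case True
        then show ?thesis using \<open>K a b\<close> by (simp add: K_def norm_minus_commute)
      next
        case False
        then show ?thesis using Kb[of s] that w(1) by (simp add: K_def)
      qed
      have "h (p b) = q b"
        by (rule isometry_eq_of_distances[OF gp ch(1,2)[OF kn(2)] h]) (use Kbk in auto)
      then have hS: "h (p s) = q s" if "s \<in> f (Suc k)" for s using that w(1,2) h(2) by auto
      have "h1 y = h y" for y
        by (rule unique) (use h(1) hS in \<open>simp add: euclidean_isometry_def flip: hS\<close>)
      then show ?thesis using h v1 bent True upt by auto
    next
      case False
      \<comment> \<open>\<open>y\<close> is the point that \<open>h\<close> takes to
        \<open>q b\<close>. It has the distances of \<open>p b\<close> to the wall but is not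
        \<open>p b\<close>, so it is the mirror image, and the isometry of the next chamber is the
        reflection followed by \<open>h\<close>.\<close>
      obtain y where y: "h y = q b" using h(1) by (metis euclidean_isometry_def surjD)
      have rS: "range (\<sigma> k) = S" using \<sigma>(2)[OF kn(1)] w(1-5) by auto
      have \<sigma>S: "\<sigma> k j \<in> S" for j using rS by blast
      have yS: "norm (p b - p (\<sigma> k j)) = norm (y - p (\<sigma> k j))" for j
      proof -
        have "norm (y - p (\<sigma> k j)) = norm (h y - h (p (\<sigma> k j)))" using h(1)
          by (simp add: euclidean_isometry_def)
        also have "\<dots> = norm (q b - q (\<sigma> k j))" using h(2) y w(1) \<sigma>S by simp
        finally show ?thesis using Kb[OF \<sigma>S] by (simp add: K_def)
      qed
      define R where "R = reflect (\<lambda>j. p (\<sigma> k j))"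
      have "y = p b \<or> y = R (p b)"
        unfolding R_def
        by (rule equidistant_imp_reflect[OF gp \<sigma>(1)[OF kn(1)] _ w(8)]) (use rS w yS in auto)
      moreover have "y \<noteq> p b"
      proof
        assume "y = p b"
        then have "norm (h (p a) - h (p b)) = norm (q a - q b)" using y h(2) w(1) by simp
        then show False using False h(1) by (simp add: K_def euclidean_isometry_def)
      qed
      ultimately have hb: "h (R (p b)) = q b" using y by simp
      have nz: "normal (\<lambda>j. p (\<sigma> k j)) \<noteq> 0"
        using inner_normal_nonzero[OF gp \<sigma>(1)[OF kn(1)] _ w(8)] rS w(3,7) by force
      have Riso: "norm (R y - R y') = norm (y - y')" for y y'
        unfolding R_def reflect_def by (rule norm_refl_plane_diff[OF nz])
      have RS: "R (p s) = p s" if s: "s \<in> S" for s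
      proof -
        obtain j where "s = \<sigma> k j" using s rS by blast
        then show ?thesis unfolding R_def using reflect_point[of "\<lambda>j. p (\<sigma> k j)" j] by simp
      qed
      have hR: "h (R (p s)) = q s" if "s \<in> f (Suc k)" for s
        using that w(1,2) hb RS h(2) by auto
      have "h1 y = h (R y)" for y
      proof (rule unique)
        fix s assume "s \<in> f (Suc k)"
        from hR[OF this] have "norm (h (R y) - q s) = norm (h (R y) - h (R (p s)))" by simp
        then show "norm (y - p s) = norm (h (R y) - q s)"
          using h(1) Riso by (simp add: euclidean_isometry_def)
      qed
      then show ?thesis using h v1 bent False upt by (auto simp: R_def)
    qed
  qed
  obtain h where h: "euclidean_isometry h" "\<And>x. x \<in> f 0 \<Longrightarrow> h (p x) = q x"
    "q v = h (reflections (map \<sigma> (filter bent [0..<n])) p (p v))" using main[of 0] by blast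
  have "u \<in> f 0" using geo by (simp add: geodesic_def gallery_def)
  then have "q u = h (p u)" using h(2) by simp
  then have eq: "norm (p u - reflections (map \<sigma> (filter bent [0..<n])) p (p v)) = norm (p u - p v)"
    using h(1,3) uv(4) by (simp add: K_def euclidean_isometry_def)
  have "bent i" using nK ab by (auto simp: bent_def)
  then have "i \<in> set (filter bent [0..<n])" using i by simp
  then obtain j js where js: "filter bent [0..<n] = j # js" by (cases "filter bent [0..<n]") auto
  have sorted: "sorted_wrt (<) (j # js)" unfolding js[symmetric] by (rule sorted_wrt_filter) simp
  have set_js: "k < n \<and> bent k" if "k \<in> set (j # js)" for k using that unfolding js[symmetric]
    by auto
  \<comment> \<open>\<open>j\<close> is the first bent wall. If another one follows,
    \<open>geodesic_wall_pivot\<close> at the next one covers all later ones; otherwise any vertex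
    of the wall will do, as d is positive.\<close>
  have "\<exists>w\<in>f j \<inter> f (Suc j). \<forall>k\<in>set js. w \<notin> f k \<inter> f (Suc k)"
  proof (cases js)
    case Nil
    have "card (f j \<inter> f (Suc j)) = CARD('n)" using card_wall set_js[of j] by simp
    then have "f j \<inter> f (Suc j) \<noteq> {}" by (metis card.empty zero_less_card_finite less_irrefl)
    then show ?thesis using Nil by auto
  next
    case (Cons k ks)
    then have jk: "j < k" "k < n" "bent k" using sorted set_js by auto
    then obtain a b where ab: "a \<in> f k - f (Suc k)" "b \<in> f (Suc k) - f k" "\<not> K a b"
      by (auto simp: bent_def)
    then have "{a, b} \<notin> L" using LK by blast
    from geodesic_wall_pivot[OF geo jk(1,2) ab(1,2) this] obtain w where
      w: "w \<in> f j \<inter> f (Suc j)" "\<And>l. k \<le> l \<Longrightarrow> l < n \<Longrightarrow> w \<notin> f l \<inter> f (Suc l)" by blast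
    have "w \<notin> f l \<inter> f (Suc l)" if "l \<in> set js" for l
      using w(2)[of l] set_js[of l] that sorted Cons by (auto simp: less_imp_le)
    then show ?thesis using w(1) by blast
  qed
  then obtain w where w: "w \<in> f j \<inter> f (Suc j)" "\<And>k. k \<in> set js \<Longrightarrow> w \<notin> f k \<inter> f (Suc k)" by blast
  have "norm (p u - reflections (\<sigma> j # map \<sigma> js) p (p v)) \<noteq> norm (p u - p v)"
  proof (rule generic_reflections_change_distance[OF gen uv(1-3)])
    fix \<tau> assume "\<tau> \<in> set (\<sigma> j # map \<sigma> js)"
    then obtain k where k: "k \<in> set (j # js)" "\<tau> = \<sigma> k" by auto
    then have "k < n" using set_js by blast
    then show "inj \<tau> \<and> range \<tau> \<subseteq> V \<and> u \<notin> range \<tau> \<and> v \<notin> range \<tau>"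
      using \<sigma>[of k] k(2) ch(1)[of k] geodesic_start[OF geo, of "Suc k"] geodesic_end[OF geo, of k]
        by auto
  next
    show "w \<in> range (\<sigma> j)" using w(1) \<sigma>(2) set_js[of j] by simp
    show "w \<notin> range \<tau>" if "\<tau> \<in> set (map \<sigma> js)" for \<tau>
      using that w(2) \<sigma>(2) set_js by auto
  qed
  then show False using eq js by simp
qed

text \<open>Reflect the side \<open>B\<close> in the hyperplane through \<open>S\<close>. Edges keep
  their lengths since none joins \<open>A\<close> to \<open>B\<close>, while \<open>a\<close> and
  \<open>b\<close>, both off the mirror, change their distance.\<close>

lemma reflection_not_globally_linked:
  fixes p :: "'a \<Rightarrow> real ^ 'n"
  assumes gen: "generic V p" and EV: "\<And>e. e \<in> E \<Longrightarrow> e \<subseteq> V" and sep: "separation V E A S B"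
    and card: "card S = CARD('n)" and ab: "a \<in> A" "b \<in> B"
  shows "\<not> globally_linked TYPE('n) V E a b"
proof
  assume gl: "globally_linked TYPE('n) V E a b"
  note gp = generic_imp_general_position[OF gen]
  obtain \<sigma> :: "'n \<Rightarrow> 'a" where \<sigma>: "inj \<sigma>" "range \<sigma> = S" using obtain_enumeration card by metis
  have V: "V = A \<union> S \<union> B" and dis: "A \<inter> S = {}" "A \<inter> B = {}" "S \<inter> B = {}"
    and nE: "\<And>a b. a \<in> A \<Longrightarrow> b \<in> B \<Longrightarrow> {a, b} \<notin> E" using sep by (simp_all add: separation_def)
  have inner: "normal (\<lambda>i. p (\<sigma> i)) \<bullet> (p y - p (\<sigma> undefined)) \<noteq> 0" if "y \<in> A \<union> B" for y
    by (rule inner_normal_nonzero[OF gp \<sigma>(1)]) (use \<sigma> V dis that in auto)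
  have nz: "normal (\<lambda>i. p (\<sigma> i)) \<noteq> 0" using inner[of a] ab by auto
  define R where "R = reflect (\<lambda>i. p (\<sigma> i))"
  define q where "q x = (if x \<in> B then R (p x) else p x)" for x
  have RS: "R (p s) = p s" if s: "s \<in> S" for s
  proof -
    obtain j where "s = \<sigma> j" using s \<sigma> by blast
    then show ?thesis unfolding R_def using reflect_point[of "\<lambda>j. p (\<sigma> j)" j] by simp
  qed
  have Riso: "norm (R y - R y') = norm (y - y')" for y y'
    unfolding R_def reflect_def by (rule norm_refl_plane_diff[OF nz])
  have "equivalent E p q"
    unfolding equivalent_def
  proof (intro allI impI)
    fix x y assume xy: "{x, y} \<in> E"
    have yx: "{y, x} \<in> E" using xy by (simp add: insert_commute)
    have "x \<in> V" "y \<in> V" using EV[OF xy] by auto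
    then consider "x \<in> B \<union> S" "y \<in> B \<union> S" | "x \<notin> B" "y \<notin> B"
      using V nE xy yx by blast
    then show "norm (p x - p y) = norm (q x - q y)"
    proof cases
      case 1
      then have "q x = R (p x)" "q y = R (p y)" using RS by (auto simp: q_def)
      then show ?thesis using Riso by simp
    qed (simp add: q_def)
  qed
  then have "norm (p a - p b) = norm (q a - q b)" using gl gen unfolding globally_linked_def
    by blast
  moreover have "a \<notin> B" using ab dis by blast
  ultimately have "(norm (p a - R (p b)))\<^sup>2 = (norm (p a - p b))\<^sup>2" using ab by (simp add: q_def)
  then have "4 * (normal (\<lambda>i. p (\<sigma> i)) \<bullet> (p a - p (\<sigma> undefined))) * (normal (\<lambda>i. p (\<sigma> i)) \<bullet> (p b - p (\<sigma> undefined))) = 0"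
    unfolding R_def reflect_def norm_diff_refl_plane[OF nz] using nz by simp
  then show False using inner[of a] inner[of b] ab by simp
qed

lemma kappa_mono:
  assumes "finite V" "E \<subseteq> E'"
  shows "kappa V E x y \<le> kappa V E' x y"
proof -
  have path: "is_path V E' x y xs" if "is_path V E x y xs" for xs
    using that assms(2) unfolding is_path_def by (auto intro: successively_mono)
  have "internally_disjoint_paths V E' x y \<P>" if "internally_disjoint_paths V E x y \<P>" for \<P>
    using that path unfolding internally_disjoint_paths_def by simp
  then have "{card \<P> |\<P>. internally_disjoint_paths V E x y \<P>} \<subseteq> {card \<P> |\<P>. internally_disjoint_paths V E' x y \<P>}"
    by auto
  moreover have "{card \<P> |\<P>. internally_disjoint_paths V E x y \<P>} \<noteq> {}"
    by (auto simp: internally_disjoint_paths_def intro: exI[of _ "{}"])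
  ultimately show ?thesis
    unfolding kappa_def using finite_kappa_set[OF assms(1)] by (intro Max_mono)
qed

lemma separation_antimono: "separation V E' A S B \<Longrightarrow> E \<subseteq> E' \<Longrightarrow> separation V E A S B"
  unfolding separation_def by blast

theorem theorem4p7:
  fixes V :: "'a set" and E :: "'a set set" and u v :: 'a
  assumes "simple_graph V E"
    and "u \<in> V" and "v \<in> V" and "u \<noteq> v" and "{u, v} \<notin> E"
    and "d_joined TYPE('n::finite) V E"
  shows "d_joined TYPE('n) V (insert {u, v} E)"
proof -
  let ?E = "insert {u, v} E" and ?d = "CARD('n)"
  have fin: "finite V" and EV: "\<And>e. e \<in> E \<Longrightarrow> e \<subseteq> V" and card2: "\<And>e. e \<in> E \<Longrightarrow> card e = 2"
    using assms(1) by (auto simp: simple_graph_def)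
  have EV': "\<And>e. e \<in> ?E \<Longrightarrow> e \<subseteq> V" using EV assms(2,3) by auto
  have cardV: "?d + 1 \<le> card V" and rig: "rigid TYPE('n) V E"
    and gl: "\<And>x y. x \<in> V \<Longrightarrow> y \<in> V \<Longrightarrow> x \<noteq> y \<Longrightarrow>
      globally_linked TYPE('n) V E x y \<longleftrightarrow> {x, y} \<in> E \<or> ?d + 1 \<le> kappa V E x y"
    using assms(6) by (auto simp: d_joined_def)
  have eqv: "equivalent E p q" if "equivalent ?E p q" for p q :: "'a \<Rightarrow> real ^ 'n"
    using that by (auto simp: equivalent_def)
  have rig': "rigid TYPE('n) V ?E" using rig eqv unfolding rigid_def by meson
  have "globally_linked TYPE('n) V ?E x y \<longleftrightarrow> {x, y} \<in> ?E \<or> ?d + 1 \<le> kappa V ?E x y"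
    if xy: "x \<in> V" "y \<in> V" "x \<noteq> y" for x y
  proof (cases "\<exists>p :: 'a \<Rightarrow> real ^ 'n. generic V p")
    case False
    then have "globally_linked TYPE('n) V E' x y" for E' unfolding globally_linked_def by blast
    moreover have "kappa V E x y \<le> kappa V ?E x y" by (rule kappa_mono[OF fin]) blast
    ultimately show ?thesis using gl[OF xy] by (auto intro: order_trans)
  next
    case True
    then obtain p0 :: "'a \<Rightarrow> real ^ 'n" where p0: "generic V p0" by blast
    obtain p1 :: "'a \<Rightarrow> real ^ 'n" where p1: "generic V p1" "inf_rigid V E p1"
      using rigid_imp_inf_rigid[OF fin EV rig p0] by blast
    note gp1 = generic_imp_general_position[OF p1(1)]
    have cV: "?d < card V" using cardV by simp
    define L where "L = {{x, y} | x y. x \<in> V \<and> y \<in> V \<and> x \<noteq> y \<and> globally_linked TYPE('n) V E x y}"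
    have gl_sym: "globally_linked TYPE('n) V E x y \<Longrightarrow> globally_linked TYPE('n) V E y x" for x y
      unfolding globally_linked_def by (metis norm_minus_commute)
    have L_iff: "{x, y} \<in> L \<longleftrightarrow> globally_linked TYPE('n) V E x y" if "x \<in> V" "y \<in> V" "x \<noteq> y" for x y
      using that gl_sym unfolding L_def by (auto simp: doubleton_eq_iff)
    have gl_edge: "globally_linked TYPE('n) V E x y" if "{x, y} \<in> E" for x y
      using that unfolding globally_linked_def equivalent_def by blast
    have EL: "E \<subseteq> L"
    proof
      fix e assume e: "e \<in> E"
      obtain a b where ab: "e = {a, b}" "a \<noteq> b" using card2[OF e] by (auto simp: card_2_iff)
      then show "e \<in> L" using L_iff[of a b] EV[OF e] gl_edge[of a b] e by auto
    qed
    have connE: "?d \<le> card S" if "separation V E A S B" for A S B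
      by (rule inf_rigid_connectivity[OF fin cV gp1 _ p1(2) that]) (use EV in auto)
    \<comment> \<open>By reflection no pair across \<open>S\<close> is globally linked, so the pairs
      that \<open>L\<close> adds to \<open>E\<close> destroy no separator of d vertices.\<close>
    have sepL: "separation V L A S B" if s: "separation V E A S B" "card S = ?d" for A S B
    proof -
      have "{a, b} \<notin> L" if "a \<in> A" "b \<in> B" for a b
      proof -
        have "a \<in> V" "b \<in> V" "a \<noteq> b" using s(1) that by (auto simp: separation_def)
        moreover have "\<not> globally_linked TYPE('n) V E a b"
          by (rule reflection_not_globally_linked[OF p0 _ s that]) (use EV in auto)
        ultimately show ?thesis using L_iff by blast
      qed
      then show ?thesis using s(1) by (simp add: separation_def)
    qed
    \<comment> \<open>Here d-joinedness of \<open>G\<close> enters: a pair that is not linked has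
      \<open>kappa\<close> at most d, and since separators have at least d vertices, Menger provides
      one with exactly d.\<close>
    have sepsE: "\<exists>A S B. separation V E A S B \<and> card S = ?d \<and> x \<in> A \<and> y \<in> B"
      if xy: "x \<in> V" "y \<in> V" "x \<noteq> y" "{x, y} \<notin> L" for x y
    proof (rule ccontr)
      assume no: "\<not> ?thesis"
      have nE: "{x, y} \<notin> E" using EL xy by blast
      have "?d + 1 \<le> kappa V E x y"
      proof (rule menger[OF fin xy(1-3) nE])
        fix A S B assume s: "separation V E A S B" "x \<in> A" "y \<in> B"
        then have "card S \<noteq> ?d" using no by blast
        then show "?d + 1 \<le> card S" using connE[OF s(1)] by simp
      qed
      then show False using gl[OF xy(1-3)] L_iff[OF xy(1-3)] xy(4) by blast
    qed
    interpret clique_separated_graph V L ?d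
    proof
      show "finite V" "?d < card V" by fact+
      show "?d \<le> card S" if "separation V L A S B" for A S B
        using connE separation_antimono[OF that EL] by blast
      show "\<exists>A S B. separation V L A S B \<and> card S = ?d \<and> x \<in> A \<and> y \<in> B"
        if "x \<in> V" "y \<in> V" "x \<noteq> y" "{x, y} \<notin> L" for x y
        using sepsE[OF that] sepL by blast
      \<comment> \<open>A nonadjacent pair inside \<open>S\<close> would be separated by d vertices,
        and that separation would cross \<open>S\<close>.\<close>
      show "{s, t} \<in> L" if S: "separation V L A S B" "card S = ?d" and st: "s \<in> S" "t \<in> S" "s \<noteq> t"
          for A S B s t
      proof (rule ccontr)
        assume nL: "{s, t} \<notin> L"
        have "s \<in> V" "t \<in> V" using S(1) st by (auto simp: separation_def)
        then obtain C T D where T: "separation V E C T D" "card T = ?d" "s \<in> C" "t \<in> D"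
          using sepsE[OF _ _ st(3) nL] by blast
        have "S \<inter> C \<noteq> {}" "S \<inter> D \<noteq> {}" using T st by blast+
        then show False
          using no_crossing[OF fin cV gp1 _ p1(2) separation_antimono[OF S(1) EL] T(1) S(2) T(2)] EV
            by blast
      qed
    qed
    have sepE: "separation V E A S B" if "separation V ?E A S B" for A S B
      using separation_antimono[OF that] by blast
    show ?thesis
    proof
      \<comment> \<open>A separator of d vertices in the enlarged graph would permit a reflection,
        and smaller ones are excluded already in \<open>G\<close>; so Menger yields d + 1
        paths.\<close>
      assume glE: "globally_linked TYPE('n) V ?E x y"
      show "{x, y} \<in> ?E \<or> ?d + 1 \<le> kappa V ?E x y"
      proof (cases "{x, y} \<in> ?E")
        case False
        have "?d + 1 \<le> kappa V ?E x y"
        proof (rule menger[OF fin xy False])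
          fix A S B assume s: "separation V ?E A S B" "x \<in> A" "y \<in> B"
          have "card S \<noteq> ?d"
            using reflection_not_globally_linked[OF p0 EV' s(1) _ s(2,3)] glE by blast
          then show "?d + 1 \<le> card S" using connE[OF sepE[OF s(1)]] by simp
        qed
        then show ?thesis ..
      qed simp
    next
      assume "{x, y} \<in> ?E \<or> ?d + 1 \<le> kappa V ?E x y"
      then show "globally_linked TYPE('n) V ?E x y"
      proof
        assume "{x, y} \<in> ?E"
        then show ?thesis unfolding globally_linked_def equivalent_def by blast
      next
        assume \<kappa>: "?d + 1 \<le> kappa V ?E x y"
        show ?thesis
          unfolding globally_linked_def
        proof (intro allI impI, rule ccontr)
          fix p q :: "'a \<Rightarrow> real ^ 'n"
          assume pq: "generic V p \<and> equivalent ?E p q" and nK: "norm (p x - p y) \<noteq> norm (q x - q y)"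
          define K where "K a b \<longleftrightarrow> norm (p a - p b) = norm (q a - q b)" for a b
          have gp: "general_position V p" using generic_imp_general_position pq by blast
          have LK: "K a b" if "{a, b} \<in> L" for a b
          proof -
            have "globally_linked TYPE('n) V E a b"
              using that gl_sym unfolding L_def by (auto simp: doubleton_eq_iff)
            then show ?thesis using pq eqv unfolding globally_linked_def K_def by blast
          qed
          have Kuv: "K u v" using pq unfolding equivalent_def K_def by blast
          have "\<exists>A S B. sep A S B \<and> x \<in> A \<and> y \<in> B \<and> \<not> (u \<in> A \<and> v \<in> B) \<and> \<not> (u \<in> B \<and> v \<in> A)"
          proof (rule separation_not_crossed[where K = K])
            show "K a b" if "{a, b} \<in> L" for a b by (rule LK[OF that])
            show "K b a" if "K a b" for a b using that by (simp add: K_def norm_minus_commute)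
            show "K a a" for a by (simp add: K_def)
            show "u \<in> V" "v \<in> V" "x \<in> V" "y \<in> V" by fact+
            show "\<not> K x y" using nK by (simp add: K_def)
            show "K a e" if S: "S \<subseteq> V" "card S = ?d" "is_clique S" "a \<in> V" "c \<in> V" "e \<in> V" "c \<notin> S"
              "\<And>s. s \<in> S \<Longrightarrow> K a s \<and> K c s \<and> K e s" "K a c" "K c e" for S a c e
            proof -
              have "K s t" if "s \<in> S" "t \<in> S" for s t
                using S(3) that LK unfolding is_clique_def by (cases "s = t") (auto simp: K_def)
              moreover have "finite S" using S(1) fin finite_subset by blast
              ultimately show ?thesis
                using preserved_distance_trans[OF gp S(1,2) _ S(5,7), of q a e] S(8-10)
                unfolding K_def by blast
            qed
            show "K a b" if "geodesic u v n f" "i < n" "a \<in> f i - f (Suc i)" "b \<in> f (Suc i) - f i"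
                for n f i a b
              using geodesic_straight[OF refl conjunct1[OF pq] _ assms(2-4) _ that, of q] LK Kuv
              unfolding K_def by blast
          qed
          then obtain A S B where S: "separation V L A S B" "card S = ?d" "x \<in> A" "y \<in> B"
            and uv: "\<not> (u \<in> A \<and> v \<in> B)" "\<not> (u \<in> B \<and> v \<in> A)" by blast
          \<comment> \<open>\<open>u\<close> and \<open>v\<close> are not on opposite sides, so the
            new edge does not join \<open>A\<close> to \<open>B\<close> and \<open>S\<close> still
            bounds \<open>kappa\<close> by d.\<close>
          have "separation V E A S B" by (rule separation_antimono[OF S(1) EL])
          then have "separation V ?E A S B"
            using uv by (auto simp: separation_def doubleton_eq_iff)
          then have "kappa V ?E x y \<le> card S" by (rule kappa_le_card_separation[OF fin _ S(3,4)])
          then show False using \<kappa> S(2) by simp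
        qed
      qed
    qed
  qed
  then show ?thesis using cardV rig' by (auto simp: d_joined_def)
qed

end
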